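(* Let $\mu$ be a partition with $m_1(\mu)=0$ and weight $|\mu|=k$. For positive integers $p,q$ with $k\le pq$, let $\lambda=p\times q$ denote the rectangular partition having exactly $p$ parts, all equal to $q$. Then the quantity $(-1)^{k}\, z_{\mu}\, \theta^{\lambda}_{\mu,1^{pq-k}}(\alpha)$ is a polynomial in the indeterminates $p$, $-q$ and $\beta=\alpha-1$, with nonnegative rational coefficients. That is, there exists a polynomial $P_\mu(X,Y,Z)\in\mathbf{Q}[X,Y,Z]$ with nonnegative coefficients, depending only on $\mu$, such that $$(-1)^{k}\, z_{\mu}\, \theta^{p\times q}_{\mu,1^{pq-k}}(\alpha)=P_\mu(p,-q,\alpha-1)$$ for all positive integers $p,q$ with $pq\ge k$.
   Context: A partition is a finite weakly decreasing sequence of positive integers; $|\mu|$ is the sum of its parts, $l(\mu)$ the number of parts, $m_i(\mu)$ the number of parts equal to $i$, and $z_\mu=\prod_{i\ge1} i^{m_i(\mu)}m_i(\mu)!$. The partition $(\mu,1^{r})$ is obtained from $\mu$ by adding $r$ parts equal to $1$. Let $\alpha$ be an indeterminate and let $\mathbf{S}$ be the algebra of symmetric functions (in infinitely many variables) with coefficients in $\mathbf{Q}(\alpha)$. Let $p_k=\sum_i x_i^k$ be the power sums, $p_\rho=\prod_i p_{\rho_i}$, and let $\langle\,,\,\rangle$ be the scalar product with $\langle p_\lambda,p_\mu\rangle=\delta_{\lambda\mu}\,\alpha^{l(\lambda)}z_\lambda$. The Jack symmetric functions $J_\lambda=J_\lambda(\alpha)$ (integral form) are the unique family which is orthogonal for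 $\langle\,,\,\rangle$, such that $J_\lambda$ is a linear combination of monomial symmetric functions $m_\mu$ with $\mu\le\lambda$ in dominance order, and normalized so that the coefficient of $m_{1^{|\lambda|}}$ in $J_\lambda$ is $|\lambda|!$. The coefficients $\theta^\lambda_\rho=\theta^\lambda_\rho(\alpha)$ are defined by $$J_\lambda(\alpha)=\sum_{|\rho|=|\lambda|}\theta^\lambda_\rho(\alpha)\,p_\rho .$$ *)

theory Defs
  imports
    "HOL-Computational_Algebra.Computational_Algebra"
    "HOL-Library.Poly_Mapping"
begin

section \<open>Formal power series in countably many variables\<close>

text \<open>
  A monomial $\prod_i x_i^{a_i}$ is a finitely supported exponent map; a power series assigns an
  arbitrary coefficient to every monomial, so that infinite sums such as $\sum_i x_i^k$ exist.
\<close>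

type_synonym expo = "nat \<Rightarrow>\<^sub>0 nat"

typedef 'a mps = "UNIV :: (expo \<Rightarrow> 'a) set"
  morphisms mps_coeff Abs_mps ..

setup_lifting type_definition_mps

definition splits :: "expo \<Rightarrow> (expo \<times> expo) set" where
  "splits a = {(b, c). b + c = a}"

lemma finite_splits [simp]: "finite (splits a)"
proof -
  define A where "A = {b. \<exists>c. b + c = a}"
  define M where "M = Max (insert 0 (Poly_Mapping.lookup a ` Poly_Mapping.keys a))"
  have "Poly_Mapping.lookup b \<in> {f. \<forall>x. (x \<in> Poly_Mapping.keys a \<longrightarrow> f x \<in> {..M}) \<and>
      (x \<notin> Poly_Mapping.keys a \<longrightarrow> f x = 0)}" if "b \<in> A" for b
  proof -
    from that obtain c where "b + c = a"
      by (auto simp: A_def)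
    then have le: "Poly_Mapping.lookup b x \<le> Poly_Mapping.lookup a x" for x
      by (auto simp: lookup_add)
    have M: "Poly_Mapping.lookup a x \<le> M" if "x \<in> Poly_Mapping.keys a" for x
      unfolding M_def using that by (intro Max_ge) auto
    have "Poly_Mapping.lookup b x = 0" if "x \<notin> Poly_Mapping.keys a" for x
      using le[of x] that by (simp add: in_keys_iff)
    then show ?thesis
      using order_trans[OF le M] by simp
  qed
  then have "Poly_Mapping.lookup ` A \<subseteq> {f. \<forall>x. (x \<in> Poly_Mapping.keys a \<longrightarrow> f x \<in> {..M}) \<and>
      (x \<notin> Poly_Mapping.keys a \<longrightarrow> f x = 0)}"
    by (rule image_subsetI)
  then have "finite (Poly_Mapping.lookup ` A)"
    by (rule finite_subset) (rule finite_set_of_finite_funs, simp_all)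
  moreover have "inj_on Poly_Mapping.lookup A"
    by (rule inj_onI) (simp add: lookup_inject)
  ultimately have "finite A"
    by (rule finite_imageD)
  moreover have "splits a \<subseteq> A \<times> A"
  proof clarify
    fix b c
    assume "(b, c) \<in> splits a"
    then have "b + c = a" "c + b = a"
      by (simp_all add: splits_def add.commute)
    then show "b \<in> A \<and> c \<in> A"
      unfolding A_def by blast
  qed
  ultimately show ?thesis
    by (meson finite_SigmaI finite_subset)
qed

instantiation mps :: (comm_ring_1) comm_ring_1
begin

lift_definition zero_mps :: "'a mps" is "\<lambda>_. 0" .
lift_definition one_mps :: "'a mps" is "\<lambda>a. if a = 0 then 1 else 0" .
lift_definition plus_mps :: "'a mps \<Rightarrow> 'a mps \<Rightarrow> 'a mps" is "\<lambda>f g a. f a + g a" .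
lift_definition minus_mps :: "'a mps \<Rightarrow> 'a mps \<Rightarrow> 'a mps" is "\<lambda>f g a. f a - g a" .
lift_definition uminus_mps :: "'a mps \<Rightarrow> 'a mps" is "\<lambda>f a. - f a" .
lift_definition times_mps :: "'a mps \<Rightarrow> 'a mps \<Rightarrow> 'a mps"
  is "\<lambda>f g a. \<Sum>(b, c)\<in>splits a. f b * g c" .

instance
proof
  fix f g h :: "'a mps"
  show "f * g * h = f * (g * h)"
  proof (transfer, rule ext)
    fix f g h :: "expo \<Rightarrow> 'a" and a :: expo
    have "(\<Sum>(b, c)\<in>splits a. (\<Sum>(d, e)\<in>splits b. f d * g e) * h c) =
        (\<Sum>((b, c), (d, e))\<in>Sigma (splits a) (\<lambda>(b, c). splits b). f d * g e * h c)"
      by (subst sum.Sigma[symmetric]) (auto simp: sum_distrib_right case_prod_beta intro!: sum.cong)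
    also have "\<dots> =
        (\<Sum>((b, c), (d, e))\<in>Sigma (splits a) (\<lambda>(b, c). splits c). f b * (g d * h e))"
      by (rule sum.reindex_bij_witness[where
            i = "\<lambda>((b, c), (d, e)). ((b + d, e), (b, d))" and
            j = "\<lambda>((b, c), (d, e)). ((d, e + c), (e, c))"])
        (auto simp: splits_def algebra_simps)
    also have "\<dots> = (\<Sum>(b, c)\<in>splits a. f b * (\<Sum>(d, e)\<in>splits c. g d * h e))"
      by (subst sum.Sigma[symmetric]) (auto simp: sum_distrib_left case_prod_beta intro!: sum.cong)
    finally show "(\<Sum>(b, c)\<in>splits a. (\<Sum>(d, e)\<in>splits b. f d * g e) * h c) =
        (\<Sum>(b, c)\<in>splits a. f b * (\<Sum>(d, e)\<in>splits c. g d * h e))" .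
  qed
  show "f * g = g * f"
  proof (transfer, rule ext)
    fix f g :: "expo \<Rightarrow> 'a" and a :: expo
    show "(\<Sum>(b, c)\<in>splits a. f b * g c) = (\<Sum>(b, c)\<in>splits a. g b * f c)"
      by (rule sum.reindex_bij_witness[where i = prod.swap and j = prod.swap])
        (auto simp: splits_def algebra_simps)
  qed
  show "1 * f = f"
  proof (transfer, rule ext)
    fix f :: "expo \<Rightarrow> 'a" and a :: expo
    have "(\<Sum>(b, c)\<in>splits a. (if b = 0 then 1 else 0) * f c) =
        (\<Sum>(b, c)\<in>{(0 :: expo, a)}. (if b = 0 then 1 else 0) * f c)"
      by (rule sum.mono_neutral_right, simp) (auto simp: splits_def split: if_splits)
    then show "(\<Sum>(b, c)\<in>splits a. (if b = 0 then 1 else 0) * f c) = f a"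
      by simp
  qed
  show "(f + g) * h = f * h + g * h"
    by transfer (simp add: distrib_right sum.distrib case_prod_unfold)
  show "(0 :: 'a mps) \<noteq> 1"
  proof (transfer, rule notI)
    assume "(\<lambda>_ :: expo. 0 :: 'a) = (\<lambda>a. if a = 0 then 1 else 0)"
    from fun_cong[OF this, of 0] show False
      by simp
  qed
  show "f + g + h = f + (g + h)" by transfer (simp add: add.assoc)
  show "f + g = g + f" by transfer (simp add: add.commute)
  show "0 + f = f" by transfer simp
  show "- f + f = 0" by transfer simp
  show "f - g = f + - g" by transfer simp
qed

end

lift_definition mps_scale :: "'a::comm_ring_1 \<Rightarrow> 'a mps \<Rightarrow> 'a mps" is "\<lambda>c f a. c * f a" .

global_interpretation mps: vector_space "mps_scale :: 'a::field \<Rightarrow> 'a mps \<Rightarrow> 'a mps"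
  by unfold_locales (transfer, simp add: fun_eq_iff distrib_left distrib_right mult.assoc)+


section \<open>Partitions\<close>

definition is_partition :: "nat list \<Rightarrow> bool" where
  "is_partition \<mu> \<longleftrightarrow> sorted_wrt (\<ge>) \<mu> \<and> 0 \<notin> set \<mu>"

definition partitions :: "nat list set" where
  "partitions = {\<mu>. is_partition \<mu>}"

definition dominated :: "nat list \<Rightarrow> nat list \<Rightarrow> bool" where
  "dominated \<mu> \<nu> \<longleftrightarrow>
     sum_list \<mu> = sum_list \<nu> \<and> (\<forall>i. sum_list (take i \<mu>) \<le> sum_list (take i \<nu>))"

definition zee :: "nat list \<Rightarrow> nat" where
  "zee \<mu> = (\<Prod>i\<in>set \<mu>. i ^ count_list \<mu> i * fact (count_list \<mu> i))"


section \<open>Symmetric functions\<close>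

definition symmetric_functions :: "'a::comm_ring_1 mps set" where
  "symmetric_functions = {f.
     (\<forall>\<pi> a. bij \<pi> \<longrightarrow> mps_coeff f (Poly_Mapping.map_key \<pi> a) = mps_coeff f a) \<and>
     (\<exists>d. \<forall>a. mps_coeff f a \<noteq> 0 \<longrightarrow> (\<Sum>i\<in>Poly_Mapping.keys a. Poly_Mapping.lookup a i) \<le> d)}"

text \<open>
  The monomial symmetric function is the sum of all distinct monomials whose nonzero exponents
  are, in some order, the parts of the partition.
\<close>

lift_definition monomial_sym :: "nat list \<Rightarrow> 'a::comm_ring_1 mps"
  is "\<lambda>\<mu> a. if image_mset (Poly_Mapping.lookup a) (mset_set (Poly_Mapping.keys a)) = mset \<mu> then 1 else 0" .

lift_definition power_sum :: "nat \<Rightarrow> 'a::comm_ring_1 mps"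
  is "\<lambda>k a. if \<exists>i. a = Poly_Mapping.single i k then 1 else 0" .

definition power_sum_part :: "nat list \<Rightarrow> 'a::comm_ring_1 mps" where
  "power_sum_part \<rho> = prod_list (map power_sum \<rho>)"

text \<open>
  Coordinates in the bases $(m_\mu)$ and $(p_\rho)$ of the space of symmetric functions. Both maps
  are injective on partitions, so the basis vector identifies its index.
\<close>

definition monomial_coeff :: "'a::field mps \<Rightarrow> nat list \<Rightarrow> 'a" where
  "monomial_coeff f \<mu> = mps.representation (monomial_sym ` partitions) f (monomial_sym \<mu>)"

definition power_sum_coeff :: "'a::field mps \<Rightarrow> nat list \<Rightarrow> 'a" where
  "power_sum_coeff f \<rho> = mps.representation (power_sum_part ` partitions) f (power_sum_part \<rho>)"


section \<open>Jack symmetric functions\<close>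

text \<open>The field of rational functions in one indeterminate over the rationals.\<close>

type_synonym ratfun = "rat poly fract"

definition alpha :: ratfun where
  "alpha = Fract [:0, 1:] 1"

text \<open>
  The bilinear extension of
  $\langle p_\lambda, p_\mu\rangle = \delta_{\lambda\mu} \alpha^{l(\lambda)} z_\lambda$.
\<close>

definition jack_scalar :: "ratfun mps \<Rightarrow> ratfun mps \<Rightarrow> ratfun" where
  "jack_scalar f g =
     (\<Sum>\<rho> | \<rho> \<in> partitions \<and> power_sum_coeff f \<rho> \<noteq> 0 \<and> power_sum_coeff g \<rho> \<noteq> 0.
        power_sum_coeff f \<rho> * power_sum_coeff g \<rho> * (alpha ^ length \<rho> * of_nat (zee \<rho>)))"

text \<open>
  The characterisation of the integral forms $J_\lambda$. It determines the family uniquely on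
  partitions and leaves its values on other lists open.
\<close>

definition jack_family :: "(nat list \<Rightarrow> ratfun mps) \<Rightarrow> bool" where
  "jack_family J \<longleftrightarrow>
     (\<forall>\<nu>\<in>partitions. J \<nu> \<in> symmetric_functions) \<and>
     (\<forall>\<nu>\<in>partitions. \<forall>\<mu>\<in>partitions. \<nu> \<noteq> \<mu> \<longrightarrow> jack_scalar (J \<nu>) (J \<mu>) = 0) \<and>
     (\<forall>\<nu>\<in>partitions. J \<nu> \<in> mps.span (monomial_sym ` {\<mu>\<in>partitions. dominated \<mu> \<nu>})) \<and>
     (\<forall>\<nu>\<in>partitions. monomial_coeff (J \<nu>) (replicate (sum_list \<nu>) 1) = fact (sum_list \<nu>))"


section \<open>Polynomials in three indeterminates\<close>

text \<open>
  An element of $\mathbf{Q}[X,Y,Z]$ is given by its finitely supported coefficient map: the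
  exponent triple $(i,j,k)$ stands for $X^i Y^j Z^k$.
\<close>

type_synonym poly3 = "(nat \<times> nat \<times> nat) \<Rightarrow>\<^sub>0 rat"

definition eval_poly3 :: "poly3 \<Rightarrow> 'a::field_char_0 \<Rightarrow> 'a \<Rightarrow> 'a \<Rightarrow> 'a" where
  "eval_poly3 P x y z =
     (\<Sum>(i, j, k)\<in>Poly_Mapping.keys P. of_rat (Poly_Mapping.lookup P (i, j, k)) * x ^ i * y ^ j * z ^ k)"

end

theory Submission
  imports Defs "HOL-Library.Product_Plus"
begin

text \<open>
  Write $F$ for the Jack function of the rectangle $p\times q$, put $n=pq$ and let $a_k$ be
  $\alpha k\,\partial/\partial p_k$, the adjoint of multiplication by $p_k$. The proof rests on
  the fact that $F$ is a singular vector of a Virasoro algebra: for $k\ge1$ it satisfies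
  $$L_kF=0,\qquad L_k=\sum_{j\ge1}p_j\,a_{k+j}+\sum_{i+j=k}a_ia_j+(k(\alpha-1)-\alpha q+p)\,a_k .$$

  Positivity follows from these constraints. Reading the coefficient of $L_kF=0$ at $p_{\tau,1^s}$
  expresses the coefficient of $p_{\tau,k+1,1^{s-1}}$ through coefficients of $p_{\rho,1^s}$ with
  $|\rho|=|\tau|+k$, where $\rho$ may contain further parts $1$. With the factors
  $(-1)^{|\mu|}z_\mu$ included, the recurrence only involves the factors $\alpha$,
  $k(\alpha-1)-\alpha q+p$ and $|\rho|-pq$, and these are polynomials in $p$, $-q$ and $\alpha-1$
  with nonnegative coefficients (\<open>virasoro_imp_removal_recurrence\<close>,
  \<open>removal_recurrence_positive\<close>).

  The constraints are derived from orthogonality and triangularity alone. Let $I_p$ be the space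
  of symmetric functions that vanish in $p$ variables. It is spanned by the Jack functions with
  more than $p$ parts, so $F$ is orthogonal to $I_p$
  (\<open>jack_orthogonal_long_monomials\<close>). The adjoint of $L_k$ and the self-adjoint
  operator $H=\sum_kp_kL_k$ make sense in finitely many variables and therefore preserve $I_p$; so
  $HF$ and all $L_kF$ are orthogonal to $I_p$ as well. The scalar product is definite, because the
  rational functions form an ordered field in which $\alpha$ is positive. Hence it suffices to
  show that $HF$ and $L_kF$ vanish in $p$ variables.

  For $HF$ this is a computation with the single monomial $(x_1\cdots x_p)^q$. For $L_k$ one
  variable more is needed: the series $\sum_kx_0^kL_kF$ in $x_0,\dots,x_p$ has an explicit
  expression in the coefficients of $F$ (\<open>lax_coeff\<close>), and $HF=0$ determines the
  restriction of $F$ to $p+1$ variables up to a factor. It is $(x_0\cdots x_p)^q\,g_q(1/x)$ with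
  the one-row function $g_q$, since the complement of $p\times q$ in $(p+1)\times q$ is a row. For
  this function the series vanishes by a telescoping identity (\<open>lax_sum_kernel\<close>). The
  lowest power of $x_0$ then gives the constraints one after the other
  (\<open>virasoro_rectangle\<close>).
\<close>

abbreviation "lookup \<equiv> Poly_Mapping.lookup"
abbreviation "keys \<equiv> Poly_Mapping.keys"
abbreviation "single \<equiv> Poly_Mapping.single"

section \<open>Coefficients of power series\<close>

lemma mps_eqI: "(\<And>a. mps_coeff f a = mps_coeff g a) \<Longrightarrow> f = g"
  by (simp add: mps_coeff_inject[symmetric] fun_eq_iff)

lemma mps_coeff_0 [simp]: "mps_coeff 0 a = 0" by transfer simp
lemma mps_coeff_1: "mps_coeff 1 a = (if a = 0 then 1 else 0)" by transfer simp
lemma mps_coeff_add [simp]: "mps_coeff (f + g) a = mps_coeff f a + mps_coeff g a" by transfer simp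
lemma mps_coeff_diff [simp]: "mps_coeff (f - g) a = mps_coeff f a - mps_coeff g a" by transfer simp
lemma mps_coeff_scale [simp]: "mps_coeff (mps_scale c f) a = c * mps_coeff f a" by transfer simp
lemma mps_coeff_sum [simp]: "mps_coeff (sum f S) a = (\<Sum>i\<in>S. mps_coeff (f i) a)"
  by (induction S rule: infinite_finite_induct) auto
lemma mps_coeff_mult: "mps_coeff (f * g) a = (\<Sum>(b, c)\<in>splits a. mps_coeff f b * mps_coeff g c)"
  by transfer simp

lift_definition mps_const :: "'a::comm_ring_1 \<Rightarrow> 'a mps" is "\<lambda>c a. if a = 0 then c else 0" .

lift_definition mps_var_power :: "nat \<Rightarrow> nat \<Rightarrow> 'a::comm_ring_1 mps"
  is "\<lambda>i k a. if a = Poly_Mapping.single i k then 1 else 0" .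

text \<open>
  The derivation $x_i\,\partial/\partial x_i$. Only this form of differentiation is needed: it
  preserves exponents, so it acts on the coefficient of each monomial by a scalar.
\<close>

lift_definition mps_euler :: "nat \<Rightarrow> 'a::comm_ring_1 mps \<Rightarrow> 'a mps"
  is "\<lambda>i f a. of_nat (Poly_Mapping.lookup a i) * f a" .

lemma mps_coeff_euler [simp]: "mps_coeff (mps_euler i f) a = of_nat (lookup a i) * mps_coeff f a"
  by transfer simp

lemma minus_single_add: "k \<le> lookup (a :: expo) i \<Longrightarrow> single i k + (a - single i k) = a"
  by (rule poly_mapping_eqI) (auto simp: lookup_add lookup_minus lookup_single when_def)

lemma mps_coeff_var_power_mult:
  "mps_coeff (mps_var_power i k * g) a =
     (if k \<le> lookup a i then mps_coeff g (a - single i k) else 0)"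
proof -
  have "mps_coeff (mps_var_power i k * g) a =
      (\<Sum>(b, c)\<in>splits a. if b = single i k then mps_coeff g c else 0)"
    unfolding mps_coeff_mult mps_var_power.rep_eq by (rule sum.cong) auto
  also have "\<dots> = (\<Sum>(b, c)\<in>(if k \<le> lookup a i then {(single i k, a - single i k)} else {}).
      mps_coeff g c)"
  proof (rule sum.mono_neutral_cong_right)
    show "(if k \<le> lookup a i then {(single i k, a - single i k)} else {}) \<subseteq> splits a"
      by (auto simp: splits_def minus_single_add)
    show "\<forall>x\<in>splits a - (if k \<le> lookup a i then {(single i k, a - single i k)} else {}).
       (case x of (b, c) \<Rightarrow> if b = single i k then mps_coeff g c else 0) = 0"
      by (auto simp: splits_def lookup_add split: if_splits)
  qed (auto split: if_splits)
  finally show ?thesis by auto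
qed

lemma mps_const_mult: "mps_const c * g = mps_scale c g"
proof (rule mps_eqI)
  fix a
  have "mps_coeff (mps_const c * g) a = (\<Sum>(b, d)\<in>splits a. if b = 0 then c * mps_coeff g d else 0)"
    unfolding mps_coeff_mult mps_const.rep_eq by (rule sum.cong) auto
  also have "\<dots> = (\<Sum>(b, d)\<in>{(0 :: expo, a)}. c * mps_coeff g d)"
    by (rule sum.mono_neutral_cong_right[OF finite_splits]) (auto simp: splits_def split: if_splits)
  finally show "mps_coeff (mps_const c * g) a = mps_coeff (mps_scale c g) a" by simp
qed

lemma mps_const_coeff_mult [simp]: "mps_coeff (mps_const c * g) a = c * mps_coeff g a"
  by (simp add: mps_const_mult)

lemma mps_const_simps:
  fixes c d :: "'a::comm_ring_1"
  shows
  "mps_const (c + d) = mps_const c + mps_const d"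
  "mps_const (c - d) = mps_const c - mps_const d"
  "mps_const (- d) = - mps_const d"
  "mps_const (c * d) = mps_const c * mps_const d"
  "mps_const (1 :: 'a) = 1" "mps_const (0 :: 'a) = 0" "mps_const (of_nat n :: 'a) = of_nat n"
proof -
  have *: "mps_const (c + d) = mps_const c + mps_const d" for c d :: 'a
    by transfer auto
  then show "mps_const (c + d) = mps_const c + mps_const d" .
  show "mps_const (c * d) = mps_const c * mps_const d"
    by (rule mps_eqI) (simp, transfer, simp)
  show **: "mps_const (1::'a) = 1" "mps_const (0::'a) = 0"
    by (transfer, simp)+
  show "mps_const (of_nat n :: 'a) = of_nat n"
    by (induction n) (simp_all only: of_nat_0 of_nat_Suc * **)
qed (transfer, auto)+

lemma mps_scale_mult_left: "mps_scale c f * g = mps_scale c (f * g)"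
  by (metis mps_const_mult mult.assoc)
lemma mps_scale_mult_right: "f * mps_scale c g = mps_scale c (f * g)"
  by (metis mps_scale_mult_left mult.commute)

lemma mps_var_power_add: "mps_var_power i (k + l) = mps_var_power i k * mps_var_power i l"
proof (rule mps_eqI)
  fix a
  have "k \<le> lookup a i \<Longrightarrow> a - single i k = single i l \<longleftrightarrow> a = single i (k + l)"
    by (metis add.commute minus_single_add single_add add_diff_cancel_right')
  then show "mps_coeff (mps_var_power i (k + l)) a = mps_coeff (mps_var_power i k * mps_var_power i l) a"
    by (auto simp: mps_coeff_var_power_mult mps_var_power.rep_eq)
qed

lemma mps_var_power_0 [simp]: "mps_var_power i 0 = 1"
  by transfer (simp)

lemma mps_euler_sum: "mps_euler i (sum f S) = (\<Sum>x\<in>S. mps_euler i (f x))"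
  by (rule mps_eqI) (simp add: sum_distrib_left)
lemma mps_euler_scale: "mps_euler i (mps_scale c g) = mps_scale c (mps_euler i g)"
  by (rule mps_eqI) (simp add: algebra_simps)

lemma mps_euler_mult: "mps_euler i (f * g) = mps_euler i f * g + f * mps_euler i g"
proof (rule mps_eqI)
  fix a
  show "mps_coeff (mps_euler i (f * g)) a = mps_coeff (mps_euler i f * g + f * mps_euler i g) a"
    unfolding mps_coeff_euler mps_coeff_add mps_coeff_mult sum_distrib_left sum.distrib[symmetric]
    by (rule sum.cong) (auto simp: splits_def lookup_add algebra_simps)
qed

lemma mps_euler_1 [simp]: "mps_euler i 1 = 0"
  by (rule mps_eqI) (simp add: mps_coeff_1)

lemma mps_euler_var_power: "mps_euler i (mps_var_power i k) = of_nat k * mps_var_power i k"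
  unfolding mps_const_simps(7)[symmetric]
  by (rule mps_eqI) (simp add: mps_var_power.rep_eq)

lemma mps_euler_power_sum: "mps_euler i (power_sum k) = of_nat k * mps_var_power i k"
  unfolding mps_const_simps(7)[symmetric]
  by (rule mps_eqI) (auto simp: mps_var_power.rep_eq power_sum.rep_eq lookup_single when_def)

text \<open>
  Multiplication by $p_k$ is multiplication by $\sum_l x_l^k$, and at a given monomial only the
  finitely many variables occurring in it can contribute. This replaces every infinite sum over
  variables below by a finite one.
\<close>

lemma mps_coeff_power_sum_mult:
  assumes "k > 0"
  shows "mps_coeff (power_sum k * g) a = (\<Sum>l\<in>keys a. mps_coeff (mps_var_power l k * g) a)"
proof -
  have *: "(if \<exists>i. b = single i k then 1 else 0) = (\<Sum>l\<in>keys a. if b = single l k then 1 else (0::'a))"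
    if "(b, c) \<in> splits a" for b c
  proof (cases "\<exists>i. b = single i k")
    case True
    then obtain i where i: "b = single i k" by auto
    with that assms have "i \<in> keys a"
      by (auto simp: splits_def in_keys_iff lookup_add)
    moreover have "b = single l k \<longleftrightarrow> l = i" for l
      unfolding i using assms by (metis lookup_single_eq lookup_single_not_eq less_numeral_extra(3))
    ultimately show ?thesis using True by simp
  qed auto
  have "mps_coeff (power_sum k * g) a =
      (\<Sum>(b, c)\<in>splits a. (\<Sum>l\<in>keys a. if b = single l k then 1 else 0) * mps_coeff g c)"
    unfolding mps_coeff_mult power_sum.rep_eq by (rule sum.cong) (auto simp: *)
  also have "\<dots> = (\<Sum>l\<in>keys a. \<Sum>(b, c)\<in>splits a. (if b = single l k then 1 else 0) * mps_coeff g c)"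
    unfolding sum_distrib_right case_prod_unfold by (rule sum.swap)
  finally show ?thesis
    unfolding mps_coeff_mult mps_var_power.rep_eq .
qed

section \<open>Symmetric functions in power sum coordinates\<close>

definition parts_of :: "nat \<Rightarrow> nat multiset set" where
  "parts_of n = {\<rho>. 0 \<notin># \<rho> \<and> sum_mset \<rho> = n}"

lemma add_mset_parts_of: "add_mset k \<sigma> \<in> parts_of n \<longleftrightarrow> 0 < k \<and> k \<le> n \<and> \<sigma> \<in> parts_of (n - k)"
  by (auto simp: parts_of_def)

lemma parts_of_0 [simp]: "parts_of 0 = {{#}}"
proof -
  have "\<rho> = {#}" if "0 \<notin># \<rho>" "sum_mset \<rho> = 0" for \<rho> :: "nat multiset"
    using that by (cases \<rho>) auto
  then show ?thesis by (auto simp: parts_of_def)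
qed

lemma finite_parts_of [simp]: "finite (parts_of n)"
proof (induction n rule: less_induct)
  case (less n)
  have "parts_of n \<subseteq> {{#}} \<union> (\<Union>k\<in>{1..n}. add_mset k ` parts_of (n - k))"
  proof
    fix \<rho> assume "\<rho> \<in> parts_of n"
    then show "\<rho> \<in> {{#}} \<union> (\<Union>k\<in>{1..n}. add_mset k ` parts_of (n - k))"
      by (cases \<rho>) (auto simp: add_mset_parts_of)
  qed
  moreover have "finite ({{#}} \<union> (\<Union>k\<in>{1..n}. add_mset k ` parts_of (n - k)))"
    using less by auto
  ultimately show ?case by (rule finite_subset)
qed

lemma sum_parts_of_containing:
  assumes "0 < k"
  shows "(\<Sum>\<rho>\<in>{\<rho>\<in>parts_of n. k \<in># \<rho>}. F \<rho>) =
    (if k \<le> n then \<Sum>\<sigma>\<in>parts_of (n - k). F (add_mset k \<sigma>) else 0)"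
proof (cases "k \<le> n")
  case True
  have "(\<Sum>\<rho>\<in>{\<rho>\<in>parts_of n. k \<in># \<rho>}. F \<rho>) = (\<Sum>\<sigma>\<in>parts_of (n - k). F (add_mset k \<sigma>))"
    using assms True
    by (intro sum.reindex_bij_witness[where i = "add_mset k" and j = "\<lambda>\<rho>. \<rho> - {#k#}"])
      (auto simp: add_mset_parts_of dest!: multi_member_split)
  then show ?thesis using True by simp
next
  case False
  then have "{\<rho>\<in>parts_of n. k \<in># \<rho>} = {}"
    by (auto simp: add_mset_parts_of dest!: multi_member_split)
  then show ?thesis using False by (simp only: sum.empty if_False)
qed

definition power_sum_mset :: "nat multiset \<Rightarrow> 'a::comm_ring_1 mps" where
  "power_sum_mset \<rho> = prod_mset (image_mset power_sum \<rho>)"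

lemma power_sum_mset_simps [simp]:
  "power_sum_mset {#} = 1"
  "power_sum_mset (add_mset k \<rho>) = power_sum k * power_sum_mset \<rho>"
  by (simp_all add: power_sum_mset_def)

lemma power_sum_part_eq: "power_sum_part xs = power_sum_mset (mset xs)"
  by (induction xs) (auto simp: power_sum_part_def)

text \<open>
  Homogeneous symmetric functions are handled through their coefficients in the power sum basis,
  as functions on multisets of parts; only the values on \<open>parts_of n\<close> matter. In this
  form the operators $\partial/\partial p_k$, which make no sense in finitely many variables, are
  index shifts.
\<close>

definition p_expand :: "nat \<Rightarrow> (nat multiset \<Rightarrow> 'a) \<Rightarrow> 'a::comm_ring_1 mps" where
  "p_expand n f = (\<Sum>\<rho>\<in>parts_of n. mps_scale (f \<rho>) (power_sum_mset \<rho>))"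

lemma mps_scale_add_left: "mps_scale (c + d) f = mps_scale c f + mps_scale d f"
  by (rule mps_eqI) (simp add: algebra_simps)

lemma p_expand_add: "p_expand n (\<lambda>\<rho>. f \<rho> + g \<rho>) = p_expand n f + p_expand n g"
  unfolding p_expand_def by (simp add: sum.distrib mps_scale_add_left)

lemma p_expand_sum: "p_expand n (\<lambda>\<rho>. \<Sum>i\<in>S. f i \<rho>) = (\<Sum>i\<in>S. p_expand n (f i))"
  by (rule mps_eqI) (simp add: p_expand_def sum_distrib_right sum.swap[of _ S])

lemma p_expand_scale: "p_expand n (\<lambda>\<rho>. c * f \<rho>) = mps_const c * p_expand n f"
  by (rule mps_eqI) (simp add: p_expand_def sum_distrib_left mult.assoc)

text \<open>
  Multiplication by $p_k$ on coefficient functions.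
\<close>

definition raise :: "nat \<Rightarrow> (nat multiset \<Rightarrow> 'a) \<Rightarrow> nat multiset \<Rightarrow> 'a::comm_ring_1" where
  "raise k f = (\<lambda>\<rho>. if k \<in># \<rho> then f (\<rho> - {#k#}) else 0)"

lemma sum_parts_of_raise:
  assumes "0 < k" "k \<le> n" "\<And>\<rho>. G \<rho> 0 = 0"
  shows "(\<Sum>\<rho>\<in>parts_of n. G \<rho> (raise k f \<rho>)) = (\<Sum>\<sigma>\<in>parts_of (n - k). G (add_mset k \<sigma>) (f \<sigma>))"
proof -
  have "(\<Sum>\<rho>\<in>parts_of n. G \<rho> (raise k f \<rho>)) =
      (\<Sum>\<rho>\<in>{\<rho>\<in>parts_of n. k \<in># \<rho>}. G \<rho> (f (\<rho> - {#k#})))"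
    by (intro sum.mono_neutral_cong_right) (auto simp: raise_def assms)
  then show ?thesis using assms by (simp add: sum_parts_of_containing)
qed

lemma p_expand_raise:
  assumes "0 < k" "k \<le> n"
  shows "p_expand n (raise k f) = power_sum k * p_expand (n - k) f"
  unfolding p_expand_def using assms
  by (subst sum_parts_of_raise[where G = "\<lambda>\<rho> x. mps_scale x (power_sum_mset \<rho>)"])
    (auto intro!: mps_eqI sum.cong simp: sum_distrib_left mps_scale_mult_right)

lemma mps_euler_power_sum_mset:
  "mps_euler i (power_sum_mset \<rho> :: 'a::comm_ring_1 mps) =
     (\<Sum>k\<in>set_mset \<rho>. of_nat (k * count \<rho> k) * (mps_var_power i k * power_sum_mset (\<rho> - {#k#})))"
proof (induction \<rho>)
  case empty
  then show ?case by simp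
next
  case (add x \<rho>)
  let ?T = "\<lambda>\<rho> k. of_nat (k * count \<rho> k) * (mps_var_power i k * power_sum_mset (\<rho> - {#k#})) :: 'a mps"
  have "(\<Sum>k\<in>set_mset (add_mset x \<rho>). ?T (add_mset x \<rho>) k) =
     (\<Sum>k\<in>insert x (set_mset \<rho>). (if k = x then of_nat k * mps_var_power i k * power_sum_mset \<rho> else 0)
        + power_sum x * ?T \<rho> k)"
  proof (rule sum.cong)
    fix k assume "k \<in> insert x (set_mset \<rho>)"
    show "?T (add_mset x \<rho>) k = (if k = x then of_nat k * mps_var_power i k * power_sum_mset \<rho> else 0)
        + power_sum x * ?T \<rho> k"
    proof (cases "k = x")
      case True
      show ?thesis
      proof (cases "x \<in># \<rho>")
        case x: True
        then obtain \<rho>' where "\<rho> = add_mset x \<rho>'" by (meson multi_member_split)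
        then show ?thesis using True by (simp add: algebra_simps)
      next
        case False
        then have "count \<rho> x = 0" by (simp add: count_eq_zero_iff)
        then show ?thesis using True by (simp add: algebra_simps)
      qed
    next
      case False
      with \<open>k \<in> _\<close> have "k \<in># \<rho>" by auto
      then obtain \<rho>' where "\<rho> = add_mset k \<rho>'" by (meson multi_member_split)
      then have "add_mset x \<rho> - {#k#} = add_mset x (\<rho> - {#k#})"
        by (simp add: add_mset_commute[of x k])
      then show ?thesis using False by (simp add: algebra_simps)
    qed
  qed simp
  also have "\<dots> = of_nat x * mps_var_power i x * power_sum_mset \<rho> + power_sum x * (\<Sum>k\<in>set_mset \<rho>. ?T \<rho> k)"
  proof -
    have "(\<Sum>k\<in>insert x (set_mset \<rho>). ?T \<rho> k) = (\<Sum>k\<in>set_mset \<rho>. ?T \<rho> k)"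
      by (rule sum.mono_neutral_right) (auto simp: not_in_iff)
    then show ?thesis by (simp add: sum.distrib sum_distrib_left[symmetric])
  qed
  finally show ?case
    by (simp add: mps_euler_mult mps_euler_power_sum add.IH mult.assoc)
qed

definition zee_mset :: "nat multiset \<Rightarrow> nat" where
  "zee_mset \<rho> = (\<Prod>i\<in>set_mset \<rho>. i ^ count \<rho> i * fact (count \<rho> i))"

lemma zee_eq_zee_mset: "zee xs = zee_mset (mset xs)"
  by (simp add: zee_def zee_mset_def count_mset)

lemma zee_mset_empty [simp]: "zee_mset {#} = 1" by (simp add: zee_mset_def)

lemma zee_mset_add_mset [simp]: "zee_mset (add_mset k \<rho>) = k * Suc (count \<rho> k) * zee_mset \<rho>"
proof -
  let ?g = "\<lambda>\<rho> i. i ^ count \<rho> i * fact (count \<rho> i) :: nat"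
  have "zee_mset \<rho> = (\<Prod>i\<in>insert k (set_mset \<rho>). ?g \<rho> i)"
    unfolding zee_mset_def by (rule prod.mono_neutral_left) (auto simp: not_in_iff)
  also have "\<dots> = ?g \<rho> k * (\<Prod>i\<in>set_mset \<rho> - {k}. ?g \<rho> i)"
    by (simp add: prod.insert_remove)
  finally have 1: "zee_mset \<rho> = ?g \<rho> k * (\<Prod>i\<in>set_mset \<rho> - {k}. ?g \<rho> i)" .
  have "zee_mset (add_mset k \<rho>) = ?g (add_mset k \<rho>) k * (\<Prod>i\<in>set_mset \<rho> - {k}. ?g (add_mset k \<rho>) i)"
    by (simp add: zee_mset_def prod.insert_remove)
  also have "(\<Prod>i\<in>set_mset \<rho> - {k}. ?g (add_mset k \<rho>) i) = (\<Prod>i\<in>set_mset \<rho> - {k}. ?g \<rho> i)"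
    by (rule prod.cong) auto
  finally show ?thesis unfolding 1 by (simp add: algebra_simps)
qed

lemma zee_mset_pos: "0 \<notin># \<rho> \<Longrightarrow> zee_mset \<rho> > 0"
  by (induction \<rho>) auto

locale jack_parameter =
  fixes \<alpha> :: "'k::linordered_field"
  assumes alpha_pos: "\<alpha> > 0"
begin

text \<open>
  The operator $\alpha k\,\partial/\partial p_k$, which is adjoint to multiplication by $p_k$.
\<close>

definition lower :: "nat \<Rightarrow> (nat multiset \<Rightarrow> 'k) \<Rightarrow> nat multiset \<Rightarrow> 'k" where
  "lower k f = (\<lambda>\<sigma>. \<alpha> * of_nat (k * Suc (count \<sigma> k)) * f (add_mset k \<sigma>))"

definition weight :: "nat multiset \<Rightarrow> 'k" where
  "weight \<rho> = \<alpha> ^ size \<rho> * of_nat (zee_mset \<rho>)"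

definition scalar :: "nat \<Rightarrow> (nat multiset \<Rightarrow> 'k) \<Rightarrow> (nat multiset \<Rightarrow> 'k) \<Rightarrow> 'k" where
  "scalar n f g = (\<Sum>\<rho>\<in>parts_of n. f \<rho> * g \<rho> * weight \<rho>)"

lemma weight_pos: "\<rho> \<in> parts_of n \<Longrightarrow> weight \<rho> > 0"
  using alpha_pos by (auto simp: weight_def parts_of_def intro!: mult_pos_pos zee_mset_pos)

lemma weight_add_mset: "weight (add_mset k \<rho>) = \<alpha> * of_nat (k * Suc (count \<rho> k)) * weight \<rho>"
  by (simp add: weight_def algebra_simps)

lemma scalar_commute: "scalar n f g = scalar n g f"
  by (simp add: scalar_def algebra_simps)

lemma scalar_add_left: "scalar n (\<lambda>\<rho>. f \<rho> + g \<rho>) h = scalar n f h + scalar n g h"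
  by (simp add: scalar_def algebra_simps sum.distrib)

lemma scalar_add_right: "scalar n h (\<lambda>\<rho>. f \<rho> + g \<rho>) = scalar n h f + scalar n h g"
  by (simp add: scalar_def algebra_simps sum.distrib)

lemma scalar_scale_left: "scalar n (\<lambda>\<rho>. c * f \<rho>) h = c * scalar n f h"
  by (simp add: scalar_def algebra_simps sum_distrib_left)

lemma scalar_scale_right: "scalar n h (\<lambda>\<rho>. c * f \<rho>) = c * scalar n h f"
  by (simp add: scalar_def algebra_simps sum_distrib_left)

lemma scalar_sum_left: "scalar n (\<lambda>\<rho>. \<Sum>i\<in>S. f i \<rho>) h = (\<Sum>i\<in>S. scalar n (f i) h)"
  by (simp add: scalar_def sum_distrib_right sum.swap[of _ S])

lemma scalar_sum_right: "scalar n h (\<lambda>\<rho>. \<Sum>i\<in>S. f i \<rho>) = (\<Sum>i\<in>S. scalar n h (f i))"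
  by (simp add: scalar_def sum_distrib_right sum_distrib_left sum.swap[of _ S])

lemmas scalar_linear = scalar_add_left scalar_add_right scalar_scale_left scalar_scale_right
    scalar_sum_left scalar_sum_right

text \<open>
  An ordered coefficient field with $\alpha>0$ makes the scalar product positive definite, because
  $\langle f,f\rangle$ is a sum of squares with positive weights. Hence a function that lies in a
  subspace and is orthogonal to that subspace must vanish.
\<close>

lemma scalar_definite:
  assumes "scalar n f f = 0" "\<rho> \<in> parts_of n"
  shows "f \<rho> = 0"
proof -
  have "f \<rho> * f \<rho> * weight \<rho> = 0"
    using assms sum_nonneg_eq_0_iff[of "parts_of n" "\<lambda>\<rho>. f \<rho> * f \<rho> * weight \<rho>"]
      weight_pos[of _ n] by (auto simp: scalar_def less_imp_le)
  then show ?thesis using weight_pos[OF assms(2)] by simp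
qed

lemma scalar_raise_left:
  assumes "0 < k" "k \<le> n"
  shows "scalar n (raise k f) g = scalar (n - k) f (lower k g)"
  unfolding scalar_def
  by (subst sum_parts_of_raise[OF assms, where G = "\<lambda>\<rho> x. x * g \<rho> * weight \<rho>"])
    (auto simp: lower_def weight_add_mset algebra_simps)

lemma scalar_lower_left:
  assumes "0 < k" "k \<le> n"
  shows "scalar (n - k) (lower k f) g = scalar n f (raise k g)"
  using scalar_raise_left[OF assms, of g f] by (simp add: scalar_commute)

text \<open>
  The chain rule for $p_k=\sum_i x_i^k$. It links the operators \<open>lower\<close>, which see
  the power sums, to the Euler derivation, which sees a single variable.
\<close>

lemma euler_p_expand:
  "mps_const \<alpha> * mps_euler i (p_expand n f) = (\<Sum>k\<in>{1..n}. mps_var_power i k * p_expand (n - k) (lower k f))"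
proof -
  let ?T = "\<lambda>k \<rho>. mps_scale (\<alpha> * of_nat (k * count \<rho> k) * f \<rho>) (mps_var_power i k
      * power_sum_mset (\<rho> - {#k#}))"
  have "mps_const \<alpha> * mps_euler i (p_expand n f) = (\<Sum>\<rho>\<in>parts_of n. \<Sum>k\<in>set_mset \<rho>. ?T k \<rho>)"
    by (rule mps_eqI)
      (simp add: p_expand_def mps_euler_sum mps_euler_scale mps_euler_power_sum_mset sum_distrib_left
        mps_const_simps(7)[symmetric] del: of_nat_mult, simp add: algebra_simps)
  also have "\<dots> = (\<Sum>\<rho>\<in>parts_of n. \<Sum>k\<in>{1..n}. if k \<in># \<rho> then ?T k \<rho> else 0)"
  proof (rule sum.cong)
    fix \<rho> assume \<rho>: "\<rho> \<in> parts_of n"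
    have "k \<in> {1..n}" if "k \<in># \<rho>" for k
      using \<rho> multi_member_split[OF that] by (auto simp: add_mset_parts_of)
    then show "(\<Sum>k\<in>set_mset \<rho>. ?T k \<rho>) = (\<Sum>k\<in>{1..n}. if k \<in># \<rho> then ?T k \<rho> else 0)"
      by (intro sum.mono_neutral_cong_left) auto
  qed simp
  also have "\<dots> = (\<Sum>k\<in>{1..n}. \<Sum>\<rho>\<in>parts_of n. if k \<in># \<rho> then ?T k \<rho> else 0)"
    by (rule sum.swap)
  also have "\<dots> = (\<Sum>k\<in>{1..n}. \<Sum>\<rho>\<in>{\<rho>\<in>parts_of n. k \<in># \<rho>}. ?T k \<rho>)"
    by (simp only: sum.inter_filter finite_parts_of)
  also have "\<dots> = (\<Sum>k\<in>{1..n}. mps_var_power i k * p_expand (n - k) (lower k f))"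
    by (intro sum.cong)
      (auto simp: sum_parts_of_containing p_expand_def lower_def sum_distrib_left mps_scale_mult_right
        algebra_simps)
  finally show ?thesis .
qed

end

section \<open>Virasoro operators, their adjoints and the Hamiltonian\<close>

lemma sum_triangle:
  "(\<Sum>k\<in>{1..n}. \<Sum>j\<in>{1..n - k}. F k j) = (\<Sum>m\<in>{1..n::nat}. \<Sum>j\<in>{1..<m}. F (m - j) (j::nat))"
proof -
  have "(\<Sum>k\<in>{1..n}. \<Sum>j\<in>{1..n - k}. F k j) = (\<Sum>(k, j)\<in>Sigma {1..n} (\<lambda>k. {1..n - k}). F k j)"
    by (rule sum.Sigma) auto
  also have "\<dots> = (\<Sum>(m, j)\<in>Sigma {1..n} (\<lambda>m. {1..<m}). F (m - j) j)"
    by (rule sum.reindex_bij_witness[where i = "\<lambda>(m, j). (m - j, j)" and j = "\<lambda>(k, j). (k + j, j)"]) auto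
  also have "\<dots> = (\<Sum>m\<in>{1..n}. \<Sum>j\<in>{1..<m}. F (m - j) j)"
    by (rule sum.Sigma[symmetric]) auto
  finally show ?thesis .
qed

definition deg :: "expo \<Rightarrow> nat" where
  "deg a = (\<Sum>l\<in>keys a. lookup a l)"

text \<open>
  The exponent obtained by moving \<open>s\<close> units from variable \<open>l\<close> to
  variable \<open>i\<close>.
\<close>

definition shift :: "expo \<Rightarrow> nat \<Rightarrow> nat \<Rightarrow> nat \<Rightarrow> expo" where
  "shift a i l s = a + single i s - single l s"

lemma lookup_shift:
  "i \<noteq> l \<Longrightarrow> lookup (shift a i l s) x =
     (if x = i then lookup a i + s else if x = l then lookup a l - s else lookup a x)"
  by (auto simp: shift_def lookup_add lookup_minus lookup_single when_def)

lemma shift_shift: "i \<noteq> l \<Longrightarrow> shift (shift a i l s) i l t = shift a i l (s + t)"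
  by (rule poly_mapping_eqI) (simp add: lookup_shift)

lemma keys_shift_subset: "keys (shift a i l s) \<subseteq> insert i (keys a)"
  by (auto simp: shift_def in_keys_iff lookup_add lookup_minus lookup_single when_def split: if_splits)

text \<open>
  For a symmetric function this says that it becomes zero when restricted to \<open>p\<close>
  variables.
\<close>

definition vanishes_on :: "nat \<Rightarrow> 'a::zero mps \<Rightarrow> bool" where
  "vanishes_on p f \<longleftrightarrow> (\<forall>a. card (keys a) \<le> p \<longrightarrow> mps_coeff f a = 0)"

lemma vanishes_on_var_power_mult:
  assumes "vanishes_on p f"
  shows "vanishes_on p (mps_var_power i k * f)"
  unfolding vanishes_on_def
proof (intro allI impI)
  fix a :: expo assume a: "card (keys a) \<le> p"
  have "keys (a - single i k) \<subseteq> keys a"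
    by (auto simp: in_keys_iff lookup_minus)
  then have "card (keys (a - single i k)) \<le> p"
    using a by (meson card_mono finite_keys order_trans)
  then show "mps_coeff (mps_var_power i k * f) a = 0"
    using assms by (auto simp: mps_coeff_var_power_mult vanishes_on_def)
qed

lemma vanishes_on_power_sum_mult:
  assumes "vanishes_on p f" "k > 0"
  shows "vanishes_on p (power_sum k * f)"
  using vanishes_on_var_power_mult[OF assms(1)] assms(2)
  by (auto simp: vanishes_on_def mps_coeff_power_sum_mult)

lemma vanishes_on_euler: "vanishes_on p f \<Longrightarrow> vanishes_on p (mps_euler i f)"
  by (simp add: vanishes_on_def)

lemma power_diff_factor:
  fixes x y :: "'a::comm_ring_1"
  shows "(x - y) * (\<Sum>j\<in>{1..m}. x ^ (m - j) * y ^ j) = y * (x ^ m - y ^ m)"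
proof (induction m)
  case (Suc m)
  have "(\<Sum>j\<in>{1..Suc m}. x ^ (Suc m - j) * y ^ j) = x * (\<Sum>j\<in>{1..m}. x ^ (m - j) * y ^ j) + y ^ Suc m"
    by (simp add: sum_distrib_left Suc_diff_le mult.assoc)
  then have "(x - y) * (\<Sum>j\<in>{1..Suc m}. x ^ (Suc m - j) * y ^ j) =
      x * ((x - y) * (\<Sum>j\<in>{1..m}. x ^ (m - j) * y ^ j)) + (x - y) * y ^ Suc m"
    by (simp only: distrib_left mult.left_commute)
  then show ?case unfolding Suc by (simp add: algebra_simps)
qed simp

lemma mps_var_power_eq_power: "(mps_var_power i k :: 'a::comm_ring_1 mps) = mps_var_power i 1 ^ k"
proof (induction k)
  case (Suc k)
  have "(mps_var_power i (Suc k) :: 'a mps) = mps_var_power i 1 * mps_var_power i k"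
    using mps_var_power_add[of i 1 k] by simp
  then show ?case using Suc by simp
qed simp

context jack_parameter
begin

text \<open>
  With $a_k=\alpha k\,\partial/\partial p_k$ this is the operator
  $$L_k=\sum_{j\ge1}p_j\,a_{k+j}+\sum_{i+j=k}a_ia_j+(k(\alpha-1)-c)\,a_k$$
  on functions of degree $n$, where the first sum stops at $j=n-k$ because the remaining terms
  vanish. These are the positive half of a Virasoro algebra; a rectangle $p\times q$ corresponds
  to $c=\alpha q-p$.
\<close>

definition virasoro :: "nat \<Rightarrow> 'k \<Rightarrow> nat \<Rightarrow> (nat multiset \<Rightarrow> 'k) \<Rightarrow> nat multiset \<Rightarrow> 'k" where
  "virasoro n c k f = (\<lambda>\<sigma>. (\<Sum>j\<in>{1..n - k}. raise j (lower (k + j) f) \<sigma>)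
     + (\<Sum>i\<in>{1..<k}. lower i (lower (k - i) f) \<sigma>)
     + (of_nat k * (\<alpha> - 1) - c) * lower k f \<sigma>)"

text \<open>
  The adjoint of $L_k$ raises the degree by $k$. Its first sum is $\sum_j p_{k+j}a_j=\alpha\sum_l
  x_l^{k+1}\partial/\partial x_l$, so that, unlike $L_k$ itself, the adjoint makes sense in any
  finite number of variables.
\<close>

definition virasoro_adj :: "nat \<Rightarrow> 'k \<Rightarrow> nat \<Rightarrow> (nat multiset \<Rightarrow> 'k) \<Rightarrow> nat multiset \<Rightarrow> 'k" where
  "virasoro_adj n c k g = (\<lambda>\<rho>. (\<Sum>j\<in>{1..n - k}. raise (k + j) (lower j g) \<rho>)
     + (\<Sum>i\<in>{1..<k}. raise (k - i) (raise i g) \<rho>)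
     + (of_nat k * (\<alpha> - 1) - c) * raise k g \<rho>)"

lemma scalar_virasoro:
  assumes "1 \<le> k" "k \<le> n"
  shows "scalar (n - k) (virasoro n c k f) g = scalar n f (virasoro_adj n c k g)"
proof -
  have 1: "scalar (n - k) (raise j (lower (k + j) f)) g = scalar n f (raise (k + j) (lower j g))"
    if "j \<in> {1..n - k}" for j
  proof -
    have "k + j \<le> n" using that assms by auto
    then show ?thesis using that assms by (simp add: scalar_raise_left scalar_lower_left)
  qed
  have 2: "scalar (n - k) (lower i (lower (k - i) f)) g = scalar n f (raise (k - i) (raise i g))"
    if "i \<in> {1..<k}" for i
  proof -
    have e: "n - (k - i) - i = n - k" using that assms by auto
    have "scalar (n - (k - i) - i) (lower i (lower (k - i) f)) g
        = scalar (n - (k - i)) (lower (k - i) f) (raise i g)"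
      using that assms by (intro scalar_lower_left) auto
    also have "\<dots> = scalar n f (raise (k - i) (raise i g))"
      using that assms by (intro scalar_lower_left) auto
    finally show ?thesis unfolding e .
  qed
  show ?thesis
    unfolding virasoro_def virasoro_adj_def scalar_linear
    using assms by (intro arg_cong2[where f = "(+)"] arg_cong2[where f
        = "(*)"] sum.cong refl 1 2 scalar_lower_left) auto
qed

text \<open>
  The combination $\sum_{k\ge1}p_kL_k$ is, up to a constant factor and a multiple of the degree,
  the Laplace-Beltrami operator that Jack functions diagonalize.
\<close>

definition hamiltonian :: "nat \<Rightarrow> 'k \<Rightarrow> (nat multiset \<Rightarrow> 'k) \<Rightarrow> nat multiset \<Rightarrow> 'k" where
  "hamiltonian n c f = (\<lambda>\<rho>. \<Sum>k\<in>{1..n}. raise k (virasoro n c k f) \<rho>)"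

text \<open>
  The cut terms $p_jp_k\,a_{j+k}$ and the join terms $p_{j+k}\,a_ja_k$ are adjoint to each other,
  and the remaining terms $p_ka_k$ are self-adjoint.
\<close>

lemma scalar_hamiltonian: "scalar n (hamiltonian n c f) g = scalar n f (hamiltonian n c g)"
proof -
  define B where "B f g = (\<Sum>k\<in>{1..n}. \<Sum>i\<in>{1..<k}. scalar (n
      - k) (lower i (lower (k - i) f)) (lower k g))" for f g
  define C where "C f g = (\<Sum>k\<in>{1..n}. (of_nat k * (\<alpha> - 1) - c)
      * scalar (n - k) (lower k f) (lower k g))" for f g
  have *: "scalar n (hamiltonian n c f) g = B g f + B f g + C f g" for f g
  proof -
    have 1: "scalar (n - k) (raise j (lower (k + j) f)) (lower k g)
        = scalar (n - (k + j)) (lower (k + j) f) (lower j (lower k g))"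
      if "k \<in> {1..n}" "j \<in> {1..n - k}" for k j
      using that by (simp add: scalar_raise_left)
    have "scalar n (hamiltonian n c f) g =
       (\<Sum>k\<in>{1..n}. scalar (n - k) (virasoro n c k f) (lower k g))"
      unfolding hamiltonian_def scalar_linear by (rule sum.cong) (auto simp: scalar_raise_left)
    also have "\<dots> = (\<Sum>k\<in>{1..n}. \<Sum>j\<in>{1..n - k}. scalar (n - k) (raise j (lower (k + j) f)) (lower k g))
        + B f g + C f g"
      unfolding virasoro_def scalar_linear sum.distrib B_def C_def ..
    also have "(\<Sum>k\<in>{1..n}. \<Sum>j\<in>{1..n - k}. scalar (n - k) (raise j (lower (k + j) f)) (lower k g))
      = (\<Sum>k\<in>{1..n}. \<Sum>j\<in>{1..n - k}. scalar (n - (k + j)) (lower (k + j) f) (lower j (lower k g)))"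
      using 1 by simp
    also have "\<dots> = (\<Sum>k\<in>{1..n}. \<Sum>j\<in>{1..<k}. scalar (n - k) (lower k f) (lower j (lower (k - j) g)))"
      unfolding sum_triangle[of "\<lambda>k j. scalar (n - (k + j)) (lower (k + j) f) (lower j (lower k g))"]
      by (rule sum.cong[OF refl], rule sum.cong) auto
    also have "\<dots> = B g f"
      unfolding B_def by (simp add: scalar_commute)
    finally show ?thesis .
  qed
  have "C f g = C g f" by (simp add: C_def scalar_commute)
  then show ?thesis using *[of f g] *[of g f] scalar_commute[of n f "hamiltonian n c g"] by simp
qed

lemma p_expand_virasoro:
  assumes "1 \<le> k" "k \<le> n"
  shows "p_expand (n - k) (virasoro n c k f) =
     (\<Sum>j\<in>{1..n - k}. power_sum j * p_expand (n - (k + j)) (lower (k + j) f))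
     + (\<Sum>i\<in>{1..<k}. p_expand (n - k) (lower i (lower (k - i) f)))
     + mps_const (of_nat k * (\<alpha> - 1) - c) * p_expand (n - k) (lower k f)"
  unfolding virasoro_def p_expand_add p_expand_sum p_expand_scale
  using assms by (simp add: p_expand_raise)

section \<open>The operators in the coordinates of one monomial\<close>

text \<open>
  The operators $L_k$ are collected in $\sum_k x_i^kL_k$ for one distinguished variable $x_i$. The
  products $a_ia_j$ and the diagonal term combine to the square of the Euler derivation, and the
  terms $p_ja_{k+j}$ leave a divided difference, as $\sum_{j\le m}x^{m-j}(p_j-x^j)$ is the sum
  over all other variables $y$ of $y\,(x^m-y^m)/(x-y)$.
\<close>

lemma lax_identity:
  "(\<Sum>k\<in>{1..n}. mps_var_power i k * p_expand (n - k) (virasoro n c k f)) =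
     mps_const (\<alpha>\<^sup>2) * mps_euler i (mps_euler i (p_expand n f))
         - mps_const (c * \<alpha>) * mps_euler i (p_expand n f)
     - (\<Sum>m\<in>{1..n}. power_sum m * p_expand (n - m) (lower m f))
     + (\<Sum>m\<in>{1..n}. \<Sum>j\<in>{1..m}. mps_var_power i (m - j) * (power_sum j - mps_var_power i j)
         * p_expand (n - m) (lower m f))"
  (is "?L = ?T1 - ?T2 - ?T3 + ?R")
proof -
  let ?X = "mps_var_power i :: nat \<Rightarrow> 'k mps"
  define E where "E m = p_expand (n - m) (lower m f)" for m
  have th: "mps_const \<alpha> * mps_euler i (p_expand n f) = (\<Sum>k\<in>{1..n}. ?X k * E k)"
    unfolding E_def by (rule euler_p_expand)
  have "?L = (\<Sum>k\<in>{1..n}. \<Sum>j\<in>{1..n - k}. ?X k * power_sum j * E (k + j))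
    + (\<Sum>k\<in>{1..n}. \<Sum>i\<in>{1..<k}. ?X k * p_expand (n - k) (lower i (lower (k - i) f)))
    + (\<Sum>k\<in>{1..n}. ?X k * (mps_const (of_nat k * (\<alpha> - 1) - c) * E k))" (is "_ = ?A + ?B + ?C")
    unfolding sum.distrib[symmetric] E_def
    by (rule sum.cong) (auto simp: p_expand_virasoro distrib_left sum_distrib_left mult.assoc)
  also have "?A = ?R - ?T3 + (\<Sum>m\<in>{1..n}. of_nat m * ?X m * E m)"
  proof -
    have "?A = (\<Sum>m\<in>{1..n}. \<Sum>j\<in>{1..<m}. ?X (m - j) * power_sum j * E (m - j + j))"
      by (rule sum_triangle)
    also have "\<dots> = (\<Sum>m\<in>{1..n}. (\<Sum>j\<in>{1..m}. ?X (m - j) * (power_sum j - ?X j) * E m)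
        - power_sum m * E m + of_nat m * ?X m * E m)"
    proof (rule sum.cong[OF refl])
      fix m assume m: "m \<in> {1..n}"
      have "(\<Sum>j\<in>{1..m}. ?X (m - j) * (power_sum j - ?X j) * E m)
        = (\<Sum>j\<in>{1..m}. ?X (m - j) * power_sum j * E m - ?X m * E m)"
        by (rule sum.cong) (auto simp: algebra_simps mps_var_power_add[symmetric])
      also have "\<dots> = (\<Sum>j\<in>{1..m}. ?X (m - j) * power_sum j * E m) - of_nat m * ?X m * E m"
        by (simp add: sum_subtractf mult.assoc)
      also have "(\<Sum>j\<in>{1..m}. ?X (m - j) * power_sum j * E m) =
          power_sum m * E m + (\<Sum>j\<in>{1..<m}. ?X (m - j) * power_sum j * E m)"
      proof -
        have *: "{1..m} = insert m {1..<m}" using m by auto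
        show ?thesis unfolding * by simp
      qed
      finally have "(\<Sum>j\<in>{1..<m}. ?X (m - j) * power_sum j * E m) =
        (\<Sum>j\<in>{1..m}. ?X (m - j) * (power_sum j - ?X j) * E m) - power_sum m * E m + of_nat m * ?X m * E m"
        by (simp only:) simp
      then show "(\<Sum>j\<in>{1..<m}. ?X (m - j) * power_sum j * E (m - j + j)) =
        (\<Sum>j\<in>{1..m}. ?X (m - j) * (power_sum j - ?X j) * E m) - power_sum m * E m + of_nat m * ?X m * E m"
        by simp
    qed
    finally show ?thesis by (simp add: sum.distrib sum_subtractf E_def)
  qed
  also have "?B = (\<Sum>k\<in>{1..n}. ?X k * (mps_const \<alpha> * mps_euler i (E k)))"
  proof -
    have "(\<Sum>k\<in>{1..n}. ?X k * (mps_const \<alpha> * mps_euler i (E k))) =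
      (\<Sum>k\<in>{1..n}. \<Sum>j\<in>{1..n - k}. ?X (k + j) * p_expand (n - (k + j)) (lower j (lower k f)))"
      by (simp add: E_def euler_p_expand sum_distrib_left mps_var_power_add mult.assoc)
    also have "\<dots> = ?B"
      unfolding sum_triangle[of "\<lambda>k j. ?X (k + j) * p_expand (n - (k + j)) (lower j (lower k f))"]
      by (rule sum.cong[OF refl], rule sum.cong) auto
    finally show ?thesis ..
  qed
  also have "?C = mps_const \<alpha> * (\<Sum>k\<in>{1..n}. of_nat k * ?X k * E k) - (\<Sum>k\<in>{1..n}. of_nat k * ?X k * E k)
     - mps_const c * (\<Sum>k\<in>{1..n}. ?X k * E k)"
    by (simp add: sum_distrib_left sum_subtractf[symmetric] mps_const_simps algebra_simps)
  also have "(\<Sum>k\<in>{1..n}. ?X k * E k) = mps_const \<alpha> * mps_euler i (p_expand n f)"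
    by (rule th[symmetric])
  also have "(\<Sum>k\<in>{1..n}. ?X k * (mps_const \<alpha> * mps_euler i (E k))) =
    ?T1 - mps_const \<alpha> * (\<Sum>k\<in>{1..n}. of_nat k * ?X k * E k)"
  proof -
    have "?T1 = mps_const \<alpha> * mps_euler i (mps_const \<alpha> * mps_euler i (p_expand n f))"
      by (simp add: mps_const_mult mps_euler_scale power2_eq_square)
    also have "\<dots> = mps_const \<alpha> * (\<Sum>k\<in>{1..n}. of_nat k * ?X k * E k)
        + mps_const \<alpha> * (\<Sum>k\<in>{1..n}. ?X k * mps_euler i (E k))"
      unfolding th by (simp add: mps_euler_sum mps_euler_mult mps_euler_var_power sum.distrib distrib_left)
    finally show ?thesis by (simp add: sum_distrib_left algebra_simps)
  qed
  finally show ?thesis by (simp add: mps_const_simps algebra_simps)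
qed

text \<open>
  The sum on the left is $\alpha\,x_l(\theta_i-\theta_l)f/(x_i-x_l)$ with
  $\theta=x\,\partial/\partial x$. Clearing the denominator gives a recursion that moves one unit
  from $x_l$ to $x_i$ at each step.
\<close>

lemma divided_difference_coeff:
  assumes "i \<noteq> l"
  shows "mps_coeff (\<Sum>m\<in>{1..n}. \<Sum>j\<in>{1..m}. mps_var_power i (m - j) * mps_var_power l j
      * p_expand (n - m) (lower m f)) a
    = \<alpha> * (\<Sum>s\<in>{1..lookup a l}. (of_nat (lookup a i) - of_nat (lookup a l) + 2 * of_nat s)
        * mps_coeff (p_expand n f) (shift a i l s))"
proof -
  define Q where "Q = (\<Sum>m\<in>{1..n}. \<Sum>j\<in>{1..m}. mps_var_power i (m - j) * mps_var_power l j
      * p_expand (n - m) (lower m f))"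
  define F where "F = p_expand n f"
  have Q: "(mps_var_power i 1 - mps_var_power l 1) * Q
      = mps_const \<alpha> * (mps_var_power l 1 * (mps_euler i F - mps_euler l F))"
  proof -
    have "(mps_var_power i 1 - mps_var_power l 1) * Q =
      (\<Sum>m\<in>{1..n}. ((mps_var_power i 1 - mps_var_power l 1)
          * (\<Sum>j\<in>{1..m}. mps_var_power i (m - j) * mps_var_power l j)) * p_expand (n - m) (lower m f))"
      by (simp add: Q_def sum_distrib_left sum_distrib_right mult.assoc)
    also have "\<dots> = (\<Sum>m\<in>{1..n}. mps_var_power l 1 * (mps_var_power i m - mps_var_power l m)
        * p_expand (n - m) (lower m f))"
    proof (rule sum.cong[OF refl])
      fix m
      show "((mps_var_power i 1 - mps_var_power l 1)
          * (\<Sum>j\<in>{1..m}. mps_var_power i (m - j) * mps_var_power l j)) * p_expand (n - m) (lower m f)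
        = mps_var_power l 1 * (mps_var_power i m - mps_var_power l m) * p_expand (n - m) (lower m f)"
        using power_diff_factor[of "mps_var_power i 1 :: 'k mps" "mps_var_power l 1" m]
        unfolding mps_var_power_eq_power[symmetric] by simp
    qed
    also have "\<dots> = mps_var_power l 1 * (mps_const \<alpha> * mps_euler i F)
        - mps_var_power l 1 * (mps_const \<alpha> * mps_euler l F)"
      unfolding F_def euler_p_expand sum_distrib_left sum_subtractf[symmetric]
      by (rule sum.cong) (auto simp: algebra_simps)
    finally show ?thesis by (simp add: algebra_simps)
  qed
  have step: "mps_coeff Q a = (if lookup a l = 0 then 0 else mps_coeff Q (shift a i l 1)
     + \<alpha> * (of_nat (lookup a i) - of_nat (lookup a l) + 2) * mps_coeff F (shift a i l 1))" for a
  proof -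
    let ?b = "a + single i 1"
    have b: "?b - single i 1 = a" "?b - single l 1 = shift a i l 1"
      by (simp_all add: shift_def)
    have lb: "lookup ?b i = lookup a i + 1" "lookup ?b l = lookup a l"
      using assms by (auto simp: lookup_add lookup_single)
    have "mps_coeff ((mps_var_power i 1 - mps_var_power l 1) * Q) ?b
      = mps_coeff Q a - (if lookup a l = 0 then 0 else mps_coeff Q (shift a i l 1))"
      unfolding left_diff_distrib mps_coeff_diff mps_coeff_var_power_mult lb b by auto
    moreover have "mps_coeff (mps_const \<alpha> * (mps_var_power l 1 * (mps_euler i F - mps_euler l F))) ?b =
      (if lookup a l = 0 then 0 else \<alpha> * (of_nat (lookup a i) - of_nat (lookup a l) + 2)
          * mps_coeff F (shift a i l 1))"
      unfolding mps_const_coeff_mult mps_coeff_var_power_mult lb b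
      using assms by (auto simp: lookup_shift of_nat_diff algebra_simps)
    ultimately show ?thesis unfolding Q by (auto simp: algebra_simps split: if_splits)
  qed
  have "mps_coeff Q a = \<alpha> * (\<Sum>s\<in>{1..lookup a l}. (of_nat (lookup a i) - of_nat (lookup a l)
      + 2 * of_nat s) * mps_coeff F (shift a i l s))"
  proof (induction "lookup a l" arbitrary: a)
    case 0
    then show ?case using step[of a] by simp
  next
    case (Suc m)
    have l: "m = lookup (shift a i l 1) l" "lookup (shift a i l 1) i = lookup a i + 1" using assms Suc(2)
      by (auto simp: lookup_shift)
    have "mps_coeff Q a = mps_coeff Q (shift a i l 1)
        + \<alpha> * (of_nat (lookup a i) - of_nat (Suc m) + 2) * mps_coeff F (shift a i l 1)"
      using step[of a] Suc(2) by simp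
    also have "mps_coeff Q (shift a i l 1)
        = \<alpha> * (\<Sum>s\<in>{1..m}. (of_nat (lookup a i) - of_nat (Suc m) + 2 * of_nat (Suc s))
        * mps_coeff F (shift a i l (Suc s)))"
      using Suc(1)[OF l(1)] assms unfolding l(2) l(1)[symmetric]
      by (simp add: shift_shift algebra_simps)
    also have "(\<Sum>s\<in>{1..m}. (of_nat (lookup a i) - of_nat (Suc m) + 2 * of_nat (Suc s))
        * mps_coeff F (shift a i l (Suc s)))
      = (\<Sum>s\<in>{2..Suc m}. (of_nat (lookup a i) - of_nat (Suc m) + 2 * of_nat s)
          * mps_coeff F (shift a i l s))"
      by (rule sum.reindex_bij_witness[where i = "\<lambda>s. s - 1" and j = Suc]) auto
    finally show ?case unfolding Suc(2)[symmetric]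
      by (subst sum.atLeast_Suc_atMost[of 1 "Suc m"]) (auto simp: algebra_simps numeral_2_eq_2)
  qed
  then show ?thesis unfolding Q_def F_def .
qed

text \<open>
  The coefficient at $x^a$ of $\sum_k x_i^kL_kf$, written through the coefficients of $f$ alone.
  This is $(L-c_1)(L-c_2)f$ for the operator $L$ of Heckman type, with $c=c_1+c_2$ and with
  $c_1c_2$ replaced by minus $\alpha$ times the degree. For a rectangle $c_1=\alpha q$ and
  $c_2=-p$ are the contents of its two outer corners.
\<close>

definition lax :: "'k \<Rightarrow> (expo \<Rightarrow> 'k) \<Rightarrow> nat \<Rightarrow> expo \<Rightarrow> 'k" where
  "lax c f i a = \<alpha> * ((\<alpha> * of_nat (lookup a i) - c) * of_nat (lookup a i) * f a
     + (\<Sum>l\<in>keys a - {i}. \<Sum>s\<in>{1..lookup a l}.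
         (of_nat (lookup a i) - of_nat (lookup a l) + 2 * of_nat s) * f (shift a i l s))
     - of_nat (deg a) * f a)"

lemma sum_power_sum_lower_coeff:
  "mps_coeff (\<Sum>m\<in>{1..n}. power_sum m * p_expand (n - m) (lower m f)) a
      = \<alpha> * of_nat (deg a) * mps_coeff (p_expand n f) a"
proof -
  have "mps_coeff (\<Sum>m\<in>{1..n}. power_sum m * p_expand (n - m) (lower m f)) a =
    (\<Sum>l\<in>keys a. mps_coeff (\<Sum>m\<in>{1..n}. mps_var_power l m * p_expand (n - m) (lower m f)) a)"
    by (simp add: mps_coeff_power_sum_mult sum.swap[of _ _ "keys a"])
  also have "\<dots> = (\<Sum>l\<in>keys a. mps_coeff (mps_const \<alpha> * mps_euler l (p_expand n f)) a)"
    unfolding euler_p_expand ..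
  finally show ?thesis by (simp add: deg_def sum_distrib_left sum_distrib_right mult.assoc)
qed

theorem lax_coeff:
  "(\<Sum>k\<in>{1..n}. mps_coeff (mps_var_power i k * p_expand (n - k) (virasoro n c k f)) a)
      = lax c (mps_coeff (p_expand n f)) i a"
proof -
  define G where "G m j = mps_var_power i (m - j) * p_expand (n - m) (lower m f)" for m j
  have R: "mps_coeff (power_sum j * G m j) a - mps_coeff (mps_var_power i j * G m j) a =
     (\<Sum>l\<in>keys a - {i}. mps_coeff (mps_var_power l j * G m j) a)" if "j \<in> {1..m}" for m j
    using that by (cases "i \<in> keys a")
      (auto simp: mps_coeff_power_sum_mult sum_diff1 mps_coeff_var_power_mult in_keys_iff)
  have "mps_coeff (\<Sum>m\<in>{1..n}. \<Sum>j\<in>{1..m}. mps_var_power i (m - j) * (power_sum j - mps_var_power i j)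
      * p_expand (n - m) (lower m f)) a
    = (\<Sum>m\<in>{1..n}. \<Sum>j\<in>{1..m}. mps_coeff (power_sum j * G m j) a - mps_coeff (mps_var_power i j * G m j) a)"
    by (simp add: G_def algebra_simps)
  also have "\<dots> = (\<Sum>m\<in>{1..n}. \<Sum>j\<in>{1..m}. \<Sum>l\<in>keys a - {i}. mps_coeff (mps_var_power l j * G m j) a)"
    using R by simp
  also have "\<dots> = (\<Sum>l\<in>keys a - {i}. \<Sum>m\<in>{1..n}. \<Sum>j\<in>{1..m}. mps_coeff (mps_var_power l j * G m j) a)"
    by (simp add: sum.swap[of _ _ "keys a - {i}"])
  also have "\<dots> = (\<Sum>l\<in>keys a - {i}. \<alpha> * (\<Sum>s\<in>{1..lookup a l}. (of_nat (lookup a i) - of_nat (lookup a l)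
      + 2 * of_nat s) * mps_coeff (p_expand n f) (shift a i l s)))"
  proof (rule sum.cong[OF refl])
    fix l assume "l \<in> keys a - {i}"
    then have "i \<noteq> l" by auto
    from divided_difference_coeff[OF this, of n f a]
    show "(\<Sum>m\<in>{1..n}. \<Sum>j\<in>{1..m}. mps_coeff (mps_var_power l j * G m j) a)
        = \<alpha> * (\<Sum>s\<in>{1..lookup a l}. (of_nat (lookup a i) - of_nat (lookup a l) + 2 * of_nat s)
        * mps_coeff (p_expand n f) (shift a i l s))"
      by (simp add: G_def algebra_simps)
  qed
  finally have R': "mps_coeff (\<Sum>m\<in>{1..n}. \<Sum>j\<in>{1..m}. mps_var_power i (m - j)
      * (power_sum j - mps_var_power i j) * p_expand (n - m) (lower m f)) a = \<dots>" .
  have "(\<Sum>k\<in>{1..n}. mps_coeff (mps_var_power i k * p_expand (n - k) (virasoro n c k f)) a)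
    = mps_coeff (\<Sum>k\<in>{1..n}. mps_var_power i k * p_expand (n - k) (virasoro n c k f)) a" by simp
  also have "\<dots> = lax c (mps_coeff (p_expand n f)) i a"
    unfolding lax_identity mps_coeff_add mps_coeff_diff R' sum_power_sum_lower_coeff lax_def
    by (simp add: sum_distrib_left power2_eq_square algebra_simps)
  finally show ?thesis .
qed

lemma hamiltonian_coeff:
  "mps_coeff (p_expand n (hamiltonian n c f)) a = (\<Sum>i\<in>keys a. lax c (mps_coeff (p_expand n f)) i a)"
proof -
  have "p_expand n (hamiltonian n c f) = (\<Sum>k\<in>{1..n}. power_sum k * p_expand (n - k) (virasoro n c k f))"
    unfolding hamiltonian_def p_expand_sum by (rule sum.cong) (auto simp: p_expand_raise)
  then have "mps_coeff (p_expand n (hamiltonian n c f)) a =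
     (\<Sum>k\<in>{1..n}. \<Sum>i\<in>keys a. mps_coeff (mps_var_power i k * p_expand (n - k) (virasoro n c k f)) a)"
    by (simp add: mps_coeff_power_sum_mult)
  also have "\<dots> = (\<Sum>i\<in>keys a. \<Sum>k\<in>{1..n}. mps_coeff (mps_var_power i k
      * p_expand (n - k) (virasoro n c k f)) a)"
    by (rule sum.swap)
  finally show ?thesis unfolding lax_coeff .
qed

text \<open>
  In the coordinates of a single monomial the Hamiltonian only involves exponents supported on the
  variables of that monomial, so it is compatible with restriction to \<open>p\<close> variables.
\<close>

lemma vanishes_on_hamiltonian:
  assumes "vanishes_on p (p_expand n f)"
  shows "vanishes_on p (p_expand n (hamiltonian n c f))"
  unfolding vanishes_on_def
proof (intro allI impI)
  fix a :: expo assume a: "card (keys a) \<le> p"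
  have "lax c (mps_coeff (p_expand n f)) i a = 0" if "i \<in> keys a" for i
  proof -
    have "mps_coeff (p_expand n f) (shift a i l s) = 0" for l s
    proof -
      have "keys (shift a i l s) \<subseteq> keys a" using keys_shift_subset[of a i l s] that by auto
      then have "card (keys (shift a i l s)) \<le> p"
        using a by (meson card_mono finite_keys order_trans)
      then show ?thesis using assms by (simp add: vanishes_on_def)
    qed
    moreover have "mps_coeff (p_expand n f) a = 0" using assms a by (simp add: vanishes_on_def)
    ultimately show ?thesis by (simp add: lax_def)
  qed
  then show "mps_coeff (p_expand n (hamiltonian n c f)) a = 0" by (simp add: hamiltonian_coeff)
qed

lemma vanishes_on_virasoro_adj:
  assumes g: "vanishes_on p (p_expand (n - k) g)" and k: "1 \<le> k" "k \<le> n"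
  shows "vanishes_on p (p_expand n (virasoro_adj n c k g))"
proof -
  have "p_expand n (virasoro_adj n c k g)
      = (\<Sum>j\<in>{1..n - k}. power_sum (k + j) * p_expand (n - k - j) (lower j g))
     + (\<Sum>i\<in>{1..<k}. power_sum (k - i) * (power_sum i * p_expand (n - k) g))
     + mps_const (of_nat k * (\<alpha> - 1) - c) * (power_sum k * p_expand (n - k) g)"
  proof -
    have "p_expand n (raise (k - i) (raise i g)) = power_sum (k - i) * (power_sum i * p_expand (n - k) g)"
      if "i \<in> {1..<k}" for i
    proof -
      have e: "n - (k - i) - i = n - k" using that k by auto
      have "p_expand n (raise (k - i) (raise i g)) = power_sum (k - i) * p_expand (n - (k - i)) (raise i g)"
        using that k by (intro p_expand_raise) auto
      also have "p_expand (n - (k - i)) (raise i g) = power_sum i * p_expand (n - (k - i) - i) g"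
        using that k by (intro p_expand_raise) auto
      finally show ?thesis unfolding e .
    qed
    moreover have "p_expand n (raise (k + j) (lower j g))
        = power_sum (k + j) * p_expand (n - k - j) (lower j g)"
      if "j \<in> {1..n - k}" for j
    proof -
      have "k + j \<le> n" using that k by auto
      then show ?thesis using k by (simp add: p_expand_raise)
    qed
    ultimately show ?thesis
      unfolding virasoro_adj_def p_expand_add p_expand_sum p_expand_scale using k
          by (simp add: p_expand_raise)
  qed
  moreover have "vanishes_on p (\<Sum>j\<in>{1..n - k}. power_sum (k + j) * p_expand (n - k - j) (lower j g))"
    unfolding vanishes_on_def
  proof (intro allI impI)
    fix a :: expo assume a: "card (keys a) \<le> p"
    have "mps_coeff (\<Sum>j\<in>{1..n - k}. power_sum (k + j) * p_expand (n - k - j) (lower j g)) a =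
      (\<Sum>l\<in>keys a. mps_coeff (mps_var_power l k
          * (\<Sum>j\<in>{1..n - k}. mps_var_power l j * p_expand (n - k - j) (lower j g))) a)"
      using k by (simp add: mps_coeff_power_sum_mult sum.swap[of _ _ "keys a"] sum_distrib_left
          mps_var_power_add mult.assoc)
    also have "\<dots> = (\<Sum>l\<in>keys a. \<alpha> * mps_coeff (mps_var_power l k * mps_euler l (p_expand (n - k) g)) a)"
      unfolding euler_p_expand[symmetric] by (simp add: mps_const_mult mps_scale_mult_right)
    also have "\<dots> = 0"
      using vanishes_on_var_power_mult[OF vanishes_on_euler[OF g]] a
      by (simp add: vanishes_on_def)
    finally show "mps_coeff (\<Sum>j\<in>{1..n - k}. power_sum (k + j) * p_expand (n - k - j) (lower j g)) a = 0" .
  qed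
  moreover have "vanishes_on p (power_sum (k - i) * (power_sum i * p_expand (n - k) g))"
      if "i \<in> {1..<k}" for i
    using that g by (intro vanishes_on_power_sum_mult) auto
  moreover have "vanishes_on p (power_sum k * p_expand (n - k) g)"
    using k g by (intro vanishes_on_power_sum_mult) auto
  ultimately show ?thesis by (simp add: vanishes_on_def)
qed

end

section \<open>Symmetric coefficient functions\<close>

text \<open>
  The partition formed by the exponents of a monomial. A symmetric function is one whose
  coefficients depend on the type only.
\<close>

definition expo_type :: "expo \<Rightarrow> nat multiset" where
  "expo_type a = image_mset (lookup a) (mset_set (keys a))"

lemma size_expo_type [simp]: "size (expo_type a) = card (keys a)"
  by (simp add: expo_type_def)

lemma sum_mset_expo_type: "sum_mset (expo_type a) = deg a"
  by (simp add: expo_type_def deg_def sum_unfold_sum_mset)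

lemma zero_notin_expo_type: "0 \<notin># expo_type a"
  by (auto simp: expo_type_def in_keys_iff)

lemma expo_type_parts_of: "expo_type a \<in> parts_of (deg a)"
  by (simp add: parts_of_def sum_mset_expo_type zero_notin_expo_type)

lemma expo_type_eq_empty: "expo_type a = {#} \<longleftrightarrow> a = 0"
proof
  assume "expo_type a = {#}"
  then have "card (keys a) = 0" by (metis size_expo_type size_empty)
  then show "a = 0" by simp
qed (simp add: expo_type_def)

lemma expo_type_permute:
  assumes "bij \<pi>" "\<And>x. lookup b x = lookup a (\<pi> x)"
  shows "expo_type b = expo_type a"
proof -
  have inj: "inj_on \<pi> (keys b)" using assms(1) by (meson bij_is_inj inj_on_subset subset_UNIV)
  have "\<pi> ` keys b = keys a"
    using assms by (force simp: in_keys_iff bij_def surj_def)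
  moreover have "expo_type b = image_mset (lookup a) (image_mset \<pi> (mset_set (keys b)))"
    unfolding expo_type_def multiset.map_comp by (rule image_mset_cong) (simp add: assms(2))
  ultimately show ?thesis
    using image_mset_mset_set[OF inj] by (simp add: expo_type_def)
qed

lemma expo_type_diff_single:
  assumes "l \<in> keys a" "k \<le> lookup a l"
  shows "expo_type (a - single l k) =
    (if lookup a l = k then expo_type a - {#lookup a l#} else add_mset (lookup a l - k) (expo_type a
        - {#lookup a l#}))"
proof -
  have *: "expo_type a - {#lookup a l#} = image_mset (lookup a) (mset_set (keys a - {l}))"
    using assms(1) by (simp add: expo_type_def mset_set.remove[of "keys a" l])
  have l: "lookup (a - single l k) x = (if x = l then lookup a l - k else lookup a x)" for x
    by (auto simp: lookup_minus lookup_single when_def)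
  have k: "keys (a - single l k) = (if lookup a l = k then keys a - {l} else insert l (keys a - {l}))"
    using assms unfolding set_eq_iff in_keys_iff l by (auto simp: in_keys_iff)
  have "image_mset (lookup (a - single l k)) (mset_set (keys a - {l}))
      = image_mset (lookup a) (mset_set (keys a - {l}))"
    by (rule image_mset_cong) (auto simp: l)
  moreover have "mset_set (insert l (keys a - {l})) = add_mset l (mset_set (keys a - {l}))"
    by (rule mset_set.insert) auto
  ultimately show ?thesis unfolding * by (auto simp: expo_type_def k l simp del: insert_Diff_single)
qed

lemma power_sum_mset_coeff_expo_type:
  assumes "0 \<notin># \<rho>"
  shows "\<exists>G. \<forall>a. mps_coeff (power_sum_mset \<rho> :: 'a::comm_ring_1 mps) a = G (expo_type a)"
  using assms
proof (induction \<rho>)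
  case empty
  show ?case by (rule exI[of _ "\<lambda>M. if M = {#} then 1 else 0"]) (simp add: mps_coeff_1 expo_type_eq_empty)
next
  case (add k \<rho>)
  then obtain G :: "_ \<Rightarrow> 'a" where G: "mps_coeff (power_sum_mset \<rho>) a = G (expo_type a)" for a by auto
  define H where "H M x = (if k \<le> x then G (if x
      = k then M - {#x#} else add_mset (x - k) (M - {#x#})) else 0)" for M x
  have "mps_coeff (power_sum_mset (add_mset k \<rho>)) a = (\<Sum>x\<in>#expo_type a. H (expo_type a) x)" for a
  proof -
    have "mps_coeff (power_sum_mset (add_mset k \<rho>)) a = (\<Sum>l\<in>keys a. H (expo_type a) (lookup a l))"
      using add.prems
      by (auto simp: mps_coeff_power_sum_mult mps_coeff_var_power_mult G H_def expo_type_diff_single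
          intro!: sum.cong)
    then show ?thesis by (simp add: expo_type_def sum_unfold_sum_mset multiset.map_comp comp_def)
  qed
  then show ?case by (intro exI[of _ "\<lambda>M. \<Sum>x\<in>#M. H M x"]) simp
qed

lemma power_sum_mset_homogeneous:
  assumes "0 \<notin># \<rho>" "mps_coeff (power_sum_mset \<rho> :: 'a::comm_ring_1 mps) a \<noteq> 0"
  shows "deg a = sum_mset \<rho>"
  using assms
proof (induction \<rho> arbitrary: a)
  case empty
  then show ?case by (auto simp: mps_coeff_1 deg_def split: if_splits)
next
  case (add k \<rho>)
  then have "\<exists>l\<in>keys a. mps_coeff (mps_var_power l k * power_sum_mset \<rho> :: 'a mps) a \<noteq> 0"
    by (auto simp: mps_coeff_power_sum_mult dest: sum.not_neutral_contains_not_neutral)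
  then obtain l where l: "l \<in> keys a" "k
      \<le> lookup a l" "mps_coeff (power_sum_mset \<rho> :: 'a mps) (a - single l k) \<noteq> 0"
    by (auto simp: mps_coeff_var_power_mult split: if_splits)
  have "deg (a - single l k) = sum_mset \<rho>" using add l by auto
  moreover have "deg (a - single l k) + k = deg a"
  proof -
    have "lookup a l \<in># expo_type a" using l(1) by (auto simp: expo_type_def)
    then have "sum_mset (expo_type a) = lookup a l + sum_mset (expo_type a - {#lookup a l#})"
      by (metis sum_mset.remove)
    then show ?thesis
      using l unfolding sum_mset_expo_type[symmetric] by (auto simp: expo_type_diff_single)
  qed
  ultimately show ?case by simp
qed

lemma p_expand_coeff_expo_type:
  fixes f :: "nat multiset \<Rightarrow> 'a::comm_ring_1"
  shows "\<exists>G. \<forall>a. mps_coeff (p_expand n f) a = G (expo_type a)"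
proof -
  have "\<forall>\<rho>\<in>parts_of n. \<exists>G. \<forall>a. mps_coeff (power_sum_mset \<rho> :: 'a mps) a = G (expo_type a)"
    by (intro ballI power_sum_mset_coeff_expo_type) (auto simp: parts_of_def)
  then obtain G where "\<forall>\<rho>\<in>parts_of n. \<forall>a. mps_coeff (power_sum_mset \<rho> :: 'a mps) a = G \<rho> (expo_type a)"
    unfolding bchoice_iff by blast
  then show ?thesis
    by (intro exI[of _ "\<lambda>M. \<Sum>\<rho>\<in>parts_of n. f \<rho> * G \<rho> M"]) (simp add: p_expand_def)
qed

lemma p_expand_coeff_cong_expo_type: "expo_type a = expo_type b \<Longrightarrow> mps_coeff (p_expand n f) a
    = mps_coeff (p_expand n f) b"
  using p_expand_coeff_expo_type[of n f] by auto

lemma p_expand_homogeneous: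
  fixes f :: "nat multiset \<Rightarrow> 'a::comm_ring_1"
  assumes "mps_coeff (p_expand n f) a \<noteq> 0" shows "deg a = n"
proof -
  have "(\<Sum>\<rho>\<in>parts_of n. f \<rho> * mps_coeff (power_sum_mset \<rho>) a) \<noteq> 0"
    using assms by (simp add: p_expand_def)
  then obtain \<rho> where \<rho>: "\<rho> \<in> parts_of n" and "f \<rho> * mps_coeff (power_sum_mset \<rho>) a \<noteq> 0"
    by (rule sum.not_neutral_contains_not_neutral)
  then have "mps_coeff (power_sum_mset \<rho> :: 'a mps) a \<noteq> 0" by auto
  with \<rho> show ?thesis
    using power_sum_mset_homogeneous[of \<rho> a, where 'a = 'a] by (auto simp: parts_of_def)
qed

text \<open>
  Invariance of a coefficient function under exchanging two variables of \<open>N\<close>. The set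
  \<open>N\<close> is a parameter because the one-row complement below lives on finitely many
  variables.
\<close>

definition swap_invariant :: "nat set \<Rightarrow> (expo \<Rightarrow> 'a) \<Rightarrow> bool" where
  "swap_invariant N f \<longleftrightarrow> (\<forall>i\<in>N. \<forall>l\<in>N. \<forall>a b. i \<noteq> l \<longrightarrow> lookup b i = lookup a l \<longrightarrow> lookup b l = lookup a i \<longrightarrow>
     (\<forall>x. x \<noteq> i \<longrightarrow> x \<noteq> l \<longrightarrow> lookup b x = lookup a x) \<longrightarrow> f b = f a)"

lemma swap_invariantD:
  assumes "swap_invariant N f" "i \<in> N" "l \<in> N" "i \<noteq> l" "lookup b i = lookup a l" "lookup b l = lookup a i"
    "\<And>x. x \<noteq> i \<Longrightarrow> x \<noteq> l \<Longrightarrow> lookup b x = lookup a x"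
  shows "f b = f a"
  using assms unfolding swap_invariant_def by blast

lemma swap_invariant_p_expand: "swap_invariant N (mps_coeff (p_expand n f))"
  unfolding swap_invariant_def
proof (intro ballI allI impI)
  fix i l and a b :: expo
  assume *: "i \<noteq> l" "lookup b i = lookup a l" "lookup b l = lookup a i"
    "\<forall>x. x \<noteq> i \<longrightarrow> x \<noteq> l \<longrightarrow> lookup b x = lookup a x"
  define \<pi> where "\<pi> x = (if x = i then l else if x = l then i else x)" for x
  have "bij \<pi>" by (rule o_bij[of \<pi>]) (auto simp: \<pi>_def fun_eq_iff)
  then have "expo_type b = expo_type a" by (rule expo_type_permute) (auto simp: \<pi>_def *)
  then show "mps_coeff (p_expand n f) b = mps_coeff (p_expand n f) a"
      by (rule p_expand_coeff_cong_expo_type)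
qed

definition exponents_le :: "nat \<Rightarrow> (expo \<Rightarrow> 'a::zero) \<Rightarrow> bool" where
  "exponents_le q f \<longleftrightarrow> (\<forall>a x. lookup a x > q \<longrightarrow> f a = 0)"

lemma deg_superset: "finite N \<Longrightarrow> keys a \<subseteq> N \<Longrightarrow> deg a = (\<Sum>x\<in>N. lookup a x)"
  unfolding deg_def by (rule sum.mono_neutral_left) (auto simp: in_keys_iff)

lemma sum_replace_two:
  assumes "finite N" "i \<in> N" "l \<in> N" "i \<noteq> l"
  shows "(\<Sum>x\<in>N. g x) = g i + g l + (\<Sum>x\<in>N - {i, l}. g x)"
proof -
  have "N = insert i (insert l (N - {i, l}))" using assms by auto
  then have "(\<Sum>x\<in>N. g x) = (\<Sum>x\<in>insert i (insert l (N - {i, l})). g x)" by simp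
  then show ?thesis using assms by (simp add: add.assoc)
qed

lemma prod_replace_two:
  assumes "finite N" "i \<in> N" "l \<in> N" "i \<noteq> l"
  shows "(\<Prod>x\<in>N. g x) = g i * g l * (\<Prod>x\<in>N - {i, l}. g x)"
proof -
  have "N = insert i (insert l (N - {i, l}))" using assms by auto
  then have "(\<Prod>x\<in>N. g x) = (\<Prod>x\<in>insert i (insert l (N - {i, l})). g x)" by simp
  then show ?thesis using assms by (simp add: mult.assoc)
qed

lemma deg_shift:
  assumes "i \<noteq> l" "s \<le> lookup a l"
  shows "deg (shift a i l s) = deg a"
proof -
  let ?N = "insert i (insert l (keys a))"
  have "deg (shift a i l s) = (\<Sum>x\<in>?N. lookup (shift a i l s) x)"
    using keys_shift_subset[of a i l s] by (intro deg_superset) auto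
  also have "\<dots> = (lookup a i + s) + (lookup a l - s) + (\<Sum>x\<in>?N - {i, l}. lookup (shift a i l s) x)"
    using assms by (subst sum_replace_two[of _ i l]) (auto simp: lookup_shift)
  also have "(\<Sum>x\<in>?N - {i, l}. lookup (shift a i l s) x) = (\<Sum>x\<in>?N - {i, l}. lookup a x)"
    using assms by (intro sum.cong) (auto simp: lookup_shift)
  also have "(lookup a i + s) + (lookup a l - s) + (\<Sum>x\<in>?N - {i, l}. lookup a x) = (\<Sum>x\<in>?N. lookup a x)"
    using assms by (subst sum_replace_two[of ?N i l]) auto
  also have "\<dots> = deg a" by (rule deg_superset[symmetric]) auto
  finally show ?thesis .
qed

text \<open>
  The coefficient of the divided difference $x_l(\theta_i-\theta_l)f/(x_i-x_l)$.
\<close>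

definition exchange :: "(expo \<Rightarrow> 'k) \<Rightarrow> nat \<Rightarrow> nat \<Rightarrow> expo \<Rightarrow> 'k::linordered_field" where
  "exchange f i l a = (\<Sum>s\<in>{1..lookup a l}.
     (of_nat (lookup a i) - of_nat (lookup a l) + 2 * of_nat s) * f (shift a i l s))"

text \<open>
  For symmetric $f$ the terms in which the two exponents are less spread out than in $a$ cancel in
  pairs, since moving $s$ and $d-s$ units gives exponents that differ by a swap. What remains is a
  diagonal term and strictly more spread exponents: the operator is triangular.
\<close>

lemma exchange_split:
  fixes f :: "expo \<Rightarrow> 'k::linordered_field"
  assumes sym: "swap_invariant N f" "i \<in> N" "l \<in> N" and il: "i \<noteq> l"
  shows "exchange f i l a = of_nat (lookup a l - lookup a i) * f a
    + (\<Sum>s\<in>{lookup a l - lookup a i<..lookup a l}. (of_nat (lookup a i) - of_nat (lookup a l)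
        + 2 * of_nat s) * f (shift a i l s))"
proof (cases "lookup a i < lookup a l")
  case False
  then have "{lookup a l - lookup a i<..lookup a l} = {1..lookup a l}" by auto
  then show ?thesis using False by (simp add: exchange_def)
next
  case True
  define d where "d = lookup a l - lookup a i"
  define T where "T s = (of_nat (lookup a i) - of_nat (lookup a l) + 2 * of_nat s)
      * f (shift a i l s)" for s
  have d: "0 < d" "d \<le> lookup a l" "lookup a l = lookup a i + d" using True by (auto simp: d_def)
  have anti: "T (d - s) = - T s" if "s \<in> {1..<d}" for s
  proof -
    have "f (shift a i l (d - s)) = f (shift a i l s)"
      using that d by (intro swap_invariantD[OF sym il]) (auto simp: lookup_shift il)
    then show ?thesis using that d by (auto simp: T_def of_nat_diff algebra_simps)
  qed
  have "(\<Sum>s\<in>{1..<d}. T s) = (\<Sum>s\<in>{1..<d}. T (d - s))"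
    by (rule sum.reindex_bij_witness[where i = "\<lambda>s. d - s" and j = "\<lambda>s. d - s"]) auto
  also have "\<dots> = - (\<Sum>s\<in>{1..<d}. T s)" using anti by (simp add: sum_negf)
  finally have 0: "(\<Sum>s\<in>{1..<d}. T s) = 0" by (simp add: eq_neg_iff_add_eq_0 flip: mult_2)
  have "f (shift a i l d) = f a"
    using d by (intro swap_invariantD[OF sym il]) (auto simp: lookup_shift il)
  then have Td: "T d = of_nat d * f a" using d by (simp add: T_def algebra_simps)
  have "exchange f i l a = (\<Sum>s\<in>{1..<d} \<union> {d} \<union> {d<..lookup a l}. T s)"
    unfolding exchange_def T_def using d by (intro sum.cong) auto
  also have "\<dots> = (\<Sum>s\<in>{1..<d} \<union> {d}. T s) + (\<Sum>s\<in>{d<..lookup a l}. T s)"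
    by (rule sum.union_disjoint) auto
  also have "(\<Sum>s\<in>{1..<d} \<union> {d}. T s) = (\<Sum>s\<in>{1..<d}. T s) + T d"
    by (subst sum.union_disjoint) auto
  finally show ?thesis using 0 Td by (simp add: T_def d_def)
qed

text \<open>
  If some exponent exceeds \<open>q\<close>, a transfer of units either leaves an exponent above
  \<open>q\<close> or belongs to the terms that cancel in pairs.
\<close>

lemma exchange_zero:
  fixes f :: "expo \<Rightarrow> 'k::linordered_field"
  assumes sym: "swap_invariant N f" "i \<in> N" "l \<in> N" and il: "i \<noteq> l"
    and f: "exponents_le q f" and x: "lookup a x > q"
  shows "exchange f i l a = 0"
proof (cases "x = l \<and> lookup a i < lookup a l")
  case True
  have "f a = 0" using f x by (auto simp: exponents_le_def)
  moreover have "f (shift a i l s) = 0" if "s \<in> {lookup a l - lookup a i<..lookup a l}" for s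
  proof -
    have "lookup (shift a i l s) i > q" using that il x True by (auto simp: lookup_shift)
    then show ?thesis using f by (auto simp: exponents_le_def)
  qed
  ultimately show ?thesis by (subst exchange_split[OF sym il]) auto
next
  case False
  have "f (shift a i l s) = 0" for s
  proof -
    have "\<exists>y. lookup (shift a i l s) y > q"
    proof (cases "x = l")
      case True
      then show ?thesis using False il x by (intro exI[of _ i]) (auto simp: lookup_shift)
    next
      case False
      then show ?thesis using il x by (intro exI[of _ x]) (auto simp: lookup_shift)
    qed
    then show ?thesis using f by (auto simp: exponents_le_def)
  qed
  then show ?thesis by (simp add: exchange_def)
qed

lemma exchange_superset:
  assumes "finite N" "keys a \<subseteq> N"
  shows "(\<Sum>l\<in>keys a - {i}. exchange f i l a) = (\<Sum>l\<in>N - {i}. exchange f i l a)"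
proof (intro sum.mono_neutral_left ballI)
  fix l assume "l \<in> N - {i} - (keys a - {i})"
  then have "lookup a l = 0" by (auto simp: in_keys_iff)
  then show "exchange f i l a = 0" by (simp add: exchange_def)
qed (use assms in auto)

context jack_parameter
begin

lemma lax_exchange:
  "lax c f i a = \<alpha> * ((\<alpha> * of_nat (lookup a i) - c) * of_nat (lookup a i) * f a
     + (\<Sum>l\<in>keys a - {i}. exchange f i l a) - of_nat (deg a) * f a)"
  by (simp add: lax_def exchange_def)

lemma lax_zero:
  assumes sym: "swap_invariant N f" "i \<in> N" "keys a \<subseteq> N" and f: "exponents_le q f" and x: "lookup a x > q"
  shows "lax c f i a = 0"
proof -
  have "f a = 0" using f x by (auto simp: exponents_le_def)
  moreover have "exchange f i l a = 0" if "l \<in> keys a - {i}" for l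
    using that sym by (intro exchange_zero[OF _ _ _ _ f x, of N]) auto
  ultimately show ?thesis by (simp add: lax_exchange)
qed

text \<open>
  For an absent variable only the swaps survive, and these add up to the degree. So sums of these
  coefficients may range over any set that contains the variables of the monomial.
\<close>

lemma lax_notin_keys:
  assumes sym: "swap_invariant N f" "i \<in> N" "keys a \<subseteq> N" and i: "i \<notin> keys a"
  shows "lax c f i a = 0"
proof -
  have i0: "lookup a i = 0" using i by (simp add: in_keys_iff)
  have "exchange f i l a = of_nat (lookup a l) * f a" if "l \<in> keys a - {i}" for l
    using that sym by (subst exchange_split[of N]) (auto simp: i0)
  then have "(\<Sum>l\<in>keys a - {i}. exchange f i l a) = of_nat (deg a) * f a"
    using i by (simp add: deg_def sum_distrib_right)
  then show ?thesis by (simp add: lax_exchange i0)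
qed

text \<open>
  At the monomial $(x_1\cdots x_p)^q$ every transfer between variables would create an exponent
  above $q$. Only the scalar part remains, and it is zero for this value of $c$.
\<close>

lemma lax_rectangle:
  assumes f: "exponents_le q f" and a: "\<And>x. x \<in> keys a \<Longrightarrow> lookup a x = q" "card (keys a) = p"
    and i: "i \<in> keys a"
  shows "lax (\<alpha> * of_nat q - of_nat p) f i a = 0"
proof -
  have "f (shift a i l s) = 0" if "s \<in> {1..lookup a l}" "l \<noteq> i" for s l
  proof -
    have "lookup (shift a i l s) i > q" using that a(1)[OF i] by (auto simp: lookup_shift)
    then show ?thesis using f by (auto simp: exponents_le_def)
  qed
  then have "(\<Sum>l\<in>keys a - {i}. exchange f i l a) = 0"
    by (intro sum.neutral) (auto simp: exchange_def)
  moreover have "deg a = p * q" using a by (simp add: deg_def)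
  ultimately show ?thesis using a(1)[OF i] by (simp add: lax_exchange algebra_simps)
qed

section \<open>The solution in one variable more than the number of rows\<close>

text \<open>
  The coefficient $(1/\alpha)_m/m!$ of $t^m$ in $(1-t)^{-1/\alpha}$.
\<close>

fun one_row_coeff :: "nat \<Rightarrow> 'k" where
  "one_row_coeff 0 = 1"
| "one_row_coeff (Suc m) = (1 + \<alpha> * of_nat m) / (\<alpha> * of_nat (Suc m)) * one_row_coeff m"

lemma one_row_coeff_Suc: "\<alpha> * of_nat (Suc m) * one_row_coeff (Suc m) = (1 + \<alpha> * of_nat m) * one_row_coeff m"
proof -
  have "\<alpha> * of_nat (Suc m) \<noteq> 0" using alpha_pos by (auto simp del: of_nat_Suc)
  then show ?thesis by (simp del: of_nat_Suc)
qed

lemma one_row_coeff_pos: "one_row_coeff m > 0"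
proof (induction m)
  case (Suc m)
  have "0 < 1 + \<alpha> * of_nat m" "0 < \<alpha> * of_nat (Suc m)"
    using alpha_pos by (auto intro!: add_pos_nonneg mult_pos_pos simp del: of_nat_Suc)
  then show ?case using Suc by (simp del: of_nat_Suc)
qed simp

text \<open>
  The summand is a telescoping difference, by the two-term recursion of the coefficients. In terms
  of generating functions this is the Euler-Poisson-Darboux equation for
  $((1-ty)(1-ty'))^{-1/\alpha}$.
\<close>

lemma one_row_coeff_sum:
  "(\<Sum>s\<in>{1..x}. (of_nat y - of_nat x + 2 * of_nat s) * (one_row_coeff (x - s) * one_row_coeff (y + s))) =
     (\<alpha> * of_nat x * of_nat y + of_nat x) * (one_row_coeff x * one_row_coeff y)"
proof -
  \<comment> \<open>The boundary term of the telescoping sum; it vanishes at \<open>s = x\<close>.\<close>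
  define T where "T s = \<alpha> * of_nat (x - s) * of_nat (Suc (y + s)) * one_row_coeff (x - s)
      * one_row_coeff (Suc (y + s))" for s
  have T': "T s = of_nat (x - s) * one_row_coeff (x - s)
      * ((1 + \<alpha> * of_nat (y + s)) * one_row_coeff (y + s))" for s
    unfolding T_def one_row_coeff_Suc[symmetric] by (simp only: mult_ac)
  have "(\<Sum>s\<in>{1..t}. (of_nat y - of_nat x + 2 * of_nat s)
      * (one_row_coeff (x - s) * one_row_coeff (y + s))) = T 0 - T t" if "t \<le> x" for t
    using that
  proof (induction t)
    case (Suc t)
    have x: "x - t = Suc (x - Suc t)" using Suc.prems by simp
    have "T t = of_nat (Suc (y + t)) * one_row_coeff (Suc (y + t))
        * ((1 + \<alpha> * of_nat (x - Suc t)) * one_row_coeff (x - Suc t))"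
      unfolding T_def x one_row_coeff_Suc[symmetric] by (simp only: mult_ac)
    moreover have "T (Suc t) = of_nat (x - Suc t) * one_row_coeff (x - Suc t)
        * ((1 + \<alpha> * of_nat (Suc (y + t))) * one_row_coeff (Suc (y + t)))"
      unfolding T' by simp
    ultimately have "T t - T (Suc t) = (of_nat (Suc (y + t)) - of_nat (x - Suc t))
        * (one_row_coeff (x - Suc t) * one_row_coeff (Suc (y + t)))"
      by (simp add: algebra_simps del: one_row_coeff.simps)
    also have "of_nat (Suc (y + t)) - of_nat (x - Suc t) = of_nat y - of_nat x + 2 * (of_nat (Suc t) :: 'k)"
      using Suc.prems by (simp add: of_nat_diff)
    finally show ?case using Suc by (simp del: one_row_coeff.simps)
  qed simp
  from this[of x] show ?thesis unfolding T' by (simp add: algebra_simps)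
qed

text \<open>
  The function $(\prod_{x\in N}x)^q\,g_q(1/x)$, where $g_q$ is the one-row function with
  generating series $\prod_x(1-tx)^{-1/\alpha}$. On $p+1$ variables the complement of $p\times q$
  in the box $(p+1)\times q$ is a single row, so this is the expected restriction of the Jack
  function.
\<close>

definition one_row_complement :: "nat set \<Rightarrow> nat \<Rightarrow> nat \<Rightarrow> expo \<Rightarrow> 'k" where
  "one_row_complement N n q a = (if keys a \<subseteq> N \<and> deg a = n
      \<and> (\<forall>x\<in>N. lookup a x \<le> q) then \<Prod>x\<in>N. one_row_coeff (q - lookup a x) else 0)"

lemma swap_invariant_one_row_complement:
  assumes "finite N"
  shows "swap_invariant N (one_row_complement N n q)"
  unfolding swap_invariant_def
proof (intro ballI allI impI)
  fix i l and a b :: expo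
  assume N: "i \<in> N" "l \<in> N" and *: "i \<noteq> l" "lookup b i = lookup a l" "lookup b l = lookup a i"
    "\<forall>x. x \<noteq> i \<longrightarrow> x \<noteq> l \<longrightarrow> lookup b x = lookup a x"
  have k: "keys b \<subseteq> N \<longleftrightarrow> keys a \<subseteq> N"
    unfolding subset_iff in_keys_iff using N * by metis
  have d: "deg b = deg a" if "keys a \<subseteq> N"
    using that k assms N * by (simp add: deg_superset[of N] sum_replace_two[of N i l])
  have q: "(\<forall>x\<in>N. lookup b x \<le> q) \<longleftrightarrow> (\<forall>x\<in>N. lookup a x \<le> q)"
    using N * by metis
  have "(\<Prod>x\<in>N. one_row_coeff (q - lookup b x)) = (\<Prod>x\<in>N. one_row_coeff (q - lookup a x))"
    using assms N * by (simp add: prod_replace_two[of N i l])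
  then show "one_row_complement N n q b = one_row_complement N n q a"
    using k d q by (auto simp: one_row_complement_def)
qed

lemma exponents_le_one_row_complement: "exponents_le q (one_row_complement N n q)"
  unfolding exponents_le_def
proof (intro allI impI)
  fix a :: expo and x assume x: "q < lookup a x"
  then have "x \<in> keys a" by (auto simp: in_keys_iff)
  then have "\<not> (keys a \<subseteq> N \<and> (\<forall>x\<in>N. lookup a x \<le> q))"
    using x by (auto simp: not_le)
  then show "one_row_complement N n q a = 0" by (auto simp: one_row_complement_def)
qed

text \<open>
  Each variable $l\neq i$ contributes $(\alpha b_ib_l+b_i)$ times the coefficient, where $b=q-a$
  is the complementary exponent. As the $b_l$ sum to $q$, all contributions cancel against the
  scalar part.
\<close>

lemma lax_one_row_complement:
  assumes N: "finite N" "card N = Suc p" "i \<in> N" and a: "keys a \<subseteq> N" "deg a = p * q"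
  shows "lax (\<alpha> * of_nat q - of_nat p) (one_row_complement N (p * q) q) i a = 0"
proof (cases "\<exists>x. lookup a x > q")
  case True
  then show ?thesis
    using lax_zero[OF swap_invariant_one_row_complement[OF N(1)] N(3) a(1)
        exponents_le_one_row_complement] by auto
next
  case False
  define b where "b x = q - lookup a x" for x
  have ab: "lookup a x \<le> q" "lookup a x + b x = q" for x using False by (auto simp: b_def not_less)
  have "(\<Sum>x\<in>N. lookup a x) + (\<Sum>x\<in>N. b x) = Suc p * q"
    by (simp add: sum.distrib[symmetric] ab N)
  moreover have "(\<Sum>x\<in>N. lookup a x) = p * q" using a deg_superset[OF N(1) a(1)] by simp
  ultimately have sb: "(\<Sum>x\<in>N. b x) = q" by simp
  have ex: "exchange (one_row_complement N (p * q) q) i l a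
      = (\<alpha> * of_nat (b i) * of_nat (b l) + of_nat (b i)) * one_row_complement N (p * q) q a"
    if l: "l \<in> N - {i}" for l
  proof -
    define r where "r = (\<Prod>x\<in>N - {i, l}. one_row_coeff (b x))"
    have il: "i \<noteq> l" "l \<in> N" using l by auto
    have bil: "b i + b l \<le> q"
      using sb sum_replace_two[OF N(1) N(3) il(2) il(1), of b] by simp
    have sh: "one_row_complement N (p * q) q (shift a i l s)
        = (if s \<le> b i then r * (one_row_coeff (b i - s) * one_row_coeff (b l + s)) else 0)"
      if s: "s \<in> {1..lookup a l}" for s
    proof (cases "s \<le> b i")
      case True
      have le: "lookup (shift a i l s) x \<le> q" for x
        using True ab(1)[of x] ab(1)[of i] ab(1)[of l] il by (auto simp: lookup_shift b_def)
      have kd: "keys (shift a i l s) \<subseteq> N" "deg (shift a i l s) = p * q"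
        using keys_shift_subset[of a i l s] N a s il by (auto simp: deg_shift)
      have "(\<Prod>x\<in>N. one_row_coeff (q - lookup (shift a i l s) x))
          = one_row_coeff (b i - s) * one_row_coeff (b l + s) * r"
      proof (subst prod_replace_two[OF N(1) N(3) il(2) il(1)], intro arg_cong2[where f = "(*)"])
        show "one_row_coeff (q - lookup (shift a i l s) i) = one_row_coeff (b i - s)" using il
            by (simp add: lookup_shift b_def)
        show "one_row_coeff (q - lookup (shift a i l s) l) = one_row_coeff (b l + s)"
          using il s ab[of l] by (intro arg_cong[of _ _ one_row_coeff]) (auto simp: lookup_shift b_def)
        show "(\<Prod>x\<in>N - {i, l}. one_row_coeff (q - lookup (shift a i l s) x)) = r"
          unfolding r_def using il by (intro prod.cong) (auto simp: lookup_shift b_def)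
      qed
      then show ?thesis using True le kd by (simp add: one_row_complement_def mult.commute)
    next
      case False
      then have "lookup (shift a i l s) i > q" using ab[of i] il by (simp add: lookup_shift)
      then show ?thesis using False exponents_le_one_row_complement[of q N "p * q"]
          by (auto simp: exponents_le_def)
    qed
    have "exchange (one_row_complement N (p * q) q) i l a
        = (\<Sum>s\<in>{1..lookup a l}. (of_nat (lookup a i) - of_nat (lookup a l) + 2 * of_nat s) * (if s
        \<le> b i then r * (one_row_coeff (b i - s) * one_row_coeff (b l + s)) else 0))"
      unfolding exchange_def by (intro sum.cong refl arg_cong2[where f = "(*)"] sh)
    also have "\<dots> = (\<Sum>s\<in>{1..b i}. r * ((of_nat (b l) - of_nat (b i) + 2 * of_nat s)
        * (one_row_coeff (b i - s) * one_row_coeff (b l + s))))"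
    proof (rule sum.mono_neutral_cong_right)
      show "{1..b i} \<subseteq> {1..lookup a l}" using bil ab[of l] by auto
      fix s assume "s \<in> {1..b i}"
      have "of_nat (lookup a i) - of_nat (lookup a l) = (of_nat (b l) - of_nat (b i) :: 'k)"
        using ab[of i] ab[of l] by (simp add: b_def of_nat_diff)
      then show "(of_nat (lookup a i) - of_nat (lookup a l) + 2 * of_nat s) * (if s
          \<le> b i then r * (one_row_coeff (b i - s) * one_row_coeff (b l + s)) else 0)
          = r * ((of_nat (b l) - of_nat (b i) + 2 * of_nat s)
          * (one_row_coeff (b i - s) * one_row_coeff (b l + s)))"
        using \<open>s \<in> {1..b i}\<close> by simp
    qed auto
    also have "\<dots> = r * ((\<alpha> * of_nat (b i) * of_nat (b l) + of_nat (b i))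
        * (one_row_coeff (b i) * one_row_coeff (b l)))"
      unfolding sum_distrib_left[symmetric] one_row_coeff_sum ..
    finally have "exchange (one_row_complement N (p * q) q) i l a =
      r * ((\<alpha> * of_nat (b i) * of_nat (b l) + of_nat (b i))
          * (one_row_coeff (b i) * one_row_coeff (b l)))" .
    moreover have "one_row_complement N (p * q) q a = one_row_coeff (b i) * one_row_coeff (b l) * r"
      using a ab by (simp add: one_row_complement_def b_def[symmetric]
          prod_replace_two[OF N(1) N(3) il(2) il(1)] r_def)
    ultimately show ?thesis by (simp add: algebra_simps)
  qed
  have sb': "(\<Sum>l\<in>N - {i}. b l) = lookup a i"
    using sb ab[of i] N by (simp add: sum.remove)
  have "(\<Sum>l\<in>keys a - {i}. exchange (one_row_complement N (p * q) q) i l a) =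
     (\<Sum>l\<in>N - {i}. (\<alpha> * of_nat (b i) * of_nat (b l) + of_nat (b i)) * one_row_complement N (p * q) q a)"
    unfolding exchange_superset[OF N(1) a(1)] by (intro sum.cong refl ex)
  also have "\<dots> = (\<alpha> * of_nat (b i) * of_nat (\<Sum>l\<in>N - {i}. b l) + of_nat p * of_nat (b i))
      * one_row_complement N (p * q) q a"
    unfolding sum_distrib_right[symmetric] sum.distrib using N by (simp add: sum_distrib_left)
  also have "\<dots> = (\<alpha> * of_nat (b i) * of_nat (lookup a i) + of_nat p * of_nat (b i))
      * one_row_complement N (p * q) q a"
    unfolding sb' ..
  finally have S: "(\<Sum>l\<in>keys a - {i}. exchange (one_row_complement N (p * q) q) i l a) = \<dots>" .
  have q: "of_nat q = of_nat (lookup a i) + (of_nat (b i) :: 'k)" using ab[of i] by (metis of_nat_add)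
  show ?thesis unfolding lax_exchange S a(2) of_nat_mult q by (simp add: algebra_simps)
qed

lemma lax_cong:
  assumes fg: "\<And>a. keys a \<subseteq> N \<Longrightarrow> deg a = n \<Longrightarrow> f a = g a"
    and a: "keys a \<subseteq> N" "deg a = n" "i \<in> N"
  shows "lax c f i a = lax c g i a"
proof -
  have "exchange f i l a = exchange g i l a" if "l \<in> keys a - {i}" for l
    unfolding exchange_def
  proof (intro sum.cong refl arg_cong2[where f = "(*)"] fg)
    fix s assume "s \<in> {1..lookup a l}"
    then show "keys (shift a i l s) \<subseteq> N" "deg (shift a i l s) = n"
      using that a keys_shift_subset[of a i l s] by (auto simp: deg_shift)
  qed
  then show ?thesis using fg a by (simp add: lax_exchange)
qed

lemma lax_diff_scale: "lax c (\<lambda>a. f a - \<kappa> * g a) i a = lax c f i a - \<kappa> * lax c g i a"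
proof -
  have *: "exchange (\<lambda>a. f a - \<kappa> * g a) i l a = exchange f i l a - \<kappa> * exchange g i l a" for l
    unfolding exchange_def sum_distrib_left sum_subtractf[symmetric]
    by (rule sum.cong) (simp_all add: algebra_simps)
  show ?thesis
    unfolding lax_exchange * by (simp add: sum_subtractf sum_distrib_left[symmetric] algebra_simps)
qed

text \<open>
  Up to the factor $\alpha$, the sum in the assumption is the diagonal entry of the Hamiltonian at
  the exponents $t$, and it is zero at those of the rectangle. In general it is $-\alpha\sum_i
  t_i(q-t_i)$ plus a term that is not positive, so it can vanish only at the extremal exponents.
\<close>

lemma eigenvalue_bound:
  fixes t :: "nat \<Rightarrow> nat"
  assumes N: "finite N" "card N = Suc p" and t: "\<And>x. x \<in> N \<Longrightarrow> t x \<le> q" "(\<Sum>x\<in>N. t x) = p * q"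
    and zero: "(\<Sum>i\<in>N. (\<alpha> * of_nat (t i) - (\<alpha> * of_nat q - of_nat p)) * of_nat (t i)
        + of_nat (\<Sum>l\<in>N - {i}. t l - t i) - of_nat (p * q)) = (0 :: 'k)"
    and x: "x \<in> N"
  shows "t x = 0 \<or> t x = q"
proof -
  have 1: "(\<Sum>i\<in>N. \<Sum>l\<in>N - {i}. t l - t i) \<le> p * q"
  proof -
    have "(\<Sum>i\<in>N. \<Sum>l\<in>N - {i}. t l - t i) \<le> (\<Sum>i\<in>N. \<Sum>l\<in>N - {i}. q - t i)"
      using t(1) by (intro sum_mono diff_le_mono) auto
    also have "\<dots> = p * (\<Sum>i\<in>N. q - t i)" using N by (simp add: sum_distrib_left)
    also have "(\<Sum>i\<in>N. q - t i) = q"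
    proof -
      have "(\<Sum>i\<in>N. q - t i) + (\<Sum>i\<in>N. t i) = (\<Sum>i\<in>N. q)"
        unfolding sum.distrib[symmetric] by (rule sum.cong) (auto simp: t(1))
      then show ?thesis using N t(2) by simp
    qed
    finally show ?thesis .
  qed
  have "\<alpha> * (of_nat (t i) * (of_nat (q - t i) :: 'k)) =
      \<alpha> * (of_nat q * of_nat (t i)) - \<alpha> * (of_nat (t i) * of_nat (t i))" if "i \<in> N" for i
    using t(1)[OF that] by (simp add: of_nat_diff algebra_simps)
  then have "(\<Sum>i\<in>N. (\<alpha> * of_nat (t i) - (\<alpha> * of_nat q - of_nat p)) * of_nat (t i)
        + of_nat (\<Sum>l\<in>N - {i}. t l - t i) - of_nat (p * q)) =
      (\<Sum>i\<in>N. of_nat p * of_nat (t i) - \<alpha> * (of_nat (t i) * of_nat (q - t i))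
        + of_nat (\<Sum>l\<in>N - {i}. t l - t i) - of_nat (p * q))"
    by (intro sum.cong refl) (simp add: algebra_simps)
  also have "\<dots> = of_nat p * of_nat (\<Sum>i\<in>N. t i) - \<alpha> * of_nat (\<Sum>i\<in>N. t i * (q - t i))
     + of_nat (\<Sum>i\<in>N. \<Sum>l\<in>N - {i}. t l - t i) - of_nat (Suc p) * of_nat (p * q)"
    using N by (simp add: sum.distrib sum_subtractf sum_distrib_left del: of_nat_Suc)
  also have "\<dots> = of_nat (\<Sum>i\<in>N. \<Sum>l\<in>N - {i}. t l - t i) - of_nat (p * q) - \<alpha> * of_nat (\<Sum>i\<in>N. t i * (q - t i))"
    unfolding t(2) by (simp only: of_nat_Suc) (simp add: algebra_simps del: of_nat_sum)
  finally have "\<alpha> * of_nat (\<Sum>i\<in>N. t i * (q - t i))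
      = of_nat (\<Sum>i\<in>N. \<Sum>l\<in>N - {i}. t l - t i) - (of_nat (p * q) :: 'k)"
    using zero by (simp del: of_nat_sum)
  also have "\<dots> \<le> 0" using 1 by (simp only: diff_le_0_iff_le of_nat_le_iff)
  finally have "of_nat (\<Sum>i\<in>N. t i * (q - t i)) \<le> (0::'k)"
    using alpha_pos by (simp only: mult_le_0_iff) auto
  then have "(\<Sum>i\<in>N. t i * (q - t i)) = 0" by (simp only: of_nat_le_0_iff)
  then have "t x * (q - t x) = 0" using N x by simp
  then show ?thesis using t(1)[OF x] by auto
qed

text \<open>
  On $p+1$ variables the Hamiltonian equation, which is the sum of the Lax equations over all
  variables, already forces each of them. The reason is uniqueness: a solution agrees with a
  multiple of the one-row complement at the extremal exponent, and the difference vanishes because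
  the operator is triangular for the sum of squares of the exponents and its other diagonal
  entries are nonzero.
\<close>

lemma lax_sum_kernel:
  assumes N: "finite N" "card N = Suc p" and q: "q > 0"
    and f: "swap_invariant N f" "exponents_le q f"
    and zero: "\<And>a. keys a \<subseteq> N \<Longrightarrow> deg a = p * q \<Longrightarrow> (\<Sum>i\<in>N. lax (\<alpha> * of_nat q - of_nat p) f i a) = 0"
    and a: "keys a \<subseteq> N" "deg a = p * q" "i \<in> N"
  shows "lax (\<alpha> * of_nat q - of_nat p) f i a = 0"
proof -
  let ?c = "\<alpha> * of_nat q - of_nat p :: 'k"
  let ?g = "one_row_complement N (p * q) q"
  \<comment> \<open>The exponents of the rectangle: one variable is absent, all others have exponent \<open>q\<close>.\<close>
  define extremal where "extremal a j \<longleftrightarrow> j \<in> N \<and> lookup a j = 0 \<and> (\<forall>x\<in>N - {j}. lookup a x = q)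
      \<and> keys a \<subseteq> N" for a j
  obtain j0 where j0: "j0 \<in> N" using N by (metis card.empty nat.distinct(1) ex_in_conv)
  obtain a0 where a0: "extremal a0 j0"
  proof -
    have "finite {x. (if x \<in> N - {j0} then q else 0) \<noteq> 0}" using N by (auto intro: finite_subset[of _ N])
    then have "lookup (Abs_poly_mapping (\<lambda>x. if x \<in> N - {j0} then q else 0))
        = (\<lambda>x. if x \<in> N - {j0} then q else 0)"
      by (rule lookup_Abs_poly_mapping)
    then have "extremal (Abs_poly_mapping (\<lambda>x. if x \<in> N - {j0} then q else 0)) j0"
      using j0 q by (auto simp: extremal_def in_keys_iff split: if_splits)
    then show ?thesis by (rule that)
  qed
  have g0: "?g a0 \<noteq> 0"
  proof -
    have "deg a0 = (\<Sum>x\<in>N. lookup a0 x)" using a0 N by (intro deg_superset) (auto simp: extremal_def)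
    also have "\<dots> = p * q" using a0 N j0 by (simp add: sum.remove[of N j0] extremal_def)
    finally have "?g a0 = (\<Prod>x\<in>N. one_row_coeff (q - lookup a0 x))"
      using a0 by (auto simp: one_row_complement_def extremal_def)
    then show ?thesis using N one_row_coeff_pos by (auto simp: less_imp_neq[symmetric])
  qed
  define \<kappa> where "\<kappa> = f a0 / ?g a0"
  define H where "H a = f a - \<kappa> * ?g a" for a
  have H_eq: "H = (\<lambda>a. f a - \<kappa> * ?g a)" by (simp add: H_def fun_eq_iff)
  have H: "swap_invariant N H" "exponents_le q H"
  proof -
    show "exponents_le q H"
      using f(2) exponents_le_one_row_complement[of q N "p * q"] by (auto simp: H_def exponents_le_def)
    have g: "swap_invariant N ?g" by (rule swap_invariant_one_row_complement[OF N(1)])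
    show "swap_invariant N H"
      unfolding swap_invariant_def
    proof (intro ballI allI impI)
      fix i l and a b :: expo
      assume *: "i \<in> N" "l \<in> N" "i \<noteq> l" "lookup b i = lookup a l" "lookup b l = lookup a i"
        "\<forall>x. x \<noteq> i \<longrightarrow> x \<noteq> l \<longrightarrow> lookup b x = lookup a x"
      show "H b = H a"
        unfolding H_def using swap_invariantD[OF f(1) *(1-5)] swap_invariantD[OF g *(1-5)] *(6) by simp
    qed
  qed
  have ext: "lookup b x = (if x \<in> N - {j} then q else 0)" if "extremal b j" for b j x
  proof (cases "x \<in> N")
    case False
    then have "x \<notin> keys b" using that unfolding extremal_def by blast
    then show ?thesis using False by (simp add: in_keys_iff)
  next
    case True
    then show ?thesis using that unfolding extremal_def by (cases "x = j") simp_all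
  qed
  have H0: "H b = 0" if b: "extremal b j" for b j
  proof -
    have "H b = H a0"
    proof (cases "j = j0")
      case True
      then have "b = a0" using ext[OF b] ext[OF a0] by (intro poly_mapping_eqI) simp
      then show ?thesis by simp
    next
      case False
      show ?thesis
      proof (rule swap_invariantD[OF H(1), of j j0])
        show "j \<in> N" using b by (simp add: extremal_def)
      qed (use False j0 b in \<open>simp_all add: ext[OF b] ext[OF a0] extremal_def\<close>)
    qed
    then show ?thesis using g0 by (simp add: H_def \<kappa>_def)
  qed
  have Hzero: "(\<Sum>i\<in>N. lax ?c H i a) = 0" if a: "keys a \<subseteq> N" "deg a = p * q" for a
    using zero[OF a] lax_one_row_complement[OF N _ a] by (simp add: H_eq lax_diff_scale sum_subtractf)
  \<comment> \<open>The induction runs downwards along the sum of squares, which grows when exponents are spread.\<close>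
  define sq where "sq a = (\<Sum>x\<in>N. (lookup a x)\<^sup>2)" for a :: expo
  have sq_bound: "sq a \<le> Suc p * (p * q)\<^sup>2" if a: "keys a \<subseteq> N" "deg a = p * q" for a
  proof -
    have "lookup a x \<le> p * q" if "x \<in> N" for x
      using deg_superset[OF N(1) a(1)] a(2) member_le_sum[OF that, of "lookup a"] N by simp
    then have "sq a \<le> (\<Sum>x\<in>N. (p * q)\<^sup>2)" unfolding sq_def by (intro sum_mono power_mono) auto
    then show ?thesis using N by simp
  qed
  have sq_shift: "sq a < sq (shift a i l s)"
    if "i \<in> N" "l \<in> N" "i \<noteq> l" "lookup a l - lookup a i < s" "s \<le> lookup a l" for a i l s
  proof -
    have "lookup a l ^ 2 + lookup a i ^ 2 < (lookup a i + s)\<^sup>2 + (lookup a l - s)\<^sup>2"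
    proof -
      from that(5) obtain r where r: "lookup a l = r + s" by (metis le_add_diff_inverse2)
      then have "r < lookup a i" "s > 0" using that(4) by auto
      then obtain d where d: "lookup a i = r + d" "d > 0" by (metis less_imp_add_positive)
      show ?thesis
        unfolding r d(1) using d(2) \<open>s > 0\<close> by (simp add: power2_eq_square algebra_simps)
    qed
    moreover have "(\<Sum>x\<in>N - {i, l}. (lookup (shift a i l s) x)\<^sup>2) = (\<Sum>x\<in>N - {i, l}. (lookup a x)\<^sup>2)"
      by (rule sum.cong) (auto simp: lookup_shift that)
    ultimately show ?thesis
      unfolding sq_def sum_replace_two[OF N(1) that(1-3)] using that by (simp add: lookup_shift)
  qed
  have "H a = 0" if "keys a \<subseteq> N" "deg a = p * q" for a
    using that
  proof (induction "Suc p * (p * q)\<^sup>2 - sq a" arbitrary: a rule: less_induct)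
    case less
    show ?case
    proof (rule ccontr)
      assume Ha: "H a \<noteq> 0"
      have le: "lookup a x \<le> q" for x using Ha H(2) by (meson exponents_le_def not_le)
      have ex: "exchange H i l a = of_nat (lookup a l - lookup a i) * H a"
          if il: "i \<in> N" "l \<in> N - {i}" for i l
      proof -
        have "H (shift a i l s) = 0" if s: "s \<in> {lookup a l - lookup a i<..lookup a l}" for s
        proof (rule less(1))
          show kd: "keys (shift a i l s) \<subseteq> N" "deg (shift a i l s) = p * q"
            using keys_shift_subset[of a i l s] less.prems s \<open>i \<in> N\<close> \<open>l \<in> N - {i}\<close> by (auto simp: deg_shift)
          have "sq a < sq (shift a i l s)" using il s by (intro sq_shift) auto
          then show "Suc p * (p * q)\<^sup>2 - sq (shift a i l s) < Suc p * (p * q)\<^sup>2 - sq a"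
            using sq_bound[OF kd] by linarith
        qed
        then show ?thesis using il by (subst exchange_split[OF H(1)]) auto
      qed
      have "lax ?c H i a = \<alpha> * (((\<alpha> * of_nat (lookup a i) - ?c) * of_nat (lookup a i)
        + of_nat (\<Sum>l\<in>N - {i}. lookup a l - lookup a i) - of_nat (p * q)) * H a)" if "i \<in> N" for i
        using that less.prems by (simp add: lax_exchange exchange_superset[OF N(1)] ex flip:
            sum_distrib_right)
          (simp add: algebra_simps)
      then have "\<alpha> * ((\<Sum>i\<in>N. (\<alpha> * of_nat (lookup a i) - ?c) * of_nat (lookup a i)
        + of_nat (\<Sum>l\<in>N - {i}. lookup a l - lookup a i) - of_nat (p * q)) * H a) = 0"
        using Hzero[OF less.prems] by (simp add: sum_distrib_left sum_distrib_right)
      then have E0: "(\<Sum>i\<in>N. (\<alpha> * of_nat (lookup a i) - ?c) * of_nat (lookup a i)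
        + of_nat (\<Sum>l\<in>N - {i}. lookup a l - lookup a i) - of_nat (p * q)) = (0 :: 'k)"
        using Ha alpha_pos by auto
      have sa: "(\<Sum>x\<in>N. lookup a x) = p * q" using deg_superset[OF N(1)] less.prems by metis
      have 0: "lookup a x = 0 \<or> lookup a x = q" if "x \<in> N" for x
        by (rule eigenvalue_bound[OF N le sa E0 that])
      define Z where "Z = {x\<in>N. lookup a x = 0}"
      have "(\<Sum>x\<in>N. lookup a x) = (\<Sum>x\<in>N - Z. q)"
        using N by (intro sum.mono_neutral_cong_right) (auto simp: Z_def dest: 0)
      then have "card (N - Z) = p" using sa q by simp
      then have "card Z = 1"
        using N card_Diff_subset[of Z N] card_mono[of N Z] by (auto simp: Z_def)
      then obtain j where "Z = {j}" by (auto simp: card_1_singleton_iff)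
      then have Z: "x \<in> N \<and> lookup a x = 0 \<longleftrightarrow> x = j" for x
        unfolding Z_def set_eq_iff by simp
      have "lookup a x = q" if "x \<in> N - {j}" for x
        using 0[of x] Z[of x] that by simp
      then have "extremal a j" using Z[of j] less.prems(1) by (simp add: extremal_def)
      then show False using H0 Ha by auto
    qed
  qed
  then have "lax ?c H i a = lax ?c (\<lambda>_. 0) i a"
    by (intro lax_cong[OF _ a]) auto
  also have "\<dots> = 0" by (simp add: lax_def)
  finally have "lax ?c f i a - \<kappa> * lax ?c ?g i a = 0"
    by (simp add: H_eq lax_diff_scale)
  then show ?thesis using lax_one_row_complement[OF N a(3) a(1,2)] by simp
qed

section \<open>Virasoro constraints for rectangles\<close>

text \<open>
  The hypotheses are two properties of the rectangular Jack function: no exponent exceeds $q$, and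
  the function is orthogonal to everything that vanishes in $p$ variables. A function with the
  second property is determined by its restriction to $p$ variables, by definiteness. This is
  applied to the Hamiltonian and then to each $L_kF$.
\<close>

theorem virasoro_rectangle:
  assumes pq: "p > 0" "q > 0" "n = p * q"
    and F: "exponents_le q (mps_coeff (p_expand n F))"
    and orth: "\<And>g. vanishes_on p (p_expand n g) \<Longrightarrow> scalar n F g = 0"
    and k: "1 \<le> k" "k \<le> n"
    and \<sigma>: "\<sigma> \<in> parts_of (n - k)"
  shows "virasoro n (\<alpha> * of_nat q - of_nat p) k F \<sigma> = 0"
proof -
  define c :: 'k where "c = \<alpha> * of_nat q - of_nat p"
  let ?f = "mps_coeff (p_expand n F)"
  have sym: "swap_invariant N ?f" for N by (rule swap_invariant_p_expand)
  \<comment> \<open>The Hamiltonian annihilates \<open>F\<close>: \<open>h\<close> vanishes in \<open>p\<close> variables,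
      and it is orthogonal to all such functions.\<close>
  define h where "h = hamiltonian n c F"
  have "vanishes_on p (p_expand n h)"
    unfolding vanishes_on_def
  proof (intro allI impI)
    fix a :: expo assume a: "card (keys a) \<le> p"
    show "mps_coeff (p_expand n h) a = 0"
    proof (rule ccontr)
      assume nz: "mps_coeff (p_expand n h) a \<noteq> 0"
      then have da: "deg a = n" by (rule p_expand_homogeneous)
      have le: "lookup a x \<le> q" for x
      proof (rule ccontr)
        assume "\<not> lookup a x \<le> q"
        then have "lax c ?f i a = 0" for i using lax_zero[OF sym[of UNIV] _ _ F, of i a x c] by auto
        then show False using nz by (simp add: h_def hamiltonian_coeff)
      qed
      have "(\<Sum>x\<in>keys a. q - lookup a x) + deg a = card (keys a) * q"
        unfolding deg_def sum.distrib[symmetric] by (simp add: le)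
      moreover have "card (keys a) * q \<le> p * q" using a by simp
      ultimately have c: "card (keys a) * q = p * q" and "(\<Sum>x\<in>keys a. q - lookup a x) = 0"
        using da pq(3) by linarith+
      then have "lookup a x = q" if "x \<in> keys a" for x using le[of x] that by auto
      moreover have "card (keys a) = p" using c pq by simp
      ultimately have "lax c ?f i a = 0" if "i \<in> keys a" for i
        unfolding c_def using that by (intro lax_rectangle[OF F]) auto
      then show False using nz by (simp add: h_def hamiltonian_coeff)
    qed
  qed
  then have "scalar n F (hamiltonian n c h) = 0"
    by (intro orth vanishes_on_hamiltonian)
  then have "scalar n h h = 0"
    using scalar_hamiltonian[of n c F h] by (simp add: h_def)
  then have "h \<rho> = 0" if "\<rho> \<in> parts_of n" for \<rho>
    using scalar_definite that by blast
  then have "p_expand n h = 0" by (simp add: p_expand_def)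
  then have hz: "(\<Sum>i\<in>keys a. lax c ?f i a) = 0" for a
    using hamiltonian_coeff[of n c F a] by (simp add: h_def)
  \<comment> \<open>In \<open>p + 1\<close> variables the Hamiltonian equation determines \<open>F\<close> up to a factor.\<close>
  have lax0: "lax c ?f i a = 0"
    if N: "finite N" "card N = Suc p" and a: "keys a \<subseteq> N" "deg a = p * q" "i \<in> N" for N a i
    unfolding c_def
  proof (rule lax_sum_kernel[OF N pq(2) sym F _ a])
    fix a assume a: "keys a \<subseteq> N" "deg a = p * q"
    have "(\<Sum>i\<in>N. lax c ?f i a) = (\<Sum>i\<in>keys a. lax c ?f i a)"
      using N a lax_notin_keys[OF sym[of N] _ a(1)] by (intro sum.mono_neutral_right) auto
    then show "(\<Sum>i\<in>N. lax (\<alpha> * of_nat q - of_nat p) ?f i a) = 0"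
      using hz by (simp add: c_def)
  qed
  \<comment> \<open>If the previous constraints hold, the lowest power of the distinguished variable carries the next one.\<close>
  have "\<forall>\<sigma>\<in>parts_of (n - k). virasoro n c k F \<sigma> = 0" using k
  proof (induction k rule: less_induct)
    case (less k)
    let ?v = "\<lambda>k. p_expand (n - k) (virasoro n c k F)"
    have "vanishes_on p (?v k)"
      unfolding vanishes_on_def
    proof (intro allI impI)
      fix b :: expo assume b: "card (keys b) \<le> p"
      show "mps_coeff (?v k) b = 0"
      proof (rule ccontr)
        assume nz: "mps_coeff (?v k) b \<noteq> 0"
        then have db: "deg b = n - k" by (rule p_expand_homogeneous)
        obtain i where i: "i \<notin> keys b" using ex_new_if_finite[OF infinite_UNIV_nat finite_keys] by auto
        have "card (insert i (keys b)) \<le> Suc p" using i b by simp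
        obtain M where M: "finite M" "card M = Suc p - card (insert i (keys b))" "M \<subseteq> - insert i (keys b)"
          using infinite_arbitrarily_large[of "- insert i (keys b)"]
          by (metis finite_compl finite_insert finite_keys infinite_UNIV_nat)
        define N where "N = insert i (keys b) \<union> M"
        have "card N = card (insert i (keys b)) + card M"
          unfolding N_def using M by (intro card_Un_disjoint) auto
        then have N: "insert i (keys b) \<subseteq> N" "finite N" "card N = Suc p"
          using M \<open>card (insert i (keys b)) \<le> Suc p\<close> by (auto simp: N_def)
        \<comment> \<open>A fresh variable is given exponent \<open>k\<close>: smaller powers vanish
            by induction, larger ones do not divide the monomial.\<close>
        define a where "a = b + single i k"
        have bi: "lookup b i = 0" using i by (simp add: in_keys_iff)
        have ai: "lookup a i = k" and a_minus: "a - single i k = b"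
          using bi by (auto simp: a_def lookup_add)
        have ak: "keys a \<subseteq> N" using N keys_add[of b "single i k"] by (auto simp: a_def split: if_splits)
        have "deg a = (\<Sum>x\<in>insert i (keys b). lookup a x)"
          using keys_add[of b "single i k"] by (intro deg_superset) (auto simp: a_def split: if_splits)
        also have "\<dots> = k + (\<Sum>x\<in>keys b. lookup b x)"
          using i by (simp add: ai) (rule sum.cong, auto simp: a_def lookup_add lookup_single when_def)
        finally have da: "deg a = p * q" using db less.prems pq by (simp add: deg_def)
        have "mps_coeff (mps_var_power i k' * ?v k') a = 0" if k': "k' \<in> {1..n}" "k' \<noteq> k" for k'
        proof (cases "k' < k")
          case True
          then have "?v k' = 0" using less.IH[of k'] k' by (simp add: p_expand_def)
          then show ?thesis by simp
        next
          case False
          then show ?thesis using k' ai by (simp add: mps_coeff_var_power_mult)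
        qed
        then have "(\<Sum>k'\<in>{1..n}. mps_coeff (mps_var_power i k' * ?v k') a) =
          (\<Sum>k'\<in>{k}. mps_coeff (mps_var_power i k' * ?v k') a)"
          using less.prems by (intro sum.mono_neutral_right) auto
        also have "\<dots> = mps_coeff (?v k) b" by (simp add: mps_coeff_var_power_mult ai a_minus)
        finally have "lax c ?f i a = mps_coeff (?v k) b" unfolding lax_coeff .
        then show False using nz lax0[OF N(2,3) ak da] N(1) by simp
      qed
    qed
    then have "scalar n F (virasoro_adj n c k (virasoro n c k F)) = 0"
      using less.prems by (intro orth vanishes_on_virasoro_adj)
    then have "scalar (n - k) (virasoro n c k F) (virasoro n c k F) = 0"
      using scalar_virasoro[of k n c F "virasoro n c k F"] less.prems by simp
    then show ?case using scalar_definite by blast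
  qed
  then show ?thesis using \<sigma> by (simp add: c_def)
qed

end

section \<open>Monomial and power sum bases\<close>

lemma expo_type_surj:
  assumes "0 \<notin># M"
  shows "\<exists>a. expo_type a = M"
  using assms
proof (induction M)
  case empty
  have "expo_type 0 = {#}" by (simp add: expo_type_eq_empty)
  then show ?case by blast
next
  case (add k M)
  then obtain a where a: "expo_type a = M" by auto
  obtain i where i: "i \<notin> keys a" using ex_new_if_finite[OF infinite_UNIV_nat finite_keys] by auto
  define b where "b = a + single i k"
  have l: "lookup b x = (if x = i then k else lookup a x)" for x
    using i by (auto simp: b_def lookup_add lookup_single when_def in_keys_iff)
  have "keys b = insert i (keys a)"
    unfolding set_eq_iff insert_iff in_keys_iff l using add.prems by auto
  then have "expo_type b = add_mset k (image_mset (lookup b) (mset_set (keys a)))"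
    using i by (simp add: expo_type_def l)
  also have "image_mset (lookup b) (mset_set (keys a)) = image_mset (lookup a) (mset_set (keys a))"
    using i by (intro image_mset_cong) (auto simp: l)
  finally have "expo_type b = add_mset k M" using a by (simp add: expo_type_def)
  then show ?case by blast
qed

definition partition_of :: "nat multiset \<Rightarrow> nat list" where
  "partition_of M = rev (sorted_list_of_multiset M)"

lemma mset_partition_of [simp]: "mset (partition_of M) = M"
  by (simp add: partition_of_def)

lemma partition_of_in_partitions: "0 \<notin># M \<Longrightarrow> partition_of M \<in> partitions"
  using sorted_sort[of "sorted_list_of_multiset M"]
  by (auto simp: partitions_def is_partition_def partition_of_def sorted_wrt_rev)

lemma partition_of_mset: "\<mu> \<in> partitions \<Longrightarrow> partition_of (mset \<mu>) = \<mu>"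
proof -
  assume "\<mu> \<in> partitions"
  then have "sorted (rev \<mu>)" by (simp add: partitions_def is_partition_def sorted_wrt_rev)
  then have "sort \<mu> = rev \<mu>" by (intro properties_for_sort) auto
  then show ?thesis by (simp add: partition_of_def)
qed

lemma zero_notin_mset: "\<mu> \<in> partitions \<Longrightarrow> 0 \<notin># mset \<mu>"
  by (simp add: partitions_def is_partition_def)

lemma bij_betw_partitions: "bij_betw mset {\<mu>\<in>partitions. sum_list \<mu> = n} (parts_of n)"
proof (rule bij_betw_byWitness[where f' = partition_of])
  show "mset ` {\<mu> \<in> partitions. sum_list \<mu> = n} \<subseteq> parts_of n"
    by (auto simp: parts_of_def partitions_def is_partition_def sum_mset_sum_list)
  show "partition_of ` parts_of n \<subseteq> {\<mu> \<in> partitions. sum_list \<mu> = n}"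
    by (auto simp: parts_of_def partition_of_in_partitions simp flip: sum_mset_sum_list)
qed (auto simp: partition_of_mset)

lemma mset_partitions: "mset ` partitions = {M. 0 \<notin># M}"
  using zero_notin_mset partition_of_in_partitions mset_partition_of by (force simp: image_iff)

lemma finite_partitions_of: "finite {\<mu>\<in>partitions. sum_list \<mu> = n}"
  using bij_betw_finite[OF bij_betw_partitions] by simp

lift_definition monomial_mset :: "nat multiset \<Rightarrow> 'a::comm_ring_1 mps"
  is "\<lambda>M a. if image_mset (Poly_Mapping.lookup a) (mset_set (Poly_Mapping.keys a)) = M then 1 else 0" .

lemma mps_coeff_monomial_mset: "mps_coeff (monomial_mset M) a = (if expo_type a = M then 1 else 0)"
  by (simp add: monomial_mset.rep_eq expo_type_def)

lemma monomial_sym_eq: "monomial_sym \<mu> = monomial_mset (mset \<mu>)"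
  by (rule mps_eqI) (simp add: monomial_sym.rep_eq monomial_mset.rep_eq)

lemma power_sum_mset_coeff_nonneg:
  "0 \<notin># \<rho> \<Longrightarrow> mps_coeff (power_sum_mset \<rho> :: 'a::linordered_idom mps) a \<ge> 0"
proof (induction \<rho> arbitrary: a)
  case (add k \<rho>)
  then show ?case
    by (auto simp: mps_coeff_power_sum_mult mps_coeff_var_power_mult intro!: sum_nonneg)
qed (simp add: mps_coeff_1)

lemma power_sum_mset_coeff_pos:
  "0 \<notin># \<rho> \<Longrightarrow> expo_type a = \<rho> \<Longrightarrow> mps_coeff (power_sum_mset \<rho> :: 'a::linordered_idom mps) a > 0"
proof (induction \<rho> arbitrary: a)
  case empty
  then show ?case by (simp add: mps_coeff_1 expo_type_eq_empty)
next
  case (add k \<rho>)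
  have "k \<in># expo_type a" using add.prems by simp
  then obtain l where l: "l \<in> keys a" "lookup a l = k" by (auto simp: expo_type_def)
  then have "expo_type (a - single l k) = \<rho>" using add.prems by (simp add: expo_type_diff_single)
  then have "0 < mps_coeff (mps_var_power l k * power_sum_mset \<rho> :: 'a mps) a"
    using add l by (simp add: mps_coeff_var_power_mult)
  moreover have "0 \<le> mps_coeff (mps_var_power x k * power_sum_mset \<rho> :: 'a mps) a" for x
    using add.prems by (auto simp: mps_coeff_var_power_mult intro!: power_sum_mset_coeff_nonneg)
  ultimately show ?case
    using add.prems l by (auto simp: mps_coeff_power_sum_mult intro!: sum_pos2[of _ l])
qed

text \<open>
  A monomial of $p_\rho$ arises by merging parts of $\rho$, so it has at most as many exponents as
  $\rho$ has parts, with equality only if nothing is merged. Thus the power sums are triangular in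
  the monomial symmetric functions with respect to the number of parts.
\<close>

lemma power_sum_mset_coeff_nonzero:
  assumes "0 \<notin># \<rho>" "mps_coeff (power_sum_mset \<rho> :: 'a::comm_ring_1 mps) a \<noteq> 0"
  shows "card (keys a) \<le> size \<rho> \<and> (card (keys a) = size \<rho> \<longrightarrow> expo_type a = \<rho>)"
  using assms
proof (induction \<rho> arbitrary: a)
  case empty
  then show ?case by (auto simp: mps_coeff_1 expo_type_eq_empty split: if_splits)
next
  case (add k \<rho>)
  then have "(\<Sum>l\<in>keys a. mps_coeff (mps_var_power l k * power_sum_mset \<rho> :: 'a mps) a) \<noteq> 0"
    by (simp add: mps_coeff_power_sum_mult)
  then obtain l where l: "l \<in> keys a" and "mps_coeff (mps_var_power l k * power_sum_mset \<rho> :: 'a mps) a \<noteq> 0"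
    by (rule sum.not_neutral_contains_not_neutral)
  then have k: "k \<le> lookup a l" and nz: "mps_coeff (power_sum_mset \<rho> :: 'a mps) (a - single l k) \<noteq> 0"
    by (auto simp: mps_coeff_var_power_mult split: if_splits)
  have la: "lookup a l \<in># expo_type a" using l by (auto simp: expo_type_def)
  have s: "card (keys a) = Suc (size (expo_type a - {#lookup a l#}))"
    using la by (metis size_Suc_Diff1 size_expo_type)
  have IH: "card (keys (a - single l k)) \<le> size \<rho>
      \<and> (card (keys (a - single l k)) = size \<rho> \<longrightarrow> expo_type (a - single l k) = \<rho>)"
    using add nz by auto
  show ?case
  proof (cases "lookup a l = k")
    case True
    then have "expo_type (a - single l k) = expo_type a - {#k#}" using l k
        by (simp add: expo_type_diff_single)
    moreover from this have "card (keys (a - single l k)) = size (expo_type a - {#lookup a l#})"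
      using True by (metis size_expo_type)
    moreover have "expo_type a = add_mset k (expo_type a - {#k#})" using la True by simp
    ultimately show ?thesis using IH s True by auto
  next
    case False
    then have "size (expo_type (a - single l k)) = card (keys a)" using l k s
        by (simp add: expo_type_diff_single)
    then show ?thesis using IH by simp
  qed
qed

lemma power_sum_mset_independent:
  assumes "finite R" "\<And>\<rho>. \<rho> \<in> R \<Longrightarrow> 0 \<notin># \<rho>"
    and zero: "(\<Sum>\<rho>\<in>R. mps_scale (f \<rho>) (power_sum_mset \<rho>)) = (0 :: 'a::linordered_idom mps)" and "\<rho> \<in> R"
  shows "f \<rho> = 0"
proof (rule ccontr)
  assume "f \<rho> \<noteq> 0"
  define S where "S = {\<rho>\<in>R. f \<rho> \<noteq> 0}"
  have S: "finite S" "S \<noteq> {}" using assms \<open>f \<rho> \<noteq> 0\<close> by (auto simp: S_def)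
  then have "Max (size ` S) \<in> size ` S" by (intro Max_in) auto
  then obtain \<tau> where \<tau>: "\<tau> \<in> S" "size \<tau> = Max (size ` S)" by auto
  then have max: "size \<sigma> \<le> size \<tau>" if "\<sigma> \<in> S" for \<sigma> using S(1) that by simp
  have \<tau>0: "0 \<notin># \<tau>" using assms(2) \<tau>(1) by (simp add: S_def)
  then obtain a where a: "expo_type a = \<tau>" using expo_type_surj[of \<tau>] by auto
  have ca: "card (keys a) = size \<tau>" using a size_expo_type by metis
  have rest: "f \<sigma> * mps_coeff (power_sum_mset \<sigma>) a = 0" if "\<sigma> \<in> R - {\<tau>}" for \<sigma>
  proof (rule ccontr)
    assume *: "\<not> ?thesis"
    then have "\<sigma> \<in> S" using that by (auto simp: S_def)
    moreover have "mps_coeff (power_sum_mset \<sigma> :: 'a mps) a \<noteq> 0" using * by auto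
    ultimately show False
      using power_sum_mset_coeff_nonzero[of \<sigma> a, where 'a = 'a] assms(2)[of \<sigma>] that max[of \<sigma>] a ca by auto
  qed
  have "(\<Sum>\<sigma>\<in>R - {\<tau>}. f \<sigma> * mps_coeff (power_sum_mset \<sigma>) a) = 0"
    by (intro sum.neutral ballI rest)
  then have "(\<Sum>\<sigma>\<in>R. f \<sigma> * mps_coeff (power_sum_mset \<sigma>) a) = f \<tau> * mps_coeff (power_sum_mset \<tau>) a"
    using assms(1) \<tau>(1) sum.remove[of R \<tau> "\<lambda>\<sigma>. f \<sigma> * mps_coeff (power_sum_mset \<sigma>) a"]
    by (simp add: S_def)
  moreover have "(\<Sum>\<sigma>\<in>R. f \<sigma> * mps_coeff (power_sum_mset \<sigma>) a) = 0"
    using arg_cong[OF zero, of "\<lambda>f. mps_coeff f a"] by simp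
  ultimately show False
    using power_sum_mset_coeff_pos[OF \<tau>0 a, where 'a = 'a] \<tau>(1) by (simp add: S_def)
qed

lemma inj_power_sum_mset: "inj_on (power_sum_mset :: _ \<Rightarrow> 'a::linordered_idom mps) {M. 0 \<notin># M}"
proof (rule inj_onI)
  fix \<rho> \<sigma> :: "nat multiset"
  assume *: "\<rho> \<in> {M. 0 \<notin># M}" "\<sigma> \<in> {M. 0 \<notin># M}" and eq: "power_sum_mset \<rho> = (power_sum_mset \<sigma> :: 'a mps)"
  have le: "size \<rho> \<le> size \<sigma> \<and> (size \<rho> = size \<sigma> \<longrightarrow> \<rho> = \<sigma>)"
    if "0 \<notin># \<rho>" "0 \<notin># \<sigma>" "power_sum_mset \<rho> = (power_sum_mset \<sigma> :: 'a mps)" for \<rho> \<sigma>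
  proof -
    from expo_type_surj[OF that(1)] obtain a where a: "expo_type a = \<rho>" ..
    then show ?thesis
      using power_sum_mset_coeff_nonzero[of \<sigma> a, where 'a = 'a] power_sum_mset_coeff_pos[of \<rho> a,
          where 'a = 'a] that
      by (auto simp flip: size_expo_type)
  qed
  show "\<rho> = \<sigma>" using le[of \<rho> \<sigma>] le[of \<sigma> \<rho>] * eq by auto
qed

lemma power_sum_part_partitions: "power_sum_part ` partitions = power_sum_mset ` {M. 0 \<notin># M}"
  unfolding mset_partitions[symmetric] image_image power_sum_part_eq ..

lemma independent_power_sums:
  "mps.independent (power_sum_part ` partitions :: 'a::linordered_field mps set)"
  unfolding mps.independent_explicit_module power_sum_part_partitions
proof (intro allI impI)
  fix t and u :: "'a mps \<Rightarrow> 'a" and v :: "'a mps"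
  assume t: "finite t" "t \<subseteq> power_sum_mset ` {M. 0 \<notin># M}" and z: "(\<Sum>v\<in>t. mps_scale (u v) v) = 0"
      and v: "v \<in> t"
  from t(2) obtain R where R: "R \<subseteq> {M. 0 \<notin># M}" "t = power_sum_mset ` R"
    by (rule subset_imageE)
  have R3: "inj_on (power_sum_mset :: _ \<Rightarrow> 'a mps) R" by (rule inj_on_subset[OF inj_power_sum_mset R(1)])
  then have fin: "finite R" using t(1) finite_imageD unfolding R(2) by blast
  obtain \<rho> where "\<rho> \<in> R" "v = power_sum_mset \<rho>" using v R by auto
  moreover have "(\<Sum>\<rho>\<in>R. mps_scale (u (power_sum_mset \<rho>)) (power_sum_mset \<rho>)) = 0"
    using z unfolding R(2) by (simp add: sum.reindex[OF R3])
  ultimately show "u v = 0"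
    using power_sum_mset_independent[OF fin, of "\<lambda>\<rho>. u (power_sum_mset \<rho>)" \<rho>] R(1) by auto
qed

lemma power_sum_coeff_p_expand:
  fixes f :: "nat multiset \<Rightarrow> 'a::linordered_field"
  assumes "xs \<in> partitions"
  shows "power_sum_coeff (p_expand n f) xs = (if sum_list xs = n then f (mset xs) else 0)"
proof -
  let ?B = "power_sum_part ` partitions :: 'a mps set"
  have B: "power_sum_mset \<rho> \<in> ?B" if "\<rho> \<in> parts_of n" for \<rho>
    using that by (auto simp: power_sum_part_partitions parts_of_def)
  have "mps.representation ?B (p_expand n f)
      = (\<lambda>b. \<Sum>\<rho>\<in>parts_of n. mps.representation ?B (mps_scale (f \<rho>) (power_sum_mset \<rho>)) b)"
    unfolding p_expand_def using B
    by (intro mps.representation_sum independent_power_sums mps.span_scale mps.span_base)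
  then have "power_sum_coeff (p_expand n f) xs
      = (\<Sum>\<rho>\<in>parts_of n. f \<rho> * (if power_sum_mset (mset xs) = (power_sum_mset \<rho> :: 'a mps) then 1 else 0))"
    unfolding power_sum_coeff_def power_sum_part_eq[of xs]
    using B by (simp add: mps.representation_scale[OF independent_power_sums] mps.span_base
        mps.representation_basis[OF independent_power_sums])
  also have "\<dots> = (\<Sum>\<rho>\<in>parts_of n. if mset xs = \<rho> then f \<rho> else 0)"
  proof (rule sum.cong[OF refl])
    fix \<rho> assume "\<rho> \<in> parts_of n"
    then have "power_sum_mset (mset xs) = (power_sum_mset \<rho> :: 'a mps) \<longleftrightarrow> mset xs = \<rho>"
      using inj_onD[OF inj_power_sum_mset[where 'a = 'a], of "mset xs" \<rho>] zero_notin_mset[OF assms]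
          by (auto simp: parts_of_def)
    then show "f \<rho> * (if power_sum_mset (mset xs) = (power_sum_mset \<rho> :: 'a mps) then 1 else 0)
        = (if mset xs = \<rho> then f \<rho> else 0)"
      by simp
  qed
  also have "\<dots> = (if sum_list xs = n then f (mset xs) else 0)"
  proof -
    have "mset xs \<in> parts_of n \<longleftrightarrow> sum_list xs = n"
      using zero_notin_mset[OF assms] by (simp add: parts_of_def sum_mset_sum_list)
    then show ?thesis by simp
  qed
  finally show ?thesis .
qed

lemma p_expand_monomial_expansion:
  "p_expand n f = (\<Sum>M\<in>parts_of n. mps_scale (mps_coeff (p_expand n f) (SOME a. expo_type a = M))
      (monomial_mset M))"
proof (rule mps_eqI)
  fix a
  have *: "mps_coeff (p_expand n f) (SOME b. expo_type b = expo_type a) = mps_coeff (p_expand n f) a"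
    by (rule p_expand_coeff_cong_expo_type) (rule someI, rule refl)
  have "(\<Sum>M\<in>parts_of n. mps_coeff (p_expand n f) (SOME b. expo_type b = M) * (if expo_type a
      = M then 1 else 0))
    = (if expo_type a \<in> parts_of n then mps_coeff (p_expand n f) a else 0)"
    by (simp add: * if_distrib[of "\<lambda>x. _ * x"] cong: if_cong)
  also have "\<dots> = mps_coeff (p_expand n f) a"
    using p_expand_homogeneous[of n f a] expo_type_parts_of[of a] by auto
  finally show "mps_coeff (p_expand n f) a
      = mps_coeff (\<Sum>M\<in>parts_of n. mps_scale (mps_coeff (p_expand n f) (SOME a. expo_type a = M))
      (monomial_mset M)) a"
    by (simp add: mps_coeff_monomial_mset)
qed

lemma subspace_range_p_expand: "mps.subspace (range (p_expand n :: _ \<Rightarrow> 'a::field mps))"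
proof (rule mps.subspaceI)
  have "p_expand n (\<lambda>_. 0) = 0" by (rule mps_eqI) (simp add: p_expand_def)
  then show "0 \<in> range (p_expand n)" by (metis rangeI)
qed (auto simp flip: p_expand_add p_expand_scale mps_const_mult)

lemma p_expand_delta:
  assumes "M \<in> parts_of n"
  shows "p_expand n (\<lambda>\<rho>. if \<rho> = M then 1 else 0) = (power_sum_mset M :: 'a::field mps)"
proof -
  have "p_expand n (\<lambda>\<rho>. if \<rho> = M then 1 else 0)
      = (\<Sum>\<rho>\<in>parts_of n. if \<rho> = M then (power_sum_mset \<rho> :: 'a mps) else 0)"
    unfolding p_expand_def by (rule sum.cong) auto
  then show ?thesis using assms by simp
qed

lemma monomial_in_range_p_expand:
  "M \<in> parts_of n \<Longrightarrow> (monomial_mset M :: 'a::linordered_field mps) \<in> range (p_expand n)"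
proof (induction "size M" arbitrary: M rule: less_induct)
  case less
  let ?P = "power_sum_mset M :: 'a mps"
  define c where "c N = mps_coeff ?P (SOME a. expo_type a = N)" for N
  have M0: "0 \<notin># M" using less.prems by (simp add: parts_of_def)
  have some: "expo_type (SOME a. expo_type a = N) = N" if "N \<in> parts_of n" for N
    using that expo_type_surj[of N] by (auto simp: parts_of_def intro: someI_ex)
  have cM: "c M > 0" unfolding c_def by (rule power_sum_mset_coeff_pos[OF M0 some[OF less.prems]])
  have "?P = (\<Sum>N\<in>parts_of n. mps_scale (c N) (monomial_mset N))"
    using p_expand_monomial_expansion[of n "\<lambda>\<rho>. if \<rho> = M then (1 :: 'a) else 0"]
    unfolding p_expand_delta[OF less.prems] c_def .
  also have "\<dots> = mps_scale (c M) (monomial_mset M)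
      + (\<Sum>N\<in>parts_of n - {M}. mps_scale (c N) (monomial_mset N))"
    using less.prems by (simp add: sum.remove)
  finally have "mps_scale (c M) (monomial_mset M)
      = ?P - (\<Sum>N\<in>parts_of n - {M}. mps_scale (c N) (monomial_mset N))"
    by simp
  moreover have "(\<Sum>N\<in>parts_of n - {M}. mps_scale (c N) (monomial_mset N)) \<in> range (p_expand n)"
  proof (rule mps.subspace_sum[OF subspace_range_p_expand])
    fix N assume N: "N \<in> parts_of n - {M}"
    show "mps_scale (c N) (monomial_mset N) \<in> range (p_expand n)"
    proof (cases "c N = 0")
      case True
      then show ?thesis using mps.subspace_0[OF subspace_range_p_expand] by simp
    next
      case False
      then have "size N < size M"
        using power_sum_mset_coeff_nonzero[OF M0, of "SOME a. expo_type a = N", where 'a = 'a] some[of N] N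
        unfolding c_def size_expo_type[symmetric] by (simp del: size_expo_type add: less_le)
      then show ?thesis using less.hyps[of N] N
          by (intro mps.subspace_scale[OF subspace_range_p_expand]) auto
    qed
  qed
  moreover have "?P \<in> range (p_expand n)" using p_expand_delta[OF less.prems] by (metis rangeI)
  ultimately have "mps_scale (c M) (monomial_mset M) \<in> range (p_expand n)"
    by (simp add: mps.subspace_diff[OF subspace_range_p_expand])
  then have "mps_scale (inverse (c M)) (mps_scale (c M) (monomial_mset M)) \<in> range (p_expand n)"
    by (rule mps.subspace_scale[OF subspace_range_p_expand])
  then show ?case using cM by simp
qed

section \<open>Rectangular Jack functions\<close>

lemma alpha_positive: "alpha > 0"
  by (simp add: alpha_def zero_less_Fract_iff less_poly_def pos_poly_def)

global_interpretation jack: jack_parameter alpha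
  by unfold_locales (rule alpha_positive)

text \<open>
  The first $l(\mu)$ parts of $\nu$ already have the full sum. In consequence the partitions with
  more than \<open>p\<close> parts are closed under passing to dominated ones.
\<close>

lemma dominated_length:
  assumes "\<nu> \<in> partitions" "dominated \<mu> \<nu>"
  shows "length \<nu> \<le> length \<mu>"
proof (rule ccontr)
  assume "\<not> ?thesis"
  then have "drop (length \<mu>) \<nu> \<noteq> []" by simp
  then obtain x where x: "x \<in> set (drop (length \<mu>) \<nu>)" by fastforce
  have "sum_list \<mu> \<le> sum_list (take (length \<mu>) \<nu>)" "sum_list \<mu> = sum_list \<nu>"
    using assms(2) unfolding dominated_def by (metis take_all order_refl)+
  moreover have "sum_list \<nu> = sum_list (take (length \<mu>) \<nu>) + sum_list (drop (length \<mu>) \<nu>)"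
    by (metis append_take_drop_id sum_list_append)
  ultimately have "sum_list (drop (length \<mu>) \<nu>) = 0" by simp
  then have "x = 0" using x by (simp add: sum_list_eq_0_iff)
  then show False using x in_set_dropD[of x] assms(1) by (auto simp: partitions_def is_partition_def)
qed

lemma span_monomial_sym:
  assumes "f \<in> mps.span (monomial_sym ` {\<mu>\<in>partitions. dominated \<mu> \<nu>})"
  shows "f \<in> range (p_expand (sum_list \<nu>) :: _ \<Rightarrow> 'a::linordered_field mps)"
    and "mps_coeff f a \<noteq> 0 \<Longrightarrow> \<exists>\<mu>\<in>partitions. dominated \<mu> \<nu> \<and> expo_type a = mset \<mu>"
proof -
  have "monomial_sym ` {\<mu>\<in>partitions. dominated \<mu> \<nu>} \<subseteq> range (p_expand (sum_list \<nu>) :: _ \<Rightarrow> 'a mps)"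
  proof safe
    fix \<mu> assume "\<mu> \<in> partitions" "dominated \<mu> \<nu>"
    then have "mset \<mu> \<in> parts_of (sum_list \<nu>)"
      by (simp add: parts_of_def dominated_def sum_mset_sum_list partitions_def is_partition_def)
    then show "monomial_sym \<mu> \<in> range (p_expand (sum_list \<nu>) :: _ \<Rightarrow> 'a mps)"
      unfolding monomial_sym_eq by (rule monomial_in_range_p_expand)
  qed
  then show "f \<in> range (p_expand (sum_list \<nu>))"
    using mps.span_minimal[OF _ subspace_range_p_expand] assms by blast
  show "\<exists>\<mu>\<in>partitions. dominated \<mu> \<nu> \<and> expo_type a = mset \<mu>" if "mps_coeff f a \<noteq> 0"
  proof (rule ccontr)
    assume no: "\<not> ?thesis"
    have "mps_coeff f a = 0"
      using assms
    proof (induction rule: mps.span_induct_alt)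
      case (step c x y)
      then have "mps_coeff x a = 0" using no by (auto simp: monomial_sym_eq mps_coeff_monomial_mset)
      then show ?case using step by simp
    qed simp
    then show False using that by simp
  qed
qed

lemma jack_scalar_p_expand: "jack_scalar (p_expand n f) (p_expand n g) = jack.scalar n f g"
proof -
  let ?S = "{\<rho>\<in>partitions. sum_list \<rho> = n}"
  let ?t = "\<lambda>\<rho>. f (mset \<rho>) * g (mset \<rho>) * jack.weight (mset \<rho>)"
  have "jack_scalar (p_expand n f) (p_expand n g) = (\<Sum>\<rho>\<in>?S. ?t \<rho>)"
    unfolding jack_scalar_def
  proof (rule sum.mono_neutral_cong_left)
    show "\<forall>i\<in>?S - {\<rho> \<in> partitions. power_sum_coeff (p_expand n f) \<rho> \<noteq> 0
        \<and> power_sum_coeff (p_expand n g) \<rho> \<noteq> 0}. ?t i = 0"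
      by (auto simp: power_sum_coeff_p_expand)
  qed (auto simp: finite_partitions_of power_sum_coeff_p_expand jack.weight_def zee_eq_zee_mset split:
      if_splits)
  also have "\<dots> = jack.scalar n f g"
    unfolding jack.scalar_def by (rule sum.reindex_bij_betw[OF bij_betw_partitions])
  finally show ?thesis .
qed

context
  fixes J assumes J: "jack_family J"
begin

lemma jack_in_range: "\<nu> \<in> partitions \<Longrightarrow> J \<nu> \<in> range (p_expand (sum_list \<nu>))"
  using J span_monomial_sym(1) unfolding jack_family_def by blast

lemma jack_coeff_support:
  "\<nu> \<in> partitions \<Longrightarrow> mps_coeff (J \<nu>) a \<noteq> 0 \<Longrightarrow> \<exists>\<mu>\<in>partitions. dominated \<mu> \<nu> \<and> expo_type a = mset \<mu>"
  using J span_monomial_sym(2) unfolding jack_family_def by blast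

text \<open>
  The normalization fixes the coordinate at $m_{1^n}$, which is the coefficient of a product of
  $n$ distinct variables. It is nonzero, so the coordinates in the monomial basis are not the
  default value that they have outside the span of an independent set.
\<close>

lemma jack_coeff_squarefree:
  assumes \<nu>: "\<nu> \<in> partitions" and a: "expo_type a = replicate_mset (sum_list \<nu>) 1"
  shows "mps_coeff (J \<nu>) a = fact (sum_list \<nu>)"
proof -
  define n where "n = sum_list \<nu>"
  let ?B = "monomial_sym ` partitions :: ratfun mps set"
  let ?r = "mps.representation ?B (J \<nu>)"
  have r: "?r (monomial_sym (replicate n 1)) = fact n"
    using J \<nu> unfolding jack_family_def monomial_coeff_def n_def by blast
  then have "?r \<noteq> (\<lambda>b. 0)" by (metis fact_nonzero)
  then have B: "mps.independent ?B" "J \<nu> \<in> mps.span ?B"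
    by (auto simp: mps.representation_def split: if_splits)
  have "mps_coeff (J \<nu>) a = mps_coeff (\<Sum>b | ?r b \<noteq> 0. mps_scale (?r b) b) a"
    unfolding mps.sum_nonzero_representation_eq[OF B] ..
  also have "\<dots> = (\<Sum>b | ?r b \<noteq> 0. ?r b * mps_coeff b a)" by simp
  also have "\<dots> = (\<Sum>b\<in>{monomial_sym (replicate n 1)}. ?r b * mps_coeff b a)"
  proof (rule sum.mono_neutral_right)
    show "finite {b. ?r b \<noteq> 0}" by (rule mps.finite_representation)
    show "{monomial_sym (replicate n 1)} \<subseteq> {b. ?r b \<noteq> 0}" using r by simp
    show "\<forall>b\<in>{b. ?r b \<noteq> 0} - {monomial_sym (replicate n 1)}. ?r b * mps_coeff b a = 0"
    proof
      fix b assume b: "b \<in> {b. ?r b \<noteq> 0} - {monomial_sym (replicate n 1)}"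
      then obtain \<mu> where \<mu>: "\<mu> \<in> partitions" "b = monomial_sym \<mu>"
        using mps.representation_ne_zero by blast
      then have "mset \<mu> \<noteq> mset (replicate n 1)" using b by (auto simp: monomial_sym_eq)
      then show "?r b * mps_coeff b a = 0"
        using \<mu>(2) a by (simp add: monomial_sym_eq mps_coeff_monomial_mset n_def)
    qed
  qed
  also have "\<dots> = fact n" using a r by (simp add: monomial_sym_eq mps_coeff_monomial_mset n_def)
  finally show ?thesis by (simp add: n_def)
qed

lemma jack_nonzero: "\<nu> \<in> partitions \<Longrightarrow> J \<nu> \<noteq> 0"
proof
  assume \<nu>: "\<nu> \<in> partitions" and "J \<nu> = 0"
  have "(0 :: nat) \<notin># replicate_mset (sum_list \<nu>) 1" by (simp only: in_replicate_mset) simp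
  from expo_type_surj[OF this] obtain a where "expo_type a = replicate_mset (sum_list \<nu>) 1" ..
  from jack_coeff_squarefree[OF \<nu> this] \<open>J \<nu> = 0\<close> show False by simp
qed

text \<open>
  By triangularity the Jack functions with more than $p$ parts lie in the span of the monomial
  functions with more than $p$ parts. They are orthogonal and nonzero, hence independent, so by
  counting they span the same space. A Jack function with $p$ parts is orthogonal to all of them.
\<close>

lemma jack_orthogonal_long_monomials:
  assumes \<kappa>: "\<kappa> \<in> partitions" "sum_list \<kappa> = n" "length \<kappa> = p" and F: "J \<kappa> = p_expand n F"
    and g: "vanishes_on p (p_expand n g)"
  shows "jack.scalar n F g = 0"
proof -
  define U where "U = {\<nu>\<in>partitions. sum_list \<nu> = n \<and> length \<nu> > p}"
  have finU: "finite U" by (rule finite_subset[OF _ finite_partitions_of[of n]]) (auto simp: U_def)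
  have "\<forall>\<nu>\<in>{\<nu>\<in>partitions. sum_list \<nu> = n}. \<exists>f. J \<nu> = p_expand n f"
    using jack_in_range by force
  then obtain f where f: "\<And>\<nu>. \<nu> \<in> partitions \<Longrightarrow> sum_list \<nu> = n \<Longrightarrow> J \<nu> = p_expand n (f \<nu>)"
    by (auto simp: bchoice_iff)
  have orth: "jack.scalar n (f \<nu>) (f \<mu>) = 0"
    if "\<nu> \<in> partitions" "sum_list \<nu> = n" "\<mu> \<in> partitions" "sum_list \<mu> = n" "\<nu> \<noteq> \<mu>" for \<nu> \<mu>
    using J that f[of \<nu>] f[of \<mu>] unfolding jack_family_def by (metis jack_scalar_p_expand)
  have norm: "jack.scalar n (f \<nu>) (f \<nu>) \<noteq> 0" if "\<nu> \<in> partitions" "sum_list \<nu> = n" for \<nu>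
  proof
    assume "jack.scalar n (f \<nu>) (f \<nu>) = 0"
    then have "f \<nu> \<rho> = 0" if "\<rho> \<in> parts_of n" for \<rho> using jack.scalar_definite that by blast
    then have "p_expand n (f \<nu>) = 0" by (simp add: p_expand_def)
    then show False using jack_nonzero[OF that(1)] f[OF that] by simp
  qed
  have dep: "u \<nu> = 0" if z: "(\<Sum>\<nu>\<in>U. mps_scale (u \<nu>) (J \<nu>)) = 0" and \<nu>: "\<nu> \<in> U" for u \<nu>
  proof -
    define h where "h \<rho> = (\<Sum>\<nu>\<in>U. u \<nu> * f \<nu> \<rho>)" for \<rho>
    have "p_expand n h = (\<Sum>\<nu>\<in>U. mps_scale (u \<nu>) (J \<nu>))"
      unfolding h_def p_expand_sum p_expand_scale mps_const_mult using f
          by (intro sum.cong) (auto simp: U_def)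
    then have "p_expand n h = p_expand n (\<lambda>_. 0)" unfolding z by (intro mps_eqI) (simp add: p_expand_def)
    then have "jack.scalar n (f \<nu>) h = jack.scalar n (f \<nu>) (\<lambda>_. 0)" by (metis jack_scalar_p_expand)
    then have "0 = (\<Sum>\<mu>\<in>U. u \<mu> * jack.scalar n (f \<nu>) (f \<mu>))"
      unfolding h_def jack.scalar_sum_right jack.scalar_scale_right by (simp add: jack.scalar_def)
    also have "\<dots> = u \<nu> * jack.scalar n (f \<nu>) (f \<nu>)"
    proof -
      have "jack.scalar n (f \<nu>) (f \<mu>) = 0" if "\<mu> \<in> U - {\<nu>}" for \<mu>
        using orth[of \<nu> \<mu>] that \<nu> by (auto simp: U_def)
      then show ?thesis using finU \<nu> by (simp add: sum.remove[of U \<nu>])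
    qed
    finally show ?thesis using norm[of \<nu>] \<nu> by (auto simp: U_def)
  qed
  have inj: "inj_on J U"
  proof (rule inj_onI, rule ccontr)
    fix \<nu> \<mu> assume *: "\<nu> \<in> U" "\<mu> \<in> U" "J \<nu> = J \<mu>" "\<nu> \<noteq> \<mu>"
    then have "p_expand n (f \<nu>) = p_expand n (f \<mu>)" using f by (auto simp: U_def)
    then have "jack.scalar n (f \<nu>) (f \<nu>) = jack.scalar n (f \<nu>) (f \<mu>)" by (metis jack_scalar_p_expand)
    then show False using * orth[of \<nu> \<mu>] norm[of \<nu>] by (auto simp: U_def)
  qed
  have indep: "mps.independent (J ` U)"
  proof (rule mps.independent_if_scalars_zero)
    show "finite (J ` U)" using finU by simp
    fix u :: "ratfun mps \<Rightarrow> ratfun" and x assume "(\<Sum>x\<in>J ` U. mps_scale (u x) x) = 0" "x \<in> J ` U"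
    then show "u x = 0" using dep[of "u \<circ> J"] by (auto simp: sum.reindex[OF inj])
  qed
  let ?M = "monomial_sym ` U :: ratfun mps set"
  have sub: "J ` U \<subseteq> mps.span ?M"
  proof
    fix x assume "x \<in> J ` U"
    then obtain \<nu> where \<nu>: "\<nu> \<in> U" "x = J \<nu>" by auto
    have "J \<nu> \<in> mps.span (monomial_sym ` {\<mu>\<in>partitions. dominated \<mu> \<nu>})"
      using J \<nu> unfolding jack_family_def U_def by blast
    moreover have "{\<mu>\<in>partitions. dominated \<mu> \<nu>} \<subseteq> U"
      using \<nu> dominated_length[of \<nu>] by (fastforce simp: U_def dominated_def)
    ultimately show "x \<in> mps.span ?M" using \<nu>(2) mps.span_mono[OF image_mono] by blast
  qed
  \<comment> \<open>Otherwise adding one monomial function to the Jack functions gives too many independent elements.\<close>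
  have span: "?M \<subseteq> mps.span (J ` U)"
  proof (rule subsetI, rule ccontr)
    fix m assume m: "m \<in> ?M" "m \<notin> mps.span (J ` U)"
    then have "mps.independent (insert m (J ` U))" using indep by (simp add: mps.independent_insertI)
    moreover have "insert m (J ` U) \<subseteq> mps.span ?M" using sub mps.span_base[OF m(1)]
        by (intro insert_subsetI)
    ultimately have "card (insert m (J ` U)) \<le> card ?M"
      using mps.independent_span_bound[of ?M] finU by blast
    moreover have "m \<notin> J ` U" using m mps.span_base by blast
    ultimately have "Suc (card U) \<le> card ?M" using finU by (simp add: card_image[OF inj])
    then show False using card_image_le[OF finU, of "monomial_sym :: _ \<Rightarrow> ratfun mps"] by simp
  qed
  have "p_expand n g \<in> mps.span ?M"
  proof (subst p_expand_monomial_expansion, rule mps.span_sum)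
    fix M assume M: "M \<in> parts_of n"
    then have "0 \<notin># M" by (simp add: parts_of_def)
    from expo_type_surj[OF this] have some: "expo_type (SOME a. expo_type a = M) = M" by (rule someI_ex)
    show "mps_scale (mps_coeff (p_expand n g) (SOME a. expo_type a = M)) (monomial_mset M) \<in> mps.span ?M"
    proof (cases "size M \<le> p")
      case True
      then have "mps_coeff (p_expand n g) (SOME a. expo_type a = M) = 0"
        using g some unfolding vanishes_on_def by (metis size_expo_type)
      then show ?thesis by (simp add: mps.span_zero)
    next
      case False
      have "partition_of M \<in> U"
      proof -
        have "length (partition_of M) = size M" by (metis mset_partition_of size_mset)
        moreover have "sum_list (partition_of M) = n"
          using M by (simp add: parts_of_def flip: sum_mset_sum_list)
        ultimately show ?thesis using False \<open>0 \<notin># M\<close> by (simp add: U_def partition_of_in_partitions)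
      qed
      then have "monomial_mset M \<in> ?M" unfolding image_iff
          by (intro bexI[of _ "partition_of M"]) (simp_all add: monomial_sym_eq)
      then show ?thesis by (intro mps.span_scale mps.span_base)
    qed
  qed
  then have "p_expand n g \<in> mps.span (J ` U)"
    using mps.span_minimal[OF span mps.subspace_span] by blast
  then have "\<exists>h. p_expand n g = p_expand n h \<and> jack.scalar n F h = 0"
  proof (induction rule: mps.span_induct_alt)
    case base
    show ?case by (intro exI[of _ "\<lambda>_. 0"]) (auto intro: mps_eqI simp: p_expand_def jack.scalar_def)
  next
    case (step c x y)
    then obtain h where h: "y = p_expand n h" "jack.scalar n F h = 0" by auto
    obtain \<nu> where \<nu>: "\<nu> \<in> U" "x = J \<nu>" using step by auto
    then have "\<nu> \<noteq> \<kappa>" using \<kappa> by (auto simp: U_def)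
    then have "jack_scalar (J \<kappa>) (J \<nu>) = 0" using J \<kappa> \<nu> unfolding jack_family_def U_def by auto
    then have "jack.scalar n F (f \<nu>) = 0" using f[of \<nu>] \<nu> F by (simp add: U_def jack_scalar_p_expand)
    then show ?case
      using h \<nu> f[of \<nu>] by (intro exI[of _ "\<lambda>\<rho>. c * f \<nu> \<rho> + h \<rho>"])
        (simp add: U_def p_expand_add p_expand_scale mps_const_mult jack.scalar_linear)
  qed
  then show ?thesis by (metis jack_scalar_p_expand)
qed

end

section \<open>Polynomials with nonnegative coefficients\<close>

lemma eval_poly3_superset:
  assumes "finite S" "keys P \<subseteq> S"
  shows "eval_poly3 P x y z = (\<Sum>(i, j, k)\<in>S. of_rat (lookup P (i, j, k)) * x ^ i * y ^ j * z ^ k)"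
  unfolding eval_poly3_def using assms by (intro sum.mono_neutral_left) (auto simp: in_keys_iff)

lemma eval_poly3_add: "eval_poly3 (P + Q) x y z = eval_poly3 P x y z + eval_poly3 Q x y z"
proof -
  let ?S = "keys P \<union> keys Q"
  have "keys (P + Q) \<subseteq> ?S" by (rule keys_add)
  then show ?thesis
    by (simp add: eval_poly3_superset[of ?S] lookup_add of_rat_add sum.distrib[symmetric]
        case_prod_unfold algebra_simps)
qed

lemma eval_poly3_0 [simp]: "eval_poly3 0 x y z = 0"
  by (simp add: eval_poly3_def)

lemma eval_poly3_sum: "eval_poly3 (\<Sum>i\<in>S. P i) x y z = (\<Sum>i\<in>S. eval_poly3 (P i) x y z)"
  by (induction S rule: infinite_finite_induct) (simp_all add: eval_poly3_add)

lemma eval_poly3_single: "eval_poly3 (single (i, j, k) c) x y z = of_rat c * x ^ i * y ^ j * z ^ k"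
  by (subst eval_poly3_superset[of "{(i, j, k)}"]) auto

text \<open>
  Both the evaluation of a product and the signs of its coefficients are read off from this double
  sum.
\<close>

lemma poly3_mult_expand:
  "(P :: poly3) * Q = (\<Sum>s\<in>keys P. \<Sum>t\<in>keys Q. single (s + t) (lookup P s * lookup Q t))"
proof -
  have expand: "(\<Sum>s\<in>keys P. single s (lookup P s)) = P" for P :: poly3
    by (rule poly_mapping_eqI) (auto simp: lookup_sum lookup_single when_def in_keys_iff)
  have "P * Q = (\<Sum>s\<in>keys P. single s (lookup P s)) * (\<Sum>t\<in>keys Q. single t (lookup Q t))"
    by (simp add: expand)
  then show ?thesis by (simp add: sum_product mult_single)
qed

lemma eval_poly3_mult: "eval_poly3 (P * Q) x y z = eval_poly3 P x y z * eval_poly3 Q x y z"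
  unfolding poly3_mult_expand eval_poly3_sum sum_product eval_poly3_def[of P] eval_poly3_def[of Q]
  by (intro sum.cong refl) (auto simp: eval_poly3_single of_rat_mult power_add algebra_simps)

definition nonneg_poly3 :: "poly3 \<Rightarrow> bool" where
  "nonneg_poly3 P \<longleftrightarrow> (\<forall>e. lookup P e \<ge> 0)"

lemma nonneg_poly3_add: "nonneg_poly3 P \<Longrightarrow> nonneg_poly3 Q \<Longrightarrow> nonneg_poly3 (P + Q)"
  by (simp add: nonneg_poly3_def lookup_add)

lemma nonneg_poly3_sum: "(\<And>i. i \<in> S \<Longrightarrow> nonneg_poly3 (P i)) \<Longrightarrow> nonneg_poly3 (\<Sum>i\<in>S. P i)"
  by (auto simp: nonneg_poly3_def lookup_sum intro: sum_nonneg)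

lemma nonneg_poly3_single: "c \<ge> 0 \<Longrightarrow> nonneg_poly3 (single e c)"
  by (simp add: nonneg_poly3_def lookup_single when_def)

lemma nonneg_poly3_mult: "nonneg_poly3 P \<Longrightarrow> nonneg_poly3 Q \<Longrightarrow> nonneg_poly3 (P * Q)"
  unfolding poly3_mult_expand
  by (intro nonneg_poly3_sum nonneg_poly3_single mult_nonneg_nonneg) (auto simp: nonneg_poly3_def)

lemmas nonneg_poly3_intros = nonneg_poly3_add nonneg_poly3_sum nonneg_poly3_mult nonneg_poly3_single

context jack_parameter
begin

section \<open>The recurrence and its positive solution\<close>

text \<open>
  The recurrence for the normalized coefficients of the Jack function of $p\times q$, with $n=pq$:
  for $\rho$ without parts equal to $1$, \<open>X \<rho>\<close> is $z_\rho$ times the coefficient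
  of $p_{\rho,1^{n-|\rho|}}$, and parts equal to $1$ are stripped by the second clause. The third
  clause expresses a part $k+1\ge2$ through multisets of weight smaller by one.
\<close>

definition removal_recurrence :: "nat \<Rightarrow> nat \<Rightarrow> (nat multiset \<Rightarrow> 'k) \<Rightarrow> bool" where
  "removal_recurrence p q X \<longleftrightarrow> X {#} = 1 \<and>
     (\<forall>\<rho>. 0 \<notin># \<rho> \<longrightarrow> sum_mset \<rho> < p * q \<longrightarrow> X (add_mset 1 \<rho>) = (of_nat (p * q) - of_nat (sum_mset \<rho>)) * X \<rho>) \<and>
     (\<forall>\<tau> k. 0 \<notin># \<tau> \<longrightarrow> 1 \<notin># \<tau> \<longrightarrow> 0 < k \<longrightarrow> Suc k + sum_mset \<tau> \<le> p * q \<longrightarrow>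
        X (add_mset (Suc k) \<tau>) =
          - ((\<Sum>j\<in>set_mset \<tau>. of_nat (j * count \<tau> j) * X (add_mset (k + j) (\<tau> - {#j#})))
             + \<alpha> * (\<Sum>i\<in>{1..<k}. X (add_mset i (add_mset (k - i) \<tau>)))
             + (of_nat k * (\<alpha> - 1) - (\<alpha> * of_nat q - of_nat p)) * X (add_mset k \<tau>)))"

text \<open>
  Every step lowers the weight by one, so the factor $(-1)^{|\rho|}$ turns the minus sign of the
  third clause into a plus sign. All other factors are positive in $x=p$, $y=-q$, $z=\alpha-1$:
  $\alpha=1+z$, $k(\alpha-1)-(\alpha q-p)=kz+(1+z)y+x$ and $|\rho|-pq=|\rho|+xy$.
\<close>

lemma removal_recurrence_positive:
  assumes "0 \<notin># \<rho>"
  shows "\<exists>P. nonneg_poly3 P \<and> (\<forall>p q X. removal_recurrence p q X \<longrightarrow> sum_mset \<rho> \<le> p * q \<longrightarrow>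
    (- 1) ^ sum_mset \<rho> * X \<rho> = eval_poly3 P (of_nat p) (- of_nat q) (\<alpha> - 1))"
  using assms
proof (induction "sum_mset \<rho>" arbitrary: \<rho> rule: less_induct)
  case less
  define good where "good \<rho> P \<longleftrightarrow> nonneg_poly3 P \<and> (\<forall>p q X. removal_recurrence p q X \<longrightarrow> sum_mset \<rho> \<le> p * q \<longrightarrow>
    (- 1) ^ sum_mset \<rho> * X \<rho> = eval_poly3 P (of_nat p) (- of_nat q) (\<alpha> - 1))" for \<rho> P
  obtain Q where "\<forall>\<sigma>\<in>{\<sigma>. sum_mset \<sigma> < sum_mset \<rho> \<and> 0 \<notin># \<sigma>}. good \<sigma> (Q \<sigma>)"
    using less(1) unfolding good_def[symmetric] by (metis (no_types, lifting) mem_Collect_eq)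
  then have Q: "good \<sigma> (Q \<sigma>)" if "sum_mset \<sigma> < sum_mset \<rho>" "0 \<notin># \<sigma>" for \<sigma> using that by auto
  have Q_nonneg: "nonneg_poly3 (Q \<sigma>)" if "sum_mset \<sigma> < sum_mset \<rho>" "0 \<notin># \<sigma>" for \<sigma>
    using Q[OF that] by (simp add: good_def)
  have Q_eval: "(- 1) ^ sum_mset \<sigma> * X \<sigma> = eval_poly3 (Q \<sigma>) (of_nat p) (- of_nat q) (\<alpha> - 1)"
    if "sum_mset \<sigma> < sum_mset \<rho>" "0 \<notin># \<sigma>" "removal_recurrence p q X" "sum_mset \<rho> \<le> p * q" for \<sigma> p q X
    using Q[OF that(1,2)] that(1,3,4) by (auto simp: good_def)
  let ?x = "single (1, 0, 0) 1 :: poly3"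
  let ?y = "single (0, 1, 0) 1 :: poly3"
  let ?z = "single (0, 0, 1) 1 :: poly3"
  let ?c = "\<lambda>n. single (0, 0, 0) (of_nat n) :: poly3"
  note eval = eval_poly3_add eval_poly3_mult eval_poly3_sum eval_poly3_single
  have "\<exists>P. good \<rho> P"
  proof (cases "1 \<in># \<rho>")
    case True
    then obtain \<sigma> where \<rho>: "\<rho> = add_mset 1 \<sigma>" by (meson multi_member_split)
    have \<sigma>: "sum_mset \<sigma> < sum_mset \<rho>" "0 \<notin># \<sigma>" using less.prems by (auto simp: \<rho>)
    have "good \<rho> ((?x * ?y + ?c (sum_mset \<sigma>)) * Q \<sigma>)"
      unfolding good_def
    proof (intro conjI allI impI)
      show "nonneg_poly3 ((?x * ?y + ?c (sum_mset \<sigma>)) * Q \<sigma>)"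
        by (intro nonneg_poly3_intros Q_nonneg \<sigma> of_nat_0_le_iff zero_le_one)
      fix p q X assume X: "removal_recurrence p q X" and le: "sum_mset \<rho> \<le> p * q"
      define s where "s = sum_mset \<sigma>"
      have s: "sum_mset \<rho> = Suc s" by (simp add: \<rho> s_def)
      have X1: "X \<rho> = (of_nat (p * q) - of_nat s) * X \<sigma>"
        using X \<sigma> le unfolding removal_recurrence_def \<rho> s_def by auto
      have "(- 1) ^ sum_mset \<rho> * X \<rho> = (of_nat s - of_nat p * of_nat q) * ((- 1) ^ s * X \<sigma>)"
        unfolding s X1 by (simp add: algebra_simps)
      then show "(- 1) ^ sum_mset \<rho> * X \<rho> =
          eval_poly3 ((?x * ?y + ?c (sum_mset \<sigma>)) * Q \<sigma>) (of_nat p) (- of_nat q) (\<alpha> - 1)"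
        using Q_eval[OF \<sigma> X le] unfolding s_def[symmetric] by (simp add: eval)
    qed
    then show ?thesis by blast
  next
    case no_one: False
    show ?thesis
    proof (cases \<rho>)
      case empty
      have "good \<rho> (?c 1)"
        unfolding good_def empty by (auto simp: eval removal_recurrence_def intro: nonneg_poly3_single)
      then show ?thesis by blast
    next
      case (add m \<tau>)
      define k where "k = m - 1"
      have m: "m = Suc k" "0 < k" using less.prems no_one add by (auto simp: k_def)
      have \<rho>: "\<rho> = add_mset (Suc k) \<tau>" using add m by simp
      have \<tau>: "0 \<notin># \<tau>" "1 \<notin># \<tau>" using less.prems no_one add by auto
      define M where "M = k + sum_mset \<tau>"
      have s\<rho>: "sum_mset \<rho> = Suc M" by (simp add: \<rho> M_def)
      have s1: "sum_mset (add_mset (k + j) (\<tau> - {#j#})) = M" "0 \<notin># add_mset (k + j) (\<tau> - {#j#})"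
          if "j \<in># \<tau>" for j
        using that \<tau> m by (auto simp: M_def sum_mset.remove dest: in_diffD)
      have s2: "sum_mset (add_mset i (add_mset (k - i) \<tau>)) = M" "0 \<notin># add_mset i (add_mset (k - i) \<tau>)"
          if "i \<in> {1..<k}" for i
        using that \<tau> by (auto simp: M_def)
      have s3: "sum_mset (add_mset k \<tau>) = M" "0 \<notin># add_mset k \<tau>" using \<tau> m by (auto simp: M_def)
      have Q': "nonneg_poly3 (Q \<sigma>)" if "sum_mset \<sigma> = M" "0 \<notin># \<sigma>" for \<sigma>
        using that by (intro Q_nonneg) (simp_all add: s\<rho>)
      define P where "P = (\<Sum>j\<in>set_mset \<tau>. ?c (j * count \<tau> j) * Q (add_mset (k + j) (\<tau> - {#j#})))
         + (?c 1 + ?z) * (\<Sum>i\<in>{1..<k}. Q (add_mset i (add_mset (k - i) \<tau>)))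
         + (?c k * ?z + (?c 1 + ?z) * ?y + ?x) * Q (add_mset k \<tau>)"
      have "good \<rho> P"
        unfolding good_def
      proof (intro conjI allI impI)
        show "nonneg_poly3 P"
          unfolding P_def
          by (intro nonneg_poly3_intros Q' s1 s2 s3 of_nat_0_le_iff zero_le_one; assumption?)
        fix p q X assume X: "removal_recurrence p q X" and le: "sum_mset \<rho> \<le> p * q"
        have p_expand: "eval_poly3 (Q \<sigma>) (of_nat p) (- of_nat q) (\<alpha> - 1) = (- 1) ^ M * X \<sigma>"
            if "sum_mset \<sigma> = M" "0 \<notin># \<sigma>" for \<sigma>
          using Q_eval[OF _ that(2) X le] that(1) s\<rho> by simp
        have X1: "X \<rho> = - ((\<Sum>j\<in>set_mset \<tau>. of_nat (j * count \<tau> j) * X (add_mset (k + j) (\<tau> - {#j#})))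
             + \<alpha> * (\<Sum>i\<in>{1..<k}. X (add_mset i (add_mset (k - i) \<tau>)))
             + (of_nat k * (\<alpha> - 1) - (\<alpha> * of_nat q - of_nat p)) * X (add_mset k \<tau>))"
          using X \<tau> m(2) le unfolding removal_recurrence_def \<rho> by auto
        have "(- 1) ^ sum_mset \<rho> * X \<rho> =
            (\<Sum>j\<in>set_mset \<tau>. of_nat (j * count \<tau> j) * ((- 1) ^ M * X (add_mset (k + j) (\<tau> - {#j#}))))
             + \<alpha> * (\<Sum>i\<in>{1..<k}. (- 1) ^ M * X (add_mset i (add_mset (k - i) \<tau>)))
             + (of_nat k * (\<alpha> - 1) - (\<alpha> * of_nat q - of_nat p)) * ((- 1) ^ M * X (add_mset k \<tau>))"
          unfolding s\<rho> X1 by (simp add: sum_distrib_left sum_negf algebra_simps)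
        also have "\<dots> = (\<Sum>j\<in>set_mset \<tau>. of_nat (j * count \<tau> j)
            * eval_poly3 (Q (add_mset (k + j) (\<tau> - {#j#}))) (of_nat p) (- of_nat q) (\<alpha> - 1))
             + \<alpha> * (\<Sum>i\<in>{1..<k}. eval_poly3 (Q (add_mset i (add_mset (k - i) \<tau>))) (of_nat p)
                 (- of_nat q) (\<alpha> - 1))
             + (of_nat k * (\<alpha> - 1) - (\<alpha> * of_nat q - of_nat p))
                 * eval_poly3 (Q (add_mset k \<tau>)) (of_nat p) (- of_nat q) (\<alpha> - 1)"
          by (intro arg_cong2[where f = "(+)"] arg_cong2[where f
              = "(*)"] sum.cong refl p_expand[symmetric] s1 s2 s3) auto
        also have "\<dots> = eval_poly3 P (of_nat p) (- of_nat q) (\<alpha> - 1)"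
          unfolding P_def eval by (simp add: of_rat_mult algebra_simps)
        finally show "(- 1) ^ sum_mset \<rho> * X \<rho> = eval_poly3 P (of_nat p) (- of_nat q) (\<alpha> - 1)" .
      qed
      then show ?thesis by blast
    qed
  qed
  then show ?case by (simp add: good_def)
qed

text \<open>
  Multiplying each coefficient by the $z$ of its partition removes the factors of
  \<open>lower\<close>: adding a part $k$ multiplies $z_\sigma$ by the factor that occurs there
  besides $\alpha$.
\<close>

lemma virasoro_scaled:
  assumes "0 \<notin># \<sigma>" "sum_mset \<sigma> = n - k" "0 < k"
  shows "of_nat (zee_mset \<sigma>) * virasoro n c k F \<sigma> = \<alpha> *
    ((\<Sum>j\<in>set_mset \<sigma>. of_nat (j * count \<sigma> j)
        * (of_nat (zee_mset (add_mset (k + j) (\<sigma> - {#j#}))) * F (add_mset (k + j) (\<sigma> - {#j#}))))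
     + \<alpha> * (\<Sum>i\<in>{1..<k}. of_nat (zee_mset (add_mset i (add_mset (k - i) \<sigma>)))
         * F (add_mset i (add_mset (k - i) \<sigma>)))
     + (of_nat k * (\<alpha> - 1) - c) * (of_nat (zee_mset (add_mset k \<sigma>)) * F (add_mset k \<sigma>)))"
proof -
  have 1: "of_nat (zee_mset \<sigma>) * lower k F \<sigma>
      = \<alpha> * (of_nat (zee_mset (add_mset k \<sigma>)) * F (add_mset k \<sigma>))" for k \<sigma>
    by (simp add: lower_def algebra_simps)
  have 2: "of_nat (zee_mset \<sigma>) * lower i (lower (k - i) F) \<sigma>
      = \<alpha> * (\<alpha> * (of_nat (zee_mset (add_mset i (add_mset (k - i) \<sigma>)))
      * F (add_mset i (add_mset (k - i) \<sigma>))))" for i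
  proof -
    have "of_nat (zee_mset \<sigma>) * lower i (lower (k - i) F) \<sigma>
        = \<alpha> * (of_nat (zee_mset (add_mset i \<sigma>)) * lower (k - i) F (add_mset i \<sigma>))"
      unfolding lower_def[of i] by (simp add: algebra_simps)
    also have "\<dots> = \<alpha> * (\<alpha> * (of_nat (zee_mset (add_mset (k - i) (add_mset i \<sigma>)))
        * F (add_mset (k - i) (add_mset i \<sigma>))))"
      unfolding 1 ..
    finally show ?thesis by (simp only: add_mset_commute)
  qed
  have 3: "of_nat (zee_mset \<sigma>) * raise j (lower (k + j) F) \<sigma> =
     \<alpha> * (of_nat (j * count \<sigma> j) * (of_nat (zee_mset (add_mset (k + j) (\<sigma> - {#j#})))
         * F (add_mset (k + j) (\<sigma> - {#j#}))))" if "j \<in># \<sigma>" for j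
  proof -
    from multi_member_split[OF that] obtain \<tau> where \<tau>: "\<sigma> = add_mset j \<tau>" ..
    have "of_nat (zee_mset \<sigma>) * raise j (lower (k + j) F) \<sigma>
        = of_nat (j * count \<sigma> j) * (of_nat (zee_mset \<tau>) * lower (k + j) F \<tau>)"
      by (simp add: \<tau> raise_def algebra_simps)
    then show ?thesis unfolding 1 by (simp add: \<tau> del: zee_mset_add_mset)
  qed
  have 4: "(\<Sum>j\<in>{1..n - k}. of_nat (zee_mset \<sigma>) * raise j (lower (k + j) F) \<sigma>) =
    (\<Sum>j\<in>set_mset \<sigma>. \<alpha> * (of_nat (j * count \<sigma> j)
        * (of_nat (zee_mset (add_mset (k + j) (\<sigma> - {#j#}))) * F (add_mset (k + j) (\<sigma> - {#j#})))))"
  proof (rule sum.mono_neutral_cong_right)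
    show "set_mset \<sigma> \<subseteq> {1..n - k}"
    proof
      fix j assume "j \<in># \<sigma>"
      then have "0 < j" "j \<le> sum_mset \<sigma>" using assms(1) by (auto simp: sum_mset.remove intro: Suc_leI gr0I)
      then show "j \<in> {1..n - k}" using assms(2) by simp
    qed
    fix j assume "j \<in># \<sigma>"
    then show "of_nat (zee_mset \<sigma>) * raise j (lower (k + j) F) \<sigma> =
     \<alpha> * (of_nat (j * count \<sigma> j) * (of_nat (zee_mset (add_mset (k + j) (\<sigma> - {#j#})))
         * F (add_mset (k + j) (\<sigma> - {#j#}))))"
      by (rule 3)
  qed (auto simp: raise_def)
  have "of_nat (zee_mset \<sigma>) * virasoro n c k F \<sigma> =
    (\<Sum>j\<in>{1..n - k}. of_nat (zee_mset \<sigma>) * raise j (lower (k + j) F) \<sigma>)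
     + (\<Sum>i\<in>{1..<k}. of_nat (zee_mset \<sigma>) * lower i (lower (k - i) F) \<sigma>)
     + (of_nat k * (\<alpha> - 1) - c) * (of_nat (zee_mset \<sigma>) * lower k F \<sigma>)"
    by (simp add: virasoro_def distrib_left sum_distrib_left mult.left_commute)
  then show ?thesis
    unfolding 4 2 1 by (simp only: sum_distrib_left distrib_left mult.left_commute)
qed

text \<open>
  The coefficient of $L_kF=0$ at $p_{\tau,1^s}$, with $s$ chosen by the degree: the $s$ parts
  equal to $1$ yield the term in which one of them is enlarged to $k+1$, and this term is solved
  for.
\<close>

lemma virasoro_imp_removal_recurrence:
  assumes virasoro: "\<And>k \<sigma>. 1 \<le> k \<Longrightarrow> k \<le> p * q \<Longrightarrow> \<sigma> \<in> parts_of (p * q - k) \<Longrightarrow>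
      virasoro (p * q) (\<alpha> * of_nat q - of_nat p) k F \<sigma> = 0"
    and F1: "F (replicate_mset (p * q) 1) = 1"
  shows "removal_recurrence p q (\<lambda>\<rho>. of_nat (zee_mset (\<rho> + replicate_mset (p * q - sum_mset \<rho>) 1)) *
     F (\<rho> + replicate_mset (p * q - sum_mset \<rho>) 1) / fact (p * q - sum_mset \<rho>))"
proof -
  define n where "n = p * q"
  define \<phi> where "\<phi> \<rho> = of_nat (zee_mset \<rho>) * F \<rho>" for \<rho>
  define X where "X \<rho> = \<phi> (\<rho> + replicate_mset (n - sum_mset \<rho>) 1) / fact (n - sum_mset \<rho>)" for \<rho>
  have zee_mset1: "zee_mset (replicate_mset m 1) = fact m" for m
    by (induction m) (simp_all add: algebra_simps)
  have "X {#} = 1" using F1 by (simp add: X_def \<phi>_def zee_mset1[simplified] n_def)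
  moreover have "X (add_mset 1 \<rho>) = (of_nat n - of_nat (sum_mset \<rho>)) * X \<rho>" if "sum_mset \<rho> < n" for \<rho>
  proof -
    define s where "s = n - Suc (sum_mset \<rho>)"
    have s: "n - sum_mset \<rho> = Suc s" using that by (simp add: s_def)
    have s': "n - sum_mset (add_mset 1 \<rho>) = s" using s by simp
    have "of_nat n - of_nat (sum_mset \<rho>) = (of_nat (Suc s) :: 'k)" using that s
        by (metis of_nat_diff less_imp_le)
    then show ?thesis unfolding X_def s s' by (simp add: field_simps del: of_nat_Suc)
  qed
  moreover have "X (add_mset (Suc k) \<tau>) =
          - ((\<Sum>j\<in>set_mset \<tau>. of_nat (j * count \<tau> j) * X (add_mset (k + j) (\<tau> - {#j#})))
             + \<alpha> * (\<Sum>i\<in>{1..<k}. X (add_mset i (add_mset (k - i) \<tau>)))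
             + (of_nat k * (\<alpha> - 1) - (\<alpha> * of_nat q - of_nat p)) * X (add_mset k \<tau>))"
    if \<tau>: "0 \<notin># \<tau>" "1 \<notin># \<tau>" and k: "0 < k" and le: "Suc k + sum_mset \<tau> \<le> n" for \<tau> k
  proof -
    define s where "s = n - (k + sum_mset \<tau>)"
    have s: "0 < s" "n = s + k + sum_mset \<tau>" using le by (auto simp: s_def)
    let ?I = "replicate_mset s 1 :: nat multiset"
    define \<sigma> where "\<sigma> = \<tau> + ?I"
    have \<sigma>: "0 \<notin># \<sigma>" "sum_mset \<sigma> = n - k" using \<tau> s by (auto simp: \<sigma>_def sum_mset_replicate_mset)
    have "\<alpha> * ((\<Sum>j\<in>set_mset \<sigma>. of_nat (j * count \<sigma> j) * \<phi> (add_mset (k + j) (\<sigma> - {#j#})))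
     + \<alpha> * (\<Sum>i\<in>{1..<k}. \<phi> (add_mset i (add_mset (k - i) \<sigma>)))
     + (of_nat k * (\<alpha> - 1) - (\<alpha> * of_nat q - of_nat p)) * \<phi> (add_mset k \<sigma>)) = 0"
      using virasoro_scaled[OF \<sigma> k, of "\<alpha> * of_nat q - of_nat p" F] virasoro[of k \<sigma>] k s(2) \<sigma>
      unfolding \<phi>_def n_def parts_of_def by simp
    then have E: "(\<Sum>j\<in>set_mset \<sigma>. of_nat (j * count \<sigma> j) * \<phi> (add_mset (k + j) (\<sigma> - {#j#})))
     + \<alpha> * (\<Sum>i\<in>{1..<k}. \<phi> (add_mset i (add_mset (k - i) \<sigma>)))
     + (of_nat k * (\<alpha> - 1) - (\<alpha> * of_nat q - of_nat p)) * \<phi> (add_mset k \<sigma>) = 0"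
      using alpha_pos by simp
    have phi: "\<phi> (\<rho> + ?I) = fact s * X \<rho>" if "sum_mset \<rho> = k + sum_mset \<tau>" for \<rho>
      unfolding X_def that by (simp add: s_def)
    have set\<sigma>: "set_mset \<sigma> = insert 1 (set_mset \<tau>)" using s by (auto simp: \<sigma>_def)
    have "(\<Sum>j\<in>set_mset \<sigma>. of_nat (j * count \<sigma> j) * \<phi> (add_mset (k + j) (\<sigma> - {#j#}))) =
      of_nat s * \<phi> (add_mset (k + 1) (\<sigma> - {#1#}))
          + (\<Sum>j\<in>set_mset \<tau>. of_nat (j * count \<sigma> j) * \<phi> (add_mset (k + j) (\<sigma> - {#j#})))"
    proof -
      have "count \<sigma> 1 = s" using \<tau>(2) by (simp add: \<sigma>_def not_in_iff)
      then show ?thesis unfolding set\<sigma> using \<tau>(2) by simp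
    qed
    also have "of_nat s * \<phi> (add_mset (k + 1) (\<sigma> - {#1#})) = fact s * X (add_mset (Suc k) \<tau>)"
    proof -
      obtain s' where s': "s = Suc s'" using s by (cases s) auto
      have "n - sum_mset (add_mset (Suc k) \<tau>) = s'" using s s' by simp
      then show ?thesis unfolding X_def s' by (simp add: \<sigma>_def s')
    qed
    also have "(\<Sum>j\<in>set_mset \<tau>. of_nat (j * count \<sigma> j) * \<phi> (add_mset (k + j) (\<sigma> - {#j#}))) =
      (\<Sum>j\<in>set_mset \<tau>. of_nat (j * count \<tau> j) * (fact s * X (add_mset (k + j) (\<tau> - {#j#}))))"
    proof (rule sum.cong[OF refl])
      fix j assume j: "j \<in># \<tau>"
      then have "j \<noteq> 1" using \<tau>(2) by auto
      then have c: "count \<sigma> j = count \<tau> j" by (simp add: \<sigma>_def)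
      have "add_mset (k + j) (\<sigma> - {#j#}) = add_mset (k + j) (\<tau> - {#j#}) + ?I"
        using j by (simp add: \<sigma>_def)
      moreover have "sum_mset (add_mset (k + j) (\<tau> - {#j#})) = k + sum_mset \<tau>"
        using j by (simp add: sum_mset.remove)
      ultimately show "of_nat (j * count \<sigma> j) * \<phi> (add_mset (k + j) (\<sigma> - {#j#}))
          = of_nat (j * count \<tau> j) * (fact s * X (add_mset (k + j) (\<tau> - {#j#})))"
        unfolding c by (metis phi)
    qed
    finally have e1: "(\<Sum>j\<in>set_mset \<sigma>. of_nat (j * count \<sigma> j) * \<phi> (add_mset (k + j) (\<sigma> - {#j#}))) =
      fact s * X (add_mset (Suc k) \<tau>) + (\<Sum>j\<in>set_mset \<tau>. of_nat (j * count \<tau> j)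
          * (fact s * X (add_mset (k + j) (\<tau> - {#j#}))))" .
    have e2: "(\<Sum>i\<in>{1..<k}. \<phi> (add_mset i (add_mset (k - i) \<sigma>)))
        = (\<Sum>i\<in>{1..<k}. fact s * X (add_mset i (add_mset (k - i) \<tau>)))"
    proof (rule sum.cong[OF refl])
      fix i assume "i \<in> {1..<k}"
      then show "\<phi> (add_mset i (add_mset (k - i) \<sigma>)) = fact s * X (add_mset i (add_mset (k - i) \<tau>))"
        using phi[of "add_mset i (add_mset (k - i) \<tau>)"] by (simp add: \<sigma>_def)
    qed
    have e3: "\<phi> (add_mset k \<sigma>) = fact s * X (add_mset k \<tau>)"
      using phi[of "add_mset k \<tau>"] by (simp add: \<sigma>_def)
    let ?R = "(\<Sum>j\<in>set_mset \<tau>. of_nat (j * count \<tau> j) * X (add_mset (k + j) (\<tau> - {#j#})))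
             + \<alpha> * (\<Sum>i\<in>{1..<k}. X (add_mset i (add_mset (k - i) \<tau>)))
             + (of_nat k * (\<alpha> - 1) - (\<alpha> * of_nat q - of_nat p)) * X (add_mset k \<tau>)"
    have "fact s * (X (add_mset (Suc k) \<tau>) + ?R) = 0"
      using E unfolding e1 e2 e3 by (simp add: sum_distrib_left algebra_simps)
    then have "X (add_mset (Suc k) \<tau>) + ?R = 0" by simp
    then show ?thesis by (simp only: eq_neg_iff_add_eq_0)
  qed
  ultimately show ?thesis
    unfolding removal_recurrence_def X_def \<phi>_def n_def by blast
qed

end

section \<open>Coefficients of rectangular Jack functions\<close>

lemma power_sum_mset_coeff_squarefree:
  "expo_type a = replicate_mset n 1 \<Longrightarrow> mps_coeff
      (power_sum_mset (replicate_mset n 1) :: 'a::linordered_field mps) a = fact n"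
proof (induction n arbitrary: a)
  case 0
  then show ?case by (simp add: mps_coeff_1 expo_type_eq_empty)
next
  case (Suc n)
  have 1: "lookup a l = 1" if "l \<in> keys a" for l
  proof -
    have "lookup a l \<in># expo_type a" using that by (auto simp: expo_type_def)
    then show ?thesis unfolding Suc.prems by (simp only: in_replicate_mset)
  qed
  have "mps_coeff (mps_var_power l 1 * power_sum_mset (replicate_mset n 1) :: 'a mps) a = fact n"
      if "l \<in> keys a" for l
  proof -
    have "expo_type (a - single l 1) = replicate_mset n 1"
      using that 1[OF that] Suc.prems by (simp add: expo_type_diff_single)
    from Suc.IH[OF this] show ?thesis using 1[OF that] by (simp only: mps_coeff_var_power_mult) simp
  qed
  moreover have "card (keys a) = Suc n"
    using arg_cong[OF Suc.prems, of size] by simp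
  ultimately show ?case
    using mps_coeff_power_sum_mult[of 1 "power_sum_mset (replicate_mset n 1) :: 'a mps" a] by simp
qed

lemma sorted_wrt_ge_replicate: "sorted_wrt (\<lambda>x y. y \<le> (x :: nat)) (replicate m q)"
  by (induction m) auto

lemma size_le_sum_mset: "0 \<notin># \<rho> \<Longrightarrow> size \<rho> \<le> sum_mset (\<rho> :: nat multiset)"
  by (induction \<rho>) auto

lemma jack_rectangle_coefficients:
  assumes J: "jack_family J" and pq: "p > 0" "q > 0"
  obtains F where "J (replicate p q) = p_expand (p * q) F"
    "jack.removal_recurrence p q (\<lambda>\<rho>. of_nat (zee_mset (\<rho> + replicate_mset (p * q - sum_mset \<rho>) 1)) *
     F (\<rho> + replicate_mset (p * q - sum_mset \<rho>) 1) / fact (p * q - sum_mset \<rho>))"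
proof -
  define n where "n = p * q"
  define \<kappa> where "\<kappa> = replicate p q"
  have \<kappa>: "\<kappa> \<in> partitions" "sum_list \<kappa> = n" "length \<kappa> = p"
    using pq by (auto simp: \<kappa>_def n_def sorted_wrt_ge_replicate partitions_def is_partition_def
        sum_list_replicate)
  obtain F where F: "J \<kappa> = p_expand n F" using jack_in_range[OF J \<kappa>(1)] \<kappa>(2) by auto
  have exp: "exponents_le q (mps_coeff (p_expand n F))"
    unfolding exponents_le_def
  proof (intro allI impI, rule ccontr)
    fix a x assume x: "lookup a x > q" and nz: "mps_coeff (p_expand n F) a \<noteq> 0"
    then obtain \<mu> where \<mu>: "\<mu> \<in> partitions" "dominated \<mu> \<kappa>" "expo_type a = mset \<mu>"
      using jack_coeff_support[OF J \<kappa>(1)] F by metis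
    have "x \<in> keys a" using x by (auto simp: in_keys_iff)
    then have "lookup a x \<in># expo_type a" by (auto simp: expo_type_def)
    then have "lookup a x \<in> set \<mu>" unfolding \<mu>(3) by simp
    then obtain h t where ht: "\<mu> = h # t" "lookup a x \<le> h"
      using \<mu>(1) by (cases \<mu>) (auto simp: partitions_def is_partition_def)
    have "sum_list (take 1 \<mu>) \<le> sum_list (take 1 \<kappa>)" using \<mu>(2) unfolding dominated_def by blast
    then have "h \<le> q" using ht(1) pq by (simp add: \<kappa>_def)
    then show False using ht x by simp
  qed
  have virasoro: "jack.virasoro (p * q) (alpha * of_nat q - of_nat p) k F \<sigma> = 0"
    if "1 \<le> k" "k \<le> p * q" "\<sigma> \<in> parts_of (p * q - k)" for k \<sigma>
    using jack.virasoro_rectangle[OF pq n_def exp jack_orthogonal_long_monomials[OF J \<kappa> F]] that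
    by (simp add: n_def)
  have "F (replicate_mset n 1) = 1"
  proof -
    let ?I = "replicate_mset n 1 :: nat multiset"
    have I: "?I \<in> parts_of n" by (simp add: parts_of_def sum_mset_replicate_mset)
    then have "0 \<notin># ?I" by (simp add: parts_of_def)
    from expo_type_surj[OF this] obtain a where a: "expo_type a = ?I" ..
    have ca: "card (keys a) = n" using arg_cong[OF a, of size] by simp
    have "F \<rho> * mps_coeff (power_sum_mset \<rho>) a = 0" if "\<rho> \<in> parts_of n - {?I}" for \<rho>
    proof (rule ccontr)
      assume "\<not> ?thesis"
      then have "mps_coeff (power_sum_mset \<rho> :: ratfun mps) a \<noteq> 0" by auto
      moreover have "0 \<notin># \<rho>" "size \<rho> \<le> n"
        using that size_le_sum_mset[of \<rho>] by (auto simp: parts_of_def)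
      ultimately show False
        using power_sum_mset_coeff_nonzero[of \<rho> a, where 'a = ratfun] a ca that by auto
    qed
    then have "(\<Sum>\<rho>\<in>parts_of n - {?I}. F \<rho> * mps_coeff (power_sum_mset \<rho>) a) = 0"
      by (intro sum.neutral ballI)
    then have "mps_coeff (p_expand n F) a = F ?I * fact n"
      using sum.remove[OF finite_parts_of I, of "\<lambda>\<rho>. F \<rho> * mps_coeff (power_sum_mset \<rho>) a"]
        power_sum_mset_coeff_squarefree[OF a, where 'a = ratfun] by (simp add: p_expand_def)
    moreover have "mps_coeff (p_expand n F) a = fact n"
      using jack_coeff_squarefree[OF J \<kappa>(1), of a] a \<kappa>(2) F by simp
    ultimately show ?thesis by simp
  qed
  then have "F (replicate_mset (p * q) 1) = 1" by (simp add: n_def)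
  from jack.virasoro_imp_removal_recurrence[OF virasoro this] F
  show ?thesis unfolding \<kappa>_def n_def by (intro that)
qed

text \<open>
  The positive polynomial of the recurrence is independent of the Jack family and of
  \<open>p\<close> and \<open>q\<close>, because the recurrence was solved uniformly in them.
\<close>

theorem theorem1:
  fixes \<mu> :: "nat list"
  assumes "is_partition \<mu>" and "count_list \<mu> 1 = 0"
  shows "\<exists>P :: poly3.
    (\<forall>e. Poly_Mapping.lookup P e \<ge> 0) \<and>
    (\<forall>J. jack_family J \<longrightarrow>
      (\<forall>p q :: nat. p > 0 \<longrightarrow> q > 0 \<longrightarrow> sum_list \<mu> \<le> p * q \<longrightarrow>
        (- 1) ^ sum_list \<mu> * of_nat (zee \<mu>) *
          power_sum_coeff (J (replicate p q)) (\<mu> @ replicate (p * q - sum_list \<mu>) 1)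
        = eval_poly3 P (of_nat p) (- of_nat q) (alpha - 1)))"
proof -
  have \<mu>0: "0 \<notin># mset \<mu>" using assms(1) by (simp add: is_partition_def)
  from jack.removal_recurrence_positive[OF this] obtain P where
    P: "nonneg_poly3 P" "\<And>p q X. jack.removal_recurrence p q X \<Longrightarrow> sum_mset (mset \<mu>) \<le> p * q \<Longrightarrow>
      (- 1) ^ sum_mset (mset \<mu>) * X (mset \<mu>) = eval_poly3 P (of_nat p) (- of_nat q) (alpha - 1)"
    by blast
  show ?thesis
  proof (intro exI[of _ P] conjI allI impI)
    show "lookup P e \<ge> 0" for e using P(1) unfolding nonneg_poly3_def by (rule spec)
    fix J and p q :: nat
    assume J: "jack_family J" and pq: "p > 0" "q > 0" and le: "sum_list \<mu> \<le> p * q"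
    define r where "r = p * q - sum_list \<mu>"
    let ?\<rho> = "mset \<mu> + replicate_mset r 1"
    obtain F where F: "J (replicate p q) = p_expand (p * q) F"
      "jack.removal_recurrence p q (\<lambda>\<rho>. of_nat (zee_mset (\<rho> + replicate_mset (p * q - sum_mset \<rho>) 1)) *
       F (\<rho> + replicate_mset (p * q - sum_mset \<rho>) 1) / fact (p * q - sum_mset \<rho>))"
      by (rule jack_rectangle_coefficients[OF J pq])
    have "zee_mset (mset \<mu> + replicate_mset m 1) = zee_mset (mset \<mu>) * fact m" for m
      using assms(2) by (induction m) (simp_all add: count_mset algebra_simps)
    then have z: "zee_mset ?\<rho> = zee \<mu> * fact r" by (simp add: zee_eq_zee_mset)
    have "\<mu> @ replicate r 1 \<in> partitions"
      using assms(1) by (auto simp: sorted_wrt_ge_replicate partitions_def is_partition_def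
          sorted_wrt_append Suc_le_eq intro!: gr0I)
    then have "power_sum_coeff (p_expand (p * q) F) (\<mu> @ replicate r 1) = F ?\<rho>"
      using le by (simp add: power_sum_coeff_p_expand r_def sum_list_replicate)
    moreover have "(- 1) ^ sum_list \<mu> * (of_nat (zee_mset ?\<rho>) * F ?\<rho> / fact r)
        = eval_poly3 P (of_nat p) (- of_nat q) (alpha - 1)"
      using P(2)[OF F(2)] le by (simp add: sum_mset_sum_list r_def)
    ultimately show "(- 1) ^ sum_list \<mu> * of_nat (zee \<mu>) *
          power_sum_coeff (J (replicate p q)) (\<mu> @ replicate (p * q - sum_list \<mu>) 1)
        = eval_poly3 P (of_nat p) (- of_nat q) (alpha - 1)"
      unfolding F(1) z r_def[symmetric] by simp
  qed
qed

end
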